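(* There is an absolute constant $C>0$ such that for arbitrary natural numbers $M,N,n$, any pair $f:\mathbb{R}^n\to\mathbb{C}^M$ and $g:\mathbb{R}^n\to\mathbb{C}^N$ of $C_c^\infty$ test functions and any $p>1$, with $q=p/(p-1)$ and $p^*=\max\{p,q\}$, we have $$\int_0^\infty\int_{\mathbb{R}^n}\|P_tf(x)\|_*\,\|P_tg(x)\|_*\,dx\,t\,dt\leq C(p^*-1)\,\|f\|_p\,\|g\|_q .$$
   Context: The Hermite operator on $\mathbb{R}^n$ is $Lu(x)=-\Delta u(x)+|x|^2u(x)$ (a positive self-adjoint operator on $L^2(\mathbb{R}^n)$), and $P_t=e^{-t\sqrt{L}}$, $t>0$, is the associated Poisson semigroup, acting componentwise on vector-valued functions. For a smooth $\mathbb{C}^N$-valued function $\phi$ on $\mathbb{R}^n\times(0,\infty)$ put $$\|\phi\|_*^2=\|\phi(x,t)\|_*^2=\Big|\frac{\partial\phi}{\partial t}(x,t)\Big|^2+\sum_{j=1}^n\Big|\frac{\partial\phi}{\partial x_j}(x,t)\Big|^2+|x|^2|\phi(x,t)|^2,$$ where derivatives are componentwise and $|\cdot|$ is the Euclidean norm; $\|P_tf(x)\|_*$ denotes this quantity for $\phi(x,t)=P_tf(x)$. The $L^p$ norm of a $\mathbb{C}^N$-valued function $\psi$ is $\big(\int_{\mathbb{R}^n}\|\psi(x)\|_{\mathbb{C}^N}^p\,dx\big)^{1/p}$. "Absolute" means that $C$ does not depend on $M,N,n,p,f,g$. *)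

theory Defs
  imports "HOL-Analysis.Analysis"
begin

text \<open>The constant in the main estimate is independent of the dimensions, so the dimensions have to
  be quantified inside the formula and cannot be types.  Points of the n-dimensional real space are
  the functions in \<open>{..<n} \<rightarrow>\<^sub>E UNIV\<close>, which is also the space of the product measure; the
  product topology of \<open>nat \<Rightarrow> real\<close> restricts to the Euclidean one there.  Vectors in complex
  N-space are functions \<open>nat \<Rightarrow> complex\<close> of which only the components below \<open>N\<close> are used.\<close>

definition Rn :: "nat \<Rightarrow> (nat \<Rightarrow> real) set" where
  "Rn n = {..<n} \<rightarrow>\<^sub>E UNIV"

definition lebesgue_Rn :: "nat \<Rightarrow> (nat \<Rightarrow> real) measure" where
  "lebesgue_Rn n = PiM {..<n} (\<lambda>_. lborel)"

lemma space_lebesgue_Rn: "space (lebesgue_Rn n) = Rn n"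
  by (simp add: lebesgue_Rn_def Rn_def space_PiM)

definition norm_Rn :: "nat \<Rightarrow> (nat \<Rightarrow> real) \<Rightarrow> real" where
  "norm_Rn n x = L2_set x {..<n}"

definition norm_CN :: "nat \<Rightarrow> (nat \<Rightarrow> complex) \<Rightarrow> real" where
  "norm_CN N v = L2_set (\<lambda>i. cmod (v i)) {..<N}"

definition partial :: "nat \<Rightarrow> ((nat \<Rightarrow> real) \<Rightarrow> complex) \<Rightarrow> (nat \<Rightarrow> real) \<Rightarrow> complex" where
  "partial j u x = vector_derivative (\<lambda>s. u (x(j := s))) (at (x j))"

definition smooth_Rn :: "nat \<Rightarrow> ((nat \<Rightarrow> real) \<Rightarrow> complex) \<Rightarrow> bool" where
  "smooth_Rn n u \<longleftrightarrow> (\<forall>js. set js \<subseteq> {..<n} \<longrightarrow>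
     continuous_on (Rn n) (foldr partial js u) \<and>
     (\<forall>x\<in>Rn n. \<forall>j<n. (\<lambda>s. foldr partial js u (x(j := s))) differentiable (at (x j))))"

definition test_function :: "nat \<Rightarrow> nat \<Rightarrow> ((nat \<Rightarrow> real) \<Rightarrow> nat \<Rightarrow> complex) \<Rightarrow> bool" where
  "test_function n N f \<longleftrightarrow>
     (\<forall>i<N. smooth_Rn n (\<lambda>x. f x i) \<and> compact (closure {x \<in> Rn n. f x i \<noteq> 0}))"

definition Lp_norm :: "nat \<Rightarrow> nat \<Rightarrow> real \<Rightarrow> ((nat \<Rightarrow> real) \<Rightarrow> nat \<Rightarrow> complex) \<Rightarrow> real" where
  "Lp_norm n N p f = (LINT x|lebesgue_Rn n. norm_CN N (f x) powr p) powr (1 / p)"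

definition hermite_op :: "nat \<Rightarrow> ((nat \<Rightarrow> real) \<Rightarrow> complex) \<Rightarrow> (nat \<Rightarrow> real) \<Rightarrow> complex" where
  "hermite_op n u x = - (\<Sum>j<n. partial j (partial j u) x) + of_real ((norm_Rn n x)\<^sup>2) * u x"

fun hermite_poly :: "nat \<Rightarrow> real \<Rightarrow> real" where
  "hermite_poly 0 x = 1"
| "hermite_poly (Suc 0) x = 2 * x"
| "hermite_poly (Suc (Suc k)) x =
     2 * x * hermite_poly (Suc k) x - 2 * real (Suc k) * hermite_poly k x"

definition hermite_fun1 :: "nat \<Rightarrow> real \<Rightarrow> real" where
  "hermite_fun1 k s = hermite_poly k s * exp (- s\<^sup>2 / 2) / sqrt (2 ^ k * fact k * sqrt pi)"

text \<open>The Hermite functions, indexed by \<open>\<alpha> \<in> {..<n} \<rightarrow>\<^sub>E UNIV\<close>, are the orthonormal basis of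
  eigenfunctions of \<open>hermite_op n\<close> in \<open>L\<^sup>2\<close>.\<close>

definition hermite_fun :: "nat \<Rightarrow> (nat \<Rightarrow> nat) \<Rightarrow> (nat \<Rightarrow> real) \<Rightarrow> real" where
  "hermite_fun n \<alpha> x = (\<Prod>i<n. hermite_fun1 (\<alpha> i) (x i))"

definition hermite_eigenvalue :: "nat \<Rightarrow> (nat \<Rightarrow> nat) \<Rightarrow> real" where
  "hermite_eigenvalue n \<alpha> = real (2 * (\<Sum>i<n. \<alpha> i) + n)"

lemma has_field_derivative_hermite_poly:
  "(hermite_poly k has_field_derivative 2 * real k * hermite_poly (k - 1) x) (at x)"
proof (induction k x rule: hermite_poly.induct)
  case (1 x)
  have "hermite_poly 0 = (\<lambda>x. 1)" by (rule ext) simp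
  then show ?case by simp
next
  case (2 x)
  have "hermite_poly (Suc 0) = (\<lambda>x. 2 * x)" by (rule ext) simp
  then show ?case by (auto intro!: derivative_eq_intros)
next
  case (3 k x)
  have eq: "hermite_poly (Suc (Suc k)) =
      (\<lambda>x. 2 * x * hermite_poly (Suc k) x - 2 * real (Suc k) * hermite_poly k x)"
    by (rule ext) simp
  have "2 * x * hermite_poly k x - 2 * real k * hermite_poly (k - 1) x = hermite_poly (Suc k) x"
    by (cases k) (auto simp: algebra_simps)
  then have *: "2 * real k * hermite_poly (k - 1) x = 2 * x * hermite_poly k x - hermite_poly (Suc k) x"
    by linarith
  have "((\<lambda>x. 2 * x * hermite_poly (Suc k) x - 2 * real (Suc k) * hermite_poly k x)
      has_field_derivative
        2 * hermite_poly (Suc k) x + 2 * x * (2 * real (Suc k) * hermite_poly k x)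
        - 2 * real (Suc k) * (2 * real k * hermite_poly (k - 1) x)) (at x)"
    using 3 by (auto intro!: derivative_eq_intros simp del: hermite_poly.simps)
  then show ?case unfolding eq * by (simp add: algebra_simps)
qed

lemma hermite_fun1_ode:
  obtains h' where
    "\<And>s. (hermite_fun1 k has_field_derivative h' s) (at s)"
    "\<And>s. (h' has_field_derivative (s\<^sup>2 - real (2 * k + 1)) * hermite_fun1 k s) (at s)"
proof -
  define c where "c = sqrt (2 ^ k * fact k * sqrt pi)"
  define h' where "h' = (\<lambda>s. (2 * real k * hermite_poly (k - 1) s - s * hermite_poly k s)
    * exp (- s\<^sup>2 / 2) / c)"
  have c: "c > 0" by (simp add: c_def)
  have eq: "hermite_fun1 k = (\<lambda>s. hermite_poly k s * exp (- s\<^sup>2 / 2) / c)"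
    by (rule ext) (simp add: hermite_fun1_def c_def)
  have 1: "(hermite_fun1 k has_field_derivative h' s) (at s)" for s
    unfolding eq h'_def
    using c by (auto intro!: derivative_eq_intros has_field_derivative_hermite_poly
        simp: field_simps power2_eq_square)
  have rec: "2 * real k * (2 * real (k - 1) * hermite_poly (k - 1 - 1) s)
      = 2 * real k * (2 * s * hermite_poly (k - 1) s - hermite_poly k s)" for s
    by (induction k s rule: hermite_poly.induct) (auto simp: algebra_simps)
  have q: "((\<lambda>s. 2 * real k * hermite_poly (k - 1) s - s * hermite_poly k s) has_field_derivative
      2 * real k * s * hermite_poly (k - 1) s - real (2 * k + 1) * hermite_poly k s) (at s)" for s
  proof -
    have "((\<lambda>s. 2 * real k * hermite_poly (k - 1) s - s * hermite_poly k s) has_field_derivative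
        2 * real k * (2 * real (k - 1) * hermite_poly (k - 1 - 1) s)
        - (hermite_poly k s + s * (2 * real k * hermite_poly (k - 1) s))) (at s)"
      by (auto intro!: derivative_eq_intros has_field_derivative_hermite_poly)
    then show ?thesis unfolding rec by (simp add: algebra_simps)
  qed
  have 2: "(h' has_field_derivative (s\<^sup>2 - real (2 * k + 1)) * hermite_fun1 k s) (at s)" for s
  proof -
    have "((\<lambda>s. exp (- s\<^sup>2 / 2) / c) has_field_derivative - s * exp (- s\<^sup>2 / 2) / c) (at s)"
      using c by (auto intro!: derivative_eq_intros simp: field_simps)
    from DERIV_mult[OF q this] show ?thesis
      unfolding eq h'_def by (simp add: algebra_simps power2_eq_square add_divide_distrib diff_divide_distrib)
  qed
  show ?thesis using that 1 2 by blast
qed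

lemma hermite_op_hermite_fun:
  "hermite_op n (\<lambda>y. of_real (hermite_fun n \<alpha> y)) x
     = of_real (hermite_eigenvalue n \<alpha> * hermite_fun n \<alpha> x)"
proof -
  have "partial j (partial j (\<lambda>y. of_real (hermite_fun n \<alpha> y))) x
      = of_real (((x j)\<^sup>2 - real (2 * \<alpha> j + 1)) * hermite_fun n \<alpha> x)" if j: "j < n" for j
  proof -
    obtain h' where
      h1: "\<And>s. (hermite_fun1 (\<alpha> j) has_field_derivative h' s) (at s)" and
      h2: "\<And>s. (h' has_field_derivative (s\<^sup>2 - real (2 * \<alpha> j + 1)) * hermite_fun1 (\<alpha> j) s) (at s)"
      by (rule hermite_fun1_ode[of "\<alpha> j"]) blast
    define P where "P = (\<lambda>y. \<Prod>i\<in>{..<n} - {j}. hermite_fun1 (\<alpha> i) (y i))"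
    have P: "P (y(j := s)) = P y" for y s
      unfolding P_def by (rule prod.cong) auto
    have split: "hermite_fun n \<alpha> y = hermite_fun1 (\<alpha> j) (y j) * P y" for y
      unfolding hermite_fun_def P_def using j by (subst prod.remove[of _ j]) auto
    have 1: "partial j (\<lambda>y. of_real (hermite_fun n \<alpha> y)) = (\<lambda>y. of_real (h' (y j) * P y))"
    proof
      fix y
      have "((\<lambda>s. hermite_fun1 (\<alpha> j) s * P y) has_real_derivative h' (y j) * P y) (at (y j))"
        using DERIV_cmult_right[OF h1] .
      then show "partial j (\<lambda>y. of_real (hermite_fun n \<alpha> y)) y = of_real (h' (y j) * P y)"
        unfolding partial_def split
        by (intro vector_derivative_at has_vector_derivative_of_real) (simp add: P)
    qed
    have "((\<lambda>s. h' s * P x) has_real_derivative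
        ((x j)\<^sup>2 - real (2 * \<alpha> j + 1)) * hermite_fun1 (\<alpha> j) (x j) * P x) (at (x j))"
      using DERIV_cmult_right[OF h2] .
    then have "partial j (\<lambda>y. of_real (h' (y j) * P y)) x
        = of_real (((x j)\<^sup>2 - real (2 * \<alpha> j + 1)) * hermite_fun1 (\<alpha> j) (x j) * P x)"
      unfolding partial_def
      by (intro vector_derivative_at has_vector_derivative_of_real) (simp add: P)
    then show ?thesis
      unfolding 1 by (simp add: split mult.assoc)
  qed
  then have "hermite_op n (\<lambda>y. of_real (hermite_fun n \<alpha> y)) x
      = of_real ((- (\<Sum>j<n. (x j)\<^sup>2 - real (2 * \<alpha> j + 1)) + (norm_Rn n x)\<^sup>2) * hermite_fun n \<alpha> x)"
    by (simp add: hermite_op_def sum_distrib_right left_diff_distrib)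
  also have "- (\<Sum>j<n. (x j)\<^sup>2 - real (2 * \<alpha> j + 1)) + (norm_Rn n x)\<^sup>2 = hermite_eigenvalue n \<alpha>"
    by (simp add: hermite_eigenvalue_def norm_Rn_def L2_set_def sum_nonneg sum_subtractf
        sum.distrib sum_distrib_left)
  finally show ?thesis .
qed

text \<open>The functional calculus of the Hermite operator: \<open>\<Phi>(L) u\<close> is the Hermite expansion of \<open>u\<close>
  with the coefficients multiplied by the values of \<open>\<Phi>\<close> at the eigenvalues.  For
  \<open>\<Phi>(\<lambda>) = exp (- t * sqrt \<lambda>)\<close> with \<open>t > 0\<close> and square-integrable \<open>u\<close> the series converges
  absolutely at every point, and the pointwise sum is the smooth representative.\<close>

definition hermite_coeff :: "nat \<Rightarrow> (nat \<Rightarrow> nat) \<Rightarrow> ((nat \<Rightarrow> real) \<Rightarrow> complex) \<Rightarrow> complex" where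
  "hermite_coeff n \<alpha> u = (LINT y|lebesgue_Rn n. u y * of_real (hermite_fun n \<alpha> y))"

definition hermite_calculus ::
  "nat \<Rightarrow> (real \<Rightarrow> real) \<Rightarrow> ((nat \<Rightarrow> real) \<Rightarrow> complex) \<Rightarrow> (nat \<Rightarrow> real) \<Rightarrow> complex" where
  "hermite_calculus n \<Phi> u x =
     (\<Sum>\<^sub>\<infinity>\<alpha>\<in>{..<n} \<rightarrow>\<^sub>E UNIV.
        of_real (\<Phi> (hermite_eigenvalue n \<alpha>)) * hermite_coeff n \<alpha> u * of_real (hermite_fun n \<alpha> x))"

definition poisson ::
  "nat \<Rightarrow> real \<Rightarrow> ((nat \<Rightarrow> real) \<Rightarrow> nat \<Rightarrow> complex) \<Rightarrow> (nat \<Rightarrow> real) \<Rightarrow> nat \<Rightarrow> complex" where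
  "poisson n t f x = (\<lambda>i. hermite_calculus n (\<lambda>l. exp (- t * sqrt l)) (\<lambda>y. f y i) x)"

definition star_norm ::
  "nat \<Rightarrow> nat \<Rightarrow> ((nat \<Rightarrow> real) \<Rightarrow> real \<Rightarrow> nat \<Rightarrow> complex) \<Rightarrow> (nat \<Rightarrow> real) \<Rightarrow> real \<Rightarrow> real" where
  "star_norm n N \<phi> x t = sqrt (
     (norm_CN N (\<lambda>i. vector_derivative (\<lambda>s. \<phi> x s i) (at t)))\<^sup>2
   + (\<Sum>j<n. (norm_CN N (\<lambda>i. partial j (\<lambda>y. \<phi> y t i) x))\<^sup>2)
   + (norm_Rn n x)\<^sup>2 * (norm_CN N (\<phi> x t))\<^sup>2)"

end

theory Submission
  imports Defs "HOL-Probability.Probability" "HOL-Real_Asymp.Real_Asymp"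
begin

text \<open>By symmetry let \<open>p \<ge> 2\<close>.  With \<open>u = P\<^sub>t f\<close> and \<open>v = P\<^sub>t g\<close> one has \<open>(\<partial>\<^sub>t\<^sup>2 + \<Delta>) u = |x|\<^sup>2 u\<close>, and likewise
  for \<open>v\<close>.  A Bellman function \<open>Q\<close> with \<open>0 \<le> Q(\<zeta>, \<eta>) \<le> C (|\<zeta>|\<^sup>p + |\<eta>|\<^sup>q)\<close> whose Hessian dominates
  \<open>(\<tau> |d\<zeta>|\<^sup>2 + |d\<eta>|\<^sup>2 / \<tau>) / (p - 1)\<close> for some \<open>\<tau>(\<zeta>, \<eta>)\<close> yields that \<open>(\<partial>\<^sub>t\<^sup>2 + \<Delta>) Q(u, v)\<close> is at least a
  constant times \<open>\<parallel>u\<parallel>\<^sub>* \<parallel>v\<parallel>\<^sub>* / (p - 1)\<close>.  Integrating against \<open>t dt dx\<close> leaves only the boundary term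
  \<open>\<integral> Q(f, g) dx\<close>, and replacing \<open>f, g\<close> by multiples turns \<open>\<parallel>f\<parallel>\<^sub>p\<^sup>p + \<parallel>g\<parallel>\<^sub>q\<^sup>q\<close> into \<open>\<parallel>f\<parallel>\<^sub>p \<parallel>g\<parallel>\<^sub>q\<close>.  All integrations
  by parts are done for finite Hermite sums, for which they are elementary.  Such sums approximate test
  functions uniformly with respect to the weight \<open>exp (- |x|\<^sup>2 / 4)\<close>, and the estimate passes to the limit by
  Fatou's lemma.\<close>

section \<open>Hermite functions in one variable\<close>

text \<open>The constant may not see M, N or n, so everything rests on a pointwise inequality
  between squared lengths: the Hessian is tested in all n + 1 directions with one and the same
  \<tau>. The part |x|^2 |u|^2 of the star norm appears because the second derivatives of u add up
  to |x|^2 u and are paired with the gradient of the Bellman function; the same Hessian bound, with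
  the derivatives of the squared lengths set to 0, controls this pairing. Where v vanishes the
  Bellman function can be singular, as q may be below 2. Shifting the squared lengths by e > 0 cures
  this but adds a constant that is not integrable over the space, so it is subtracted, and e tends
  to 0 only after the integration. The weight exp (- |x|^2 / 4) decays more slowly than the Gaussian
  in the Hermite functions and so leaves room for polynomial factors, yet it controls all Hermite
  coefficients and all L^p norms together; hence one approximating sequence serves both sides of the
  inequality. The final constant is 12 = 3 * 2 * 2: 3 from the Hessian bound, 2 from the upper bound
  of the Bellman function, 2 from adding two normalized integrals.\<close>

lemma hermite_fun1_mult_arg:
  "s * hermite_fun1 k s = sqrt (real (k + 1) / 2) * hermite_fun1 (k + 1) s
     + sqrt (real k / 2) * hermite_fun1 (k - 1) s"
proof -
  define e where "e = exp (- s\<^sup>2 / 2)"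
  define c where "c k = sqrt (2 ^ k * fact k * sqrt pi)" for k :: nat
  have c: "c k > 0" for k by (simp add: c_def)
  have h: "hermite_fun1 k s = hermite_poly k s * e / c k" for k
    by (simp add: hermite_fun1_def e_def c_def)
  have cS: "c (Suc k) = c k * sqrt (2 * real (Suc k))" for k
    unfolding c_def by (simp add: real_sqrt_mult[symmetric] algebra_simps)
  have s2: "sqrt (real (Suc k) / 2) = sqrt (2 * real (Suc k)) / 2" for k
    by (rule real_sqrt_unique) (auto simp: power_divide)
  have up: "sqrt (real (Suc k) / 2) * hermite_fun1 (Suc k) s = hermite_poly (Suc k) s * e / (2 * c k)" for k
    unfolding h cS s2 using c[of k] by (simp add: field_simps del: hermite_poly.simps of_nat_Suc)
  have down: "sqrt (real (Suc k) / 2) * hermite_fun1 k s = real (Suc k) * hermite_poly k s * e / c (Suc k)" for k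
  proof -
    have "sqrt (real (Suc k) / 2) * sqrt (2 * real (Suc k)) = real (Suc k)"
      unfolding s2 by (simp del: of_nat_Suc)
    then show ?thesis
      unfolding h cS using c[of k] by (simp add: field_simps del: hermite_poly.simps of_nat_Suc)
  qed
  show ?thesis
  proof (cases k)
    case 0
    have "sqrt (1/2) * hermite_fun1 (Suc 0) s = hermite_poly (Suc 0) s * e / (2 * c 0)"
      using up[of 0] by simp
    then show ?thesis using 0 c[of 0] by (simp add: h)
  next
    case (Suc j)
    have "hermite_poly (Suc (Suc j)) s * e / (2 * c (Suc j)) + real (Suc j) * hermite_poly j s * e / c (Suc j)
        = s * (hermite_poly (Suc j) s * e / c (Suc j))"
      using c[of "Suc j"] by (simp add: field_simps del: of_nat_Suc)
    then show ?thesis using Suc up[of "Suc j"] down[of j]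
      by (simp add: h del: hermite_poly.simps of_nat_Suc)
  qed
qed

text \<open>Lowering minus raising operator. As a combination of Hermite functions the derivative
  inherits their decay and orthogonality. For \<open>k = 0\<close> the truncated index
  \<open>k - 1\<close> is harmless, since its coefficient is 0.\<close>

definition hermite_fun1_deriv :: "nat \<Rightarrow> real \<Rightarrow> real" where
  "hermite_fun1_deriv k s = sqrt (real k / 2) * hermite_fun1 (k - 1) s
     - sqrt (real (k + 1) / 2) * hermite_fun1 (k + 1) s"

lemma has_real_derivative_hermite_fun1:
  "(hermite_fun1 k has_real_derivative hermite_fun1_deriv k s) (at s)"
proof -
  define c where "c k = sqrt (2 ^ k * fact k * sqrt pi)" for k :: nat
  have c: "c k > 0" for k by (simp add: c_def)
  have eq: "hermite_fun1 k = (\<lambda>s. hermite_poly k s * exp (- s\<^sup>2 / 2) / c k)" for k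
    by (rule ext) (simp add: hermite_fun1_def c_def)
  have "(hermite_fun1 k has_real_derivative
      2 * real k * hermite_poly (k - 1) s * exp (- s\<^sup>2 / 2) / c k - s * hermite_fun1 k s) (at s)"
    unfolding eq using c[of k]
    by (auto intro!: derivative_eq_intros has_field_derivative_hermite_poly simp: field_simps)
  also have "2 * real k * hermite_poly (k - 1) s * exp (- s\<^sup>2 / 2) / c k
      = 2 * sqrt (real k / 2) * hermite_fun1 (k - 1) s"
  proof (cases k)
    case (Suc j)
    have "c (Suc j) = c j * sqrt (2 * real (Suc j))"
      unfolding c_def by (simp add: real_sqrt_mult[symmetric] algebra_simps)
    moreover have "sqrt (real (Suc j) / 2) = sqrt (2 * real (Suc j)) / 2"
      by (rule real_sqrt_unique) (auto simp: power_divide)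
    moreover have "sqrt (2 * real (Suc j)) * sqrt (2 * real (Suc j)) = 2 * real (Suc j)"
      by (simp del: of_nat_Suc)
    ultimately show ?thesis using Suc c[of j]
      by (simp add: eq field_simps del: of_nat_Suc hermite_poly.simps)
  qed simp
  also have "2 * sqrt (real k / 2) * hermite_fun1 (k - 1) s - s * hermite_fun1 k s = hermite_fun1_deriv k s"
    unfolding hermite_fun1_mult_arg hermite_fun1_deriv_def by simp
  finally show ?thesis .
qed

lemma has_real_derivative_hermite_fun1_deriv:
  "(hermite_fun1_deriv k has_real_derivative (s\<^sup>2 - real (2 * k + 1)) * hermite_fun1 k s) (at s)"
proof -
  obtain h' where h': "\<And>s. (hermite_fun1 k has_field_derivative h' s) (at s)"
    "\<And>s. (h' has_field_derivative (s\<^sup>2 - real (2 * k + 1)) * hermite_fun1 k s) (at s)"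
    using hermite_fun1_ode[of k] by blast
  have "h' = hermite_fun1_deriv k"
    using DERIV_unique[OF h'(1) has_real_derivative_hermite_fun1] by auto
  then show ?thesis using h'(2) by simp
qed

section \<open>Gaussian decay of the Hermite functions\<close>

lemma continuous_hermite_fun1 [continuous_intros]: "continuous_on A (hermite_fun1 k)"
  by (meson DERIV_continuous_on has_field_derivative_at_within has_real_derivative_hermite_fun1)

lemma continuous_hermite_fun1_deriv [continuous_intros]: "continuous_on A (hermite_fun1_deriv k)"
  by (meson DERIV_continuous_on has_field_derivative_at_within has_real_derivative_hermite_fun1_deriv)

lemma abs_hermite_poly_bound:
  assumes "c > 0"
  shows "\<exists>K. \<forall>s. \<bar>hermite_poly k s\<bar> \<le> K * exp (c * s\<^sup>2)"
  using assms
proof (induction k arbitrary: c rule: less_induct)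
  case (less k)
  have x: "\<bar>s\<bar> \<le> (1 + 1 / c) * exp (c * s\<^sup>2)" if "c > 0" for s c :: real
  proof -
    have "\<bar>s\<bar> \<le> 1 + s\<^sup>2"
      using sum_squares_bound[of 1 "\<bar>s\<bar>"] by (simp add: power2_eq_square abs_mult_self_eq)
    also have "\<dots> \<le> exp (c * s\<^sup>2) + (1 / c) * exp (c * s\<^sup>2)"
    proof (intro add_mono)
      show "1 \<le> exp (c * s\<^sup>2)" using that by simp
      have "c * s\<^sup>2 \<le> exp (c * s\<^sup>2)" using exp_ge_add_one_self[of "c * s\<^sup>2"] by linarith
      then show "s\<^sup>2 \<le> 1 / c * exp (c * s\<^sup>2)" using that by (simp add: field_simps)
    qed
    finally show ?thesis by (simp add: algebra_simps)
  qed
  consider "k = 0" | "k = Suc 0" | j where "k = Suc (Suc j)"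
    by (metis not0_implies_Suc)
  then show ?case
  proof cases
    case 1
    have "1 \<le> exp (c * s\<^sup>2)" for s using less.prems by simp
    then show ?thesis unfolding 1 by (intro exI[of _ 1]) auto
  next
    case 2
    have "2 * \<bar>s\<bar> \<le> (2 * (1 + 1 / c)) * exp (c * s\<^sup>2)" for s
      using mult_left_mono[OF x[OF less.prems, of s], of 2] by (simp only: mult.assoc)
    then show ?thesis unfolding 2 by (intro exI[of _ "2 * (1 + 1 / c)"]) (simp add: abs_mult)
  next
    case (3 j)
    \<comment> \<open>The factor s of the recurrence needs a share of the exponential, so the
      exponent is halved here; this is why the induction runs over all \<open>c\<close>.\<close>
    obtain K where K: "\<And>s. \<bar>hermite_poly (Suc j) s\<bar> \<le> K * exp (c / 2 * s\<^sup>2)"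
      using less.IH[of "Suc j" "c / 2"] 3 less.prems by auto
    obtain K' where K': "\<And>s. \<bar>hermite_poly j s\<bar> \<le> K' * exp (c * s\<^sup>2)"
      using less.IH[of j c] 3 less.prems by auto
    define D where "D = 2 * (1 + 1 / (c/2)) * K + 2 * real (Suc j) * K'"
    have "\<bar>hermite_poly k s\<bar> \<le> D * exp (c * s\<^sup>2)" for s
    proof -
      have "\<bar>hermite_poly k s\<bar> \<le> 2 * (\<bar>s\<bar> * \<bar>hermite_poly (Suc j) s\<bar>) + 2 * real (Suc j) * \<bar>hermite_poly j s\<bar>"
        unfolding 3 hermite_poly.simps by (rule order_trans[OF abs_triangle_ineq4]) (simp add: abs_mult)
      also have "\<dots> \<le> 2 * (((1 + 1 / (c/2)) * exp (c/2 * s\<^sup>2)) * (K * exp (c / 2 * s\<^sup>2)))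
          + 2 * real (Suc j) * (K' * exp (c * s\<^sup>2))"
        using less.prems x[of "c/2" s] by (intro add_mono mult_left_mono mult_mono K K') auto
      also have "\<dots> = D * exp (c * s\<^sup>2)"
      proof -
        have "exp (c * s\<^sup>2) = exp (c/2 * s\<^sup>2) * exp (c/2 * s\<^sup>2)"
          by (simp add: exp_add[symmetric])
        then show ?thesis unfolding D_def by (simp add: algebra_simps)
      qed
      finally show ?thesis .
    qed
    then show ?thesis by blast
  qed
qed

text \<open>Half of the factor \<open>exp (- s\<^sup>2 / 2)\<close> is spent on the polynomial. The
  other half is the weight in which all later bounds and approximations are measured.\<close>

lemma hermite_fun1_gaussian_bound: "\<exists>K\<ge>0. \<forall>s. \<bar>hermite_fun1 k s\<bar> \<le> K * exp (- s\<^sup>2 / 4)"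
proof -
  obtain K where K: "\<And>s. \<bar>hermite_poly k s\<bar> \<le> K * exp (1 / 4 * s\<^sup>2)"
    using abs_hermite_poly_bound[of "1/4" k] by auto
  define c where "c = sqrt (2 ^ k * fact k * sqrt pi)"
  have c: "c > 0" by (simp add: c_def)
  have "\<bar>hermite_fun1 k s\<bar> \<le> K / c * exp (- s\<^sup>2 / 4)" for s
  proof -
    have "\<bar>hermite_fun1 k s\<bar> = \<bar>hermite_poly k s\<bar> * exp (- s\<^sup>2 / 2) / c"
      using c by (simp add: hermite_fun1_def c_def abs_mult)
    also have "\<dots> \<le> (K * exp (1 / 4 * s\<^sup>2)) * exp (- s\<^sup>2 / 2) / c"
      using c K by (intro divide_right_mono mult_right_mono) auto
    also have "\<dots> = K / c * (exp (1 / 4 * s\<^sup>2) * exp (- s\<^sup>2 / 2))" by simp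
    also have "exp (1 / 4 * s\<^sup>2) * exp (- s\<^sup>2 / 2) = exp (- s\<^sup>2 / 4)"
      unfolding exp_add[symmetric] by (simp add: field_simps)
    finally show ?thesis .
  qed
  moreover have "K \<ge> 0" using K[of 0] by simp
  ultimately show ?thesis using c by (intro exI[of _ "K / c"]) auto
qed

lemma hermite_fun1_deriv_gaussian_bound: "\<exists>K\<ge>0. \<forall>s. \<bar>hermite_fun1_deriv k s\<bar> \<le> K * exp (- s\<^sup>2 / 4)"
proof -
  obtain K1 K2 where K: "K1 \<ge> 0" "K2 \<ge> 0" "\<And>s. \<bar>hermite_fun1 (k - 1) s\<bar> \<le> K1 * exp (- s\<^sup>2 / 4)"
    "\<And>s. \<bar>hermite_fun1 (k + 1) s\<bar> \<le> K2 * exp (- s\<^sup>2 / 4)"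
    using hermite_fun1_gaussian_bound by metis
  have "\<bar>hermite_fun1_deriv k s\<bar> \<le> (sqrt (real k / 2) * K1 + sqrt (real (k + 1) / 2) * K2) * exp (- s\<^sup>2 / 4)" for s
  proof -
    have "\<bar>hermite_fun1_deriv k s\<bar> \<le> sqrt (real k / 2) * \<bar>hermite_fun1 (k - 1) s\<bar>
        + sqrt (real (k + 1) / 2) * \<bar>hermite_fun1 (k + 1) s\<bar>"
      unfolding hermite_fun1_deriv_def by (rule order_trans[OF abs_triangle_ineq4]) (simp add: abs_mult)
    also have "\<dots> \<le> sqrt (real k / 2) * (K1 * exp (- s\<^sup>2 / 4)) + sqrt (real (k + 1) / 2) * (K2 * exp (- s\<^sup>2 / 4))"
      by (intro add_mono mult_left_mono K) auto
    finally show ?thesis by (simp add: algebra_simps)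
  qed
  then show ?thesis using K by (intro exI[of _ "sqrt (real k / 2) * K1 + sqrt (real (k + 1) / 2) * K2"]) auto
qed

lemma integrable_gaussian: "integrable lborel (\<lambda>s::real. exp (- s\<^sup>2 / 4))"
proof -
  have "(\<lambda>s::real. exp (- s\<^sup>2 / 4)) = (\<lambda>s. sqrt (2 * pi * (sqrt 2)\<^sup>2) * normal_density 0 (sqrt 2) s)"
    by (rule ext) (simp add: normal_density_def)
  then show ?thesis by simp
qed

lemma integrable_gaussian_bound:
  fixes f :: "real \<Rightarrow> real"
  assumes "f \<in> borel_measurable borel" "\<And>s. \<bar>f s\<bar> \<le> K * exp (- s\<^sup>2 / 4)"
  shows "integrable lborel f"
  by (rule Bochner_Integration.integrable_bound[OF integrable_mult_right[OF integrable_gaussian, of K]])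
     (use assms in \<open>auto intro!: AE_I2 order_trans[OF assms(2)]\<close>)

lemma tendsto_gaussian:
  "((\<lambda>s::real. exp (- s\<^sup>2 / 4)) \<longlongrightarrow> 0) at_top" "((\<lambda>s::real. exp (- s\<^sup>2 / 4)) \<longlongrightarrow> 0) at_bot"
  by real_asymp+

lemma tendsto_gaussian_bound:
  fixes f :: "real \<Rightarrow> real"
  assumes "\<And>s. \<bar>f s\<bar> \<le> K * exp (- s\<^sup>2 / 4)"
  shows "(f \<longlongrightarrow> 0) at_top" "(f \<longlongrightarrow> 0) at_bot"
proof -
  have *: "(f \<longlongrightarrow> 0) F" if "((\<lambda>s::real. exp (- s\<^sup>2 / 4)) \<longlongrightarrow> 0) F" for F
    by (rule Lim_null_comparison[OF always_eventually tendsto_mult_right_zero[OF that, of K]])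
       (use assms in simp)
  show "(f \<longlongrightarrow> 0) at_top" "(f \<longlongrightarrow> 0) at_bot"
    by (intro * tendsto_gaussian)+
qed

section \<open>Orthonormality and uniform bounds\<close>

lemma integral_derivative_eq_0:
  fixes G g :: "real \<Rightarrow> real"
  assumes "\<And>s. (G has_real_derivative g s) (at s)" "continuous_on UNIV g"
    and "\<And>s. \<bar>G s\<bar> \<le> K * exp (- s\<^sup>2 / 4)" "\<And>s. \<bar>g s\<bar> \<le> L * exp (- s\<^sup>2 / 4)"
  shows "(\<integral>s. g s \<partial>lborel) = 0"
proof -
  have "integrable lborel g"
    using assms(2,4) by (intro integrable_gaussian_bound borel_measurable_continuous_onI) auto
  then have "(LBINT x=-\<infinity>..\<infinity>. g x) = 0 - 0"
  proof (intro interval_integral_FTC_integrable)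
    show "isCont g x" for x using assms(2) by (simp add: continuous_on_eq_continuous_at)
  qed (use assms tendsto_gaussian_bound[OF assms(3)] in
      \<open>auto simp: has_real_derivative_iff_has_vector_derivative ereal_tendsto_simps set_integrable_def\<close>)
  then show ?thesis
    by (simp add: interval_lebesgue_integral_def set_lebesgue_integral_def)
qed

lemma measurable_hermite_fun1 [measurable]: "hermite_fun1 k \<in> borel_measurable borel"
  by (intro borel_measurable_continuous_onI continuous_intros)

lemma measurable_hermite_fun1_deriv [measurable]: "hermite_fun1_deriv k \<in> borel_measurable borel"
  by (intro borel_measurable_continuous_onI continuous_intros)

lemma gaussian_bound_mult:
  fixes f g :: "real \<Rightarrow> real"
  assumes "\<And>s. \<bar>f s\<bar> \<le> K * exp (- s\<^sup>2 / 4)" "\<And>s. \<bar>g s\<bar> \<le> L * exp (- s\<^sup>2 / 4)"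
  shows "\<bar>f s * g s\<bar> \<le> (K * L) * exp (- s\<^sup>2 / 4)"
proof -
  have "\<bar>f s * g s\<bar> \<le> (K * exp (- s\<^sup>2 / 4)) * (L * exp (- s\<^sup>2 / 4))"
    unfolding abs_mult using assms[of s] by (intro mult_mono) (auto intro: order_trans[OF abs_ge_zero])
  also have "\<dots> = K * L * exp (- s\<^sup>2 / 4) * exp (- s\<^sup>2 / 4)" by simp
  also have "\<dots> \<le> K * L * exp (- s\<^sup>2 / 4) * 1"
  proof (intro mult_left_mono)
    have "K \<ge> 0" "L \<ge> 0" using assms[of 0] by auto
    then show "0 \<le> K * L * exp (- s\<^sup>2 / 4)" by simp
  qed simp
  finally show ?thesis by simp
qed

lemma integrable_hermite_mult:
  "integrable lborel (\<lambda>s. hermite_fun1 j s * hermite_fun1 k s)"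
proof -
  obtain K L where "\<And>s. \<bar>hermite_fun1 j s\<bar> \<le> K * exp (- s\<^sup>2 / 4)" "\<And>s. \<bar>hermite_fun1 k s\<bar> \<le> L * exp (- s\<^sup>2 / 4)"
    using hermite_fun1_gaussian_bound by metis
  from gaussian_bound_mult[OF this] show ?thesis
    by (intro integrable_gaussian_bound[of _ "K * L"]) auto
qed

text \<open>Symmetry of the one-dimensional operator: \<open>G\<close> is the Wronskian, it vanishes
  at infinity, and the equation turns its derivative \<open>g\<close> into the product times the
  difference of the eigenvalues.\<close>

lemma hermite_fun1_orthogonal:
  assumes "j \<noteq> k"
  shows "(\<integral>s. hermite_fun1 j s * hermite_fun1 k s \<partial>lborel) = 0"
proof -
  define g where "g s = (2 * (real k - real j)) * (hermite_fun1 j s * hermite_fun1 k s)" for s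
  define G where "G s = hermite_fun1_deriv j s * hermite_fun1 k s - hermite_fun1 j s * hermite_fun1_deriv k s" for s
  obtain K where K: "\<And>k s. \<bar>hermite_fun1 k s\<bar> \<le> K k * exp (- s\<^sup>2 / 4)"
    using hermite_fun1_gaussian_bound by metis
  obtain L where L: "\<And>k s. \<bar>hermite_fun1_deriv k s\<bar> \<le> L k * exp (- s\<^sup>2 / 4)"
    using hermite_fun1_deriv_gaussian_bound by metis
  have "(\<integral>s. g s \<partial>lborel) = 0"
  proof (rule integral_derivative_eq_0)
    show "(G has_real_derivative g s) (at s)" for s
      unfolding G_def g_def
      by (auto intro!: derivative_eq_intros has_real_derivative_hermite_fun1
          has_real_derivative_hermite_fun1_deriv simp: algebra_simps)
    show "continuous_on UNIV g" unfolding g_def by (intro continuous_intros)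
    show "\<bar>G s\<bar> \<le> (L j * K k + K j * L k) * exp (- s\<^sup>2 / 4)" for s
    proof -
      have "\<bar>hermite_fun1_deriv j s * hermite_fun1 k s\<bar> \<le> (L j * K k) * exp (- s\<^sup>2 / 4)"
        "\<bar>hermite_fun1 j s * hermite_fun1_deriv k s\<bar> \<le> (K j * L k) * exp (- s\<^sup>2 / 4)"
        by (rule gaussian_bound_mult[OF L K], rule gaussian_bound_mult[OF K L])
      then show ?thesis
        unfolding G_def distrib_right by linarith
    qed
    show "\<bar>g s\<bar> \<le> (\<bar>2 * (real k - real j)\<bar> * (K j * K k)) * exp (- s\<^sup>2 / 4)" for s
      unfolding g_def abs_mult[of "2 * (real k - real j)"] mult.assoc[of _ "K j * K k"]
      by (intro mult_left_mono gaussian_bound_mult K) auto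
  qed
  then show ?thesis using assms unfolding g_def by simp
qed

text \<open>Consecutive functions have equal norms: the derivative of \<open>h k * h (k + 1)\<close>
  integrates to 0, and orthogonality leaves only the two squares, with coefficients
  \<open>a (k + 1)\<close> of opposite sign.\<close>

lemma hermite_fun1_normalized: "(\<integral>s. hermite_fun1 k s * hermite_fun1 k s \<partial>lborel) = 1"
proof (induction k)
  case 0
  \<comment> \<open>The square of the ground state is the normal density of variance 1/2.\<close>
  have "(\<lambda>s. hermite_fun1 0 s * hermite_fun1 0 s) = normal_density 0 (1 / sqrt 2)"
  proof
    fix s :: real
    have "exp (- s\<^sup>2 / 2) * exp (- s\<^sup>2 / 2) = exp (- s\<^sup>2)"
      unfolding exp_add[symmetric] by simp
    then show "hermite_fun1 0 s * hermite_fun1 0 s = normal_density 0 (1 / sqrt 2) s"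
      by (simp add: hermite_fun1_def normal_density_def field_simps)
  qed
  then show ?case by (simp add: integral_normal_density)
next
  case (Suc k)
  define a where "a k = sqrt (real k / 2)" for k
  define h where "h = hermite_fun1"
  define g where "g s = a k * (h (k - 1) s * h (k + 1) s) - a (k + 1) * (h (k + 1) s * h (k + 1) s)
      + a (k + 1) * (h k s * h k s) - a (k + 2) * (h k s * h (k + 2) s)" for s
  obtain K where K: "\<And>k s. \<bar>h k s\<bar> \<le> K k * exp (- s\<^sup>2 / 4)"
    using hermite_fun1_gaussian_bound unfolding h_def by metis
  have ortho: "a k * (\<integral>s. h (k - 1) s * h (k + 1) s \<partial>lborel) = 0"
    unfolding h_def a_def using hermite_fun1_orthogonal[of "k - 1" "k + 1"] by simp
  have ortho2: "(\<integral>s. h k s * h (k + 2) s \<partial>lborel) = 0"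
    unfolding h_def using hermite_fun1_orthogonal[of k "k + 2"] by simp
  have int: "integrable lborel (\<lambda>s. h i s * h j s)" for i j
    unfolding h_def by (rule integrable_hermite_mult)
  have "(\<integral>s. g s \<partial>lborel) = 0"
  proof (rule integral_derivative_eq_0)
    show "((\<lambda>s. h k s * h (k + 1) s) has_real_derivative g s) (at s)" for s
      unfolding g_def h_def
      by (auto intro!: derivative_eq_intros has_real_derivative_hermite_fun1
          simp: hermite_fun1_deriv_def a_def algebra_simps)
    show "continuous_on UNIV g" unfolding g_def h_def by (intro continuous_intros)
    show "\<bar>h k s * h (k + 1) s\<bar> \<le> (K k * K (k + 1)) * exp (- s\<^sup>2 / 4)" for s
      by (rule gaussian_bound_mult[OF K K])
    have b: "\<bar>c * (h i s * h j s)\<bar> \<le> (\<bar>c\<bar> * (K i * K j)) * exp (- s\<^sup>2 / 4)" for c i j s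
      unfolding abs_mult[of c] mult.assoc[of _ "K i * K j"]
      by (intro mult_left_mono gaussian_bound_mult K) auto
    show "\<bar>g s\<bar> \<le> (\<bar>a k\<bar> * (K (k - 1) * K (k + 1)) + \<bar>a (k + 1)\<bar> * (K (k + 1) * K (k + 1))
      + \<bar>a (k + 1)\<bar> * (K k * K k) + \<bar>a (k + 2)\<bar> * (K k * K (k + 2))) * exp (- s\<^sup>2 / 4)" for s
      unfolding g_def distrib_right
      using b[of "a k" "k - 1" s "k + 1"] b[of "a (k + 1)" "k + 1" s "k + 1"] b[of "a (k + 1)" k s k]
        b[of "a (k + 2)" k s "k + 2"] by linarith
  qed
  moreover have "(\<integral>s. g s \<partial>lborel) = a k * (\<integral>s. h (k - 1) s * h (k + 1) s \<partial>lborel)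
      - a (k + 1) * (\<integral>s. h (k + 1) s * h (k + 1) s \<partial>lborel)
      + a (k + 1) * (\<integral>s. h k s * h k s \<partial>lborel) - a (k + 2) * (\<integral>s. h k s * h (k + 2) s \<partial>lborel)"
    unfolding g_def by (simp add: int)
  ultimately have "a (k + 1) * (\<integral>s. h k s * h k s \<partial>lborel) = a (k + 1) * (\<integral>s. h (k + 1) s * h (k + 1) s \<partial>lborel)"
    unfolding ortho ortho2 by linarith
  moreover have "a (k + 1) \<noteq> 0" by (simp add: a_def)
  ultimately show ?case using Suc by (simp add: h_def)
qed

text \<open>A Sobolev inequality on the line: the square at \<open>x\<close> is the integral of
  twice the function times its derivative up to \<open>x\<close>, hence at most the integral of the
  sum of their squares, which orthonormality evaluates to \<open>k + 3 / 2\<close>.\<close>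

lemma hermite_fun1_sup_bound: "(hermite_fun1 k x)\<^sup>2 \<le> real k + 2"
proof -
  define h where "h = hermite_fun1"
  define a where "a k = sqrt (real k / 2)" for k
  obtain K where K: "\<And>k s. \<bar>h k s\<bar> \<le> K k * exp (- s\<^sup>2 / 4)"
    using hermite_fun1_gaussian_bound unfolding h_def by metis
  define f where "f s = (h k s)\<^sup>2 + (hermite_fun1_deriv k s)\<^sup>2" for s
  have int: "integrable lborel (\<lambda>s. h i s * h j s)" for i j
    unfolding h_def by (rule integrable_hermite_mult)
  have f: "f s = h k s * h k s + (a k)\<^sup>2 * (h (k - 1) s * h (k - 1) s) + (a (k + 1))\<^sup>2 * (h (k + 1) s * h (k + 1) s)
      - (2 * a k * a (k + 1)) * (h (k - 1) s * h (k + 1) s)" for s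
    by (simp add: f_def hermite_fun1_deriv_def h_def a_def power2_eq_square algebra_simps)
  have ortho: "a k * (\<integral>s. h (k - 1) s * h (k + 1) s \<partial>lborel) = 0"
    unfolding h_def a_def using hermite_fun1_orthogonal[of "k - 1" "k + 1"] by simp
  have intf: "integrable lborel f"
    unfolding f by (intro Bochner_Integration.integrable_add Bochner_Integration.integrable_diff
        integrable_mult_right int)
  have norm: "(\<integral>s. h k s * h k s \<partial>lborel) = 1" for k
    unfolding h_def by (rule hermite_fun1_normalized)
  have If: "(\<integral>s. f s \<partial>lborel) = real k + 3 / 2"
  proof -
    have "(\<integral>s. f s \<partial>lborel) = 1 + (a k)\<^sup>2 + (a (k + 1))\<^sup>2
        - (2 * a (k + 1)) * (a k * (\<integral>s. h (k - 1) s * h (k + 1) s \<partial>lborel))"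
      unfolding f using norm by (simp add: int)
    then show ?thesis unfolding ortho by (simp add: a_def field_simps)
  qed
  have diff: "(h k x)\<^sup>2 - (h k y)\<^sup>2 \<le> real k + 3 / 2" if "y < x" for y
  proof -
    define g where "g s = 2 * h k s * hermite_fun1_deriv k s" for s
    have "(g has_integral (h k x)\<^sup>2 - (h k y)\<^sup>2) {y..x}"
    proof (rule fundamental_theorem_of_calculus)
      have "((\<lambda>s. (h k s)\<^sup>2) has_real_derivative g s) (at s)" for s
        unfolding h_def g_def
        by (auto intro!: derivative_eq_intros has_real_derivative_hermite_fun1)
      then show "((\<lambda>s. (h k s)\<^sup>2) has_vector_derivative g s) (at s within {y..x})" for s
        using has_real_derivative_iff_has_vector_derivative has_vector_derivative_at_within by blast
    qed (use that in simp)
    moreover have "(f has_integral integral {y..x} f) {y..x}"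
      using intf by (meson integrable_integral integrable_on_lborel integrable_on_subinterval subset_UNIV)
    ultimately have "(h k x)\<^sup>2 - (h k y)\<^sup>2 \<le> integral {y..x} f"
    proof (rule has_integral_le)
      show "g s \<le> f s" for s
        unfolding g_def f_def by (rule sum_squares_bound)
    qed
    also have "\<dots> \<le> integral UNIV f"
    proof (rule integral_subset_le)
      show "f integrable_on {y..x}" "f integrable_on UNIV"
        using intf by (meson integrable_on_lborel integrable_on_subinterval subset_UNIV)+
    qed (auto simp: f_def)
    also have "\<dots> = real k + 3 / 2"
      using If intf by (simp add: integral_lborel)
    finally show ?thesis .
  qed
  have "((\<lambda>y. (h k x)\<^sup>2 - (h k y)\<^sup>2) \<longlongrightarrow> (h k x)\<^sup>2 - 0\<^sup>2) at_bot"
    by (intro tendsto_intros tendsto_gaussian_bound[OF K])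
  moreover have "\<forall>\<^sub>F y in at_bot. (h k x)\<^sup>2 - (h k y)\<^sup>2 \<le> real k + 3 / 2"
    using eventually_gt_at_bot[of x] by (auto simp: eventually_at_bot_dense intro!: exI[of _ x] diff)
  ultimately have "(h k x)\<^sup>2 - 0\<^sup>2 \<le> real k + 3 / 2"
    by (rule tendsto_upperbound) simp
  then show ?thesis by (simp add: h_def)
qed

section \<open>Hermite functions in several variables\<close>

lemma abs_hermite_fun1_le: "\<bar>hermite_fun1 k s\<bar> \<le> (real k + 3)\<^sup>2"
proof -
  have e: "(real k + 3)\<^sup>2 = real k * real k + 6 * real k + 9"
    by (simp add: power2_eq_square algebra_simps)
  have "\<bar>hermite_fun1 k s\<bar>\<^sup>2 \<le> (real k + 3)\<^sup>2"
    unfolding power2_abs e using hermite_fun1_sup_bound[of k s] zero_le_square[of "real k"] by linarith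
  then have "\<bar>hermite_fun1 k s\<bar> \<le> real k + 3"
    by (rule power2_le_imp_le) simp
  also have "\<dots> \<le> (real k + 3)\<^sup>2"
    by (simp add: power2_eq_square algebra_simps)
  finally show ?thesis .
qed

lemma abs_hermite_fun1_deriv_le: "\<bar>hermite_fun1_deriv k s\<bar> \<le> 2 * (real k + 3)\<^sup>2"
proof -
  have h: "\<bar>hermite_fun1 k s\<bar> \<le> real k + 2" for k
  proof -
    have e: "(real k + 2)\<^sup>2 = real k * real k + 4 * real k + 4"
      by (simp add: power2_eq_square algebra_simps)
    have "\<bar>hermite_fun1 k s\<bar>\<^sup>2 \<le> (real k + 2)\<^sup>2"
      unfolding power2_abs e using hermite_fun1_sup_bound[of k s] zero_le_square[of "real k"] by linarith
    then show ?thesis by (rule power2_le_imp_le) simp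
  qed
  have r: "sqrt (real k / 2) \<le> real k + 1" for k
  proof (rule real_le_lsqrt)
    show "real k / 2 \<le> (real k + 1)\<^sup>2" by (simp add: power2_eq_square algebra_simps)
  qed simp
  have "\<bar>hermite_fun1_deriv k s\<bar> \<le> sqrt (real k / 2) * \<bar>hermite_fun1 (k - 1) s\<bar>
      + sqrt (real (k + 1) / 2) * \<bar>hermite_fun1 (k + 1) s\<bar>"
    unfolding hermite_fun1_deriv_def by (rule order_trans[OF abs_triangle_ineq4]) (simp add: abs_mult)
  also have "\<dots> \<le> (real k + 1) * (real (k - 1) + 2) + (real (k + 1) + 1) * (real (k + 1) + 2)"
    by (intro add_mono mult_mono r h) auto
  also have "\<dots> \<le> (real k + 3) * (real k + 3) + (real k + 3) * (real k + 3)"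
  proof -
    have "real (k - 1) \<le> real k" by simp
    then show ?thesis by (intro add_mono[OF mult_mono mult_mono]) auto
  qed
  finally show ?thesis by (simp add: power2_eq_square)
qed

text \<open>The factor \<open>s\<^sup>2\<close> need not be estimated: by the equation the product
  is the derivative of \<open>hermite_fun1_deriv k\<close>, hence a combination of the derivatives
  of two neighbouring Hermite functions.\<close>

lemma hermite_fun1_deriv2_gaussian_bound:
  "\<exists>K\<ge>0. \<forall>s. \<bar>(s\<^sup>2 - real (2 * k + 1)) * hermite_fun1 k s\<bar> \<le> K * exp (- s\<^sup>2 / 4)"
proof -
  obtain K1 K2 where K: "K1 \<ge> 0" "K2 \<ge> 0" "\<And>s. \<bar>hermite_fun1_deriv (k - 1) s\<bar> \<le> K1 * exp (- s\<^sup>2 / 4)"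
    "\<And>s. \<bar>hermite_fun1_deriv (k + 1) s\<bar> \<le> K2 * exp (- s\<^sup>2 / 4)"
    using hermite_fun1_deriv_gaussian_bound by metis
  define a b where "a = sqrt (real k / 2)" and "b = sqrt (real (k + 1) / 2)"
  have ab: "a \<ge> 0" "b \<ge> 0" by (auto simp: a_def b_def)
  have eq: "(s\<^sup>2 - real (2 * k + 1)) * hermite_fun1 k s
      = a * hermite_fun1_deriv (k - 1) s - b * hermite_fun1_deriv (k + 1) s" for s
  proof -
    have "((\<lambda>s. a * hermite_fun1 (k - 1) s - b * hermite_fun1 (k + 1) s) has_real_derivative
        a * hermite_fun1_deriv (k - 1) s - b * hermite_fun1_deriv (k + 1) s) (at s)"
      by (intro DERIV_diff DERIV_cmult has_real_derivative_hermite_fun1)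
    moreover have "(\<lambda>s. a * hermite_fun1 (k - 1) s - b * hermite_fun1 (k + 1) s) = hermite_fun1_deriv k"
      by (simp add: fun_eq_iff hermite_fun1_deriv_def a_def b_def)
    ultimately show ?thesis
      using DERIV_unique has_real_derivative_hermite_fun1_deriv by metis
  qed
  have "\<bar>(s\<^sup>2 - real (2 * k + 1)) * hermite_fun1 k s\<bar> \<le> (a * K1 + b * K2) * exp (- s\<^sup>2 / 4)" for s
  proof -
    have "\<bar>(s\<^sup>2 - real (2 * k + 1)) * hermite_fun1 k s\<bar>
        \<le> a * \<bar>hermite_fun1_deriv (k - 1) s\<bar> + b * \<bar>hermite_fun1_deriv (k + 1) s\<bar>"
      unfolding eq using ab by (intro order_trans[OF abs_triangle_ineq4]) (simp add: abs_mult)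
    also have "\<dots> \<le> a * (K1 * exp (- s\<^sup>2 / 4)) + b * (K2 * exp (- s\<^sup>2 / 4))"
      by (intro add_mono mult_left_mono K ab)
    finally show ?thesis by (simp add: algebra_simps)
  qed
  then show ?thesis using K ab by (intro exI[of _ "a * K1 + b * K2"]) auto
qed

section \<open>Partial derivatives and bounds in product form\<close>

definition hermite_partial :: "nat \<Rightarrow> nat \<Rightarrow> (nat \<Rightarrow> nat) \<Rightarrow> (nat \<Rightarrow> real) \<Rightarrow> real" where
  "hermite_partial n j \<alpha> x =
     hermite_fun1_deriv (\<alpha> j) (x j) * (\<Prod>i\<in>{..<n} - {j}. hermite_fun1 (\<alpha> i) (x i))"

definition hermite_partial2 :: "nat \<Rightarrow> nat \<Rightarrow> (nat \<Rightarrow> nat) \<Rightarrow> (nat \<Rightarrow> real) \<Rightarrow> real" where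
  "hermite_partial2 n j \<alpha> x = ((x j)\<^sup>2 - real (2 * \<alpha> j + 1)) * hermite_fun n \<alpha> x"

lemma hermite_fun_split:
  "j < n \<Longrightarrow> hermite_fun n \<alpha> x = hermite_fun1 (\<alpha> j) (x j) * (\<Prod>i\<in>{..<n} - {j}. hermite_fun1 (\<alpha> i) (x i))"
  unfolding hermite_fun_def by (subst prod.remove[of _ j]) auto

lemma has_real_derivative_hermite_fun:
  assumes "j < n"
  shows "((\<lambda>s. hermite_fun n \<alpha> (x(j := s))) has_real_derivative hermite_partial n j \<alpha> (x(j := s))) (at s)"
proof -
  have "((\<lambda>s. hermite_fun1 (\<alpha> j) s * (\<Prod>i\<in>{..<n} - {j}. hermite_fun1 (\<alpha> i) (x i))) has_real_derivative
      hermite_fun1_deriv (\<alpha> j) s * (\<Prod>i\<in>{..<n} - {j}. hermite_fun1 (\<alpha> i) (x i))) (at s)"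
    by (rule DERIV_cmult_right[OF has_real_derivative_hermite_fun1])
  then show ?thesis
    unfolding hermite_fun_split[OF assms] hermite_partial_def by simp
qed

lemma has_real_derivative_hermite_partial:
  assumes "j < n"
  shows "((\<lambda>s. hermite_partial n j \<alpha> (x(j := s))) has_real_derivative hermite_partial2 n j \<alpha> (x(j := s))) (at s)"
proof -
  have "((\<lambda>s. hermite_fun1_deriv (\<alpha> j) s * (\<Prod>i\<in>{..<n} - {j}. hermite_fun1 (\<alpha> i) (x i))) has_real_derivative
      ((s\<^sup>2 - real (2 * \<alpha> j + 1)) * hermite_fun1 (\<alpha> j) s) * (\<Prod>i\<in>{..<n} - {j}. hermite_fun1 (\<alpha> i) (x i))) (at s)"
    by (rule DERIV_cmult_right[OF has_real_derivative_hermite_fun1_deriv])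
  then show ?thesis
    unfolding hermite_fun_split[OF assms] hermite_partial_def hermite_partial2_def
    by (simp add: mult.assoc)
qed

definition gauss :: "nat \<Rightarrow> (nat \<Rightarrow> real) \<Rightarrow> real" where
  "gauss n x = (\<Prod>i<n. exp (- (x i)\<^sup>2 / 4))"

lemma gauss_pos: "gauss n x > 0" by (simp add: gauss_def prod_pos)

lemma gauss_le_1: "gauss n x \<le> 1" unfolding gauss_def by (intro prod_le_1) auto

lemma gauss_split: "j < n \<Longrightarrow> gauss n x = exp (- (x j)\<^sup>2 / 4) * (\<Prod>i\<in>{..<n} - {j}. exp (- (x i)\<^sup>2 / 4))"
  unfolding gauss_def by (subst prod.remove[of _ j]) auto

lemma abs_prod_le_prod_mult:
  fixes f g :: "nat \<Rightarrow> real"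
  assumes "\<And>i. i \<in> A \<Longrightarrow> \<bar>f i\<bar> \<le> K i * g i"
  shows "\<bar>\<Prod>i\<in>A. f i\<bar> \<le> (\<Prod>i\<in>A. K i) * (\<Prod>i\<in>A. g i)"
  unfolding abs_prod prod.distrib[symmetric] by (intro prod_mono) (use assms in auto)

lemma hermite_fun_gauss_bound: "\<exists>K\<ge>0. \<forall>x. \<bar>hermite_fun n \<alpha> x\<bar> \<le> K * gauss n x"
proof -
  obtain K where K: "\<And>k. K k \<ge> 0" "\<And>k s. \<bar>hermite_fun1 k s\<bar> \<le> K k * exp (- s\<^sup>2 / 4)"
    using hermite_fun1_gaussian_bound by metis
  then show ?thesis
    unfolding hermite_fun_def gauss_def
    by (intro exI[of _ "\<Prod>i<n. K (\<alpha> i)"] conjI allI abs_prod_le_prod_mult prod_nonneg) auto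
qed

text \<open>Serves first and second derivatives alike, since differentiation in direction
  \<open>j\<close> changes only the factor with index \<open>j\<close>.\<close>

lemma hermite_factor_gauss_bound:
  assumes "j < n" "K \<ge> 0" "\<And>s. \<bar>f s\<bar> \<le> K * exp (- s\<^sup>2 / 4)"
  shows "\<exists>L\<ge>0. \<forall>x. \<bar>f (x j) * (\<Prod>i\<in>{..<n} - {j}. hermite_fun1 (\<alpha> i) (x i))\<bar> \<le> L * gauss n x"
proof -
  obtain M where M: "\<And>k. M k \<ge> 0" "\<And>k s. \<bar>hermite_fun1 k s\<bar> \<le> M k * exp (- s\<^sup>2 / 4)"
    using hermite_fun1_gaussian_bound by metis
  define P where "P = (\<Prod>i\<in>{..<n} - {j}. M (\<alpha> i))"
  have "\<bar>f (x j) * (\<Prod>i\<in>{..<n} - {j}. hermite_fun1 (\<alpha> i) (x i))\<bar> \<le> K * P * gauss n x" for x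
  proof -
    have "\<bar>f (x j) * (\<Prod>i\<in>{..<n} - {j}. hermite_fun1 (\<alpha> i) (x i))\<bar>
       \<le> (K * exp (- (x j)\<^sup>2 / 4)) * (P * (\<Prod>i\<in>{..<n} - {j}. exp (- (x i)\<^sup>2 / 4)))"
      unfolding abs_mult P_def by (intro mult_mono assms abs_prod_le_prod_mult M) (use assms in auto)
    then show ?thesis unfolding gauss_split[OF assms(1)] by (simp add: mult_ac)
  qed
  moreover have "P \<ge> 0" unfolding P_def using M by (intro prod_nonneg) auto
  ultimately show ?thesis using assms(2) by (intro exI[of _ "K * P"]) auto
qed

lemma hermite_partial_gauss_bound:
  assumes "j < n"
  shows "\<exists>K\<ge>0. \<forall>x. \<bar>hermite_partial n j \<alpha> x\<bar> \<le> K * gauss n x"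
proof -
  obtain K where "K \<ge> 0" "\<And>s. \<bar>hermite_fun1_deriv (\<alpha> j) s\<bar> \<le> K * exp (- s\<^sup>2 / 4)"
    using hermite_fun1_deriv_gaussian_bound by metis
  from hermite_factor_gauss_bound[OF assms this] show ?thesis
    unfolding hermite_partial_def .
qed

lemma hermite_partial2_gauss_bound:
  assumes "j < n"
  shows "\<exists>K\<ge>0. \<forall>x. \<bar>hermite_partial2 n j \<alpha> x\<bar> \<le> K * gauss n x"
proof -
  obtain K where K: "K \<ge> 0" "\<And>s. \<bar>(s\<^sup>2 - real (2 * \<alpha> j + 1)) * hermite_fun1 (\<alpha> j) s\<bar> \<le> K * exp (- s\<^sup>2 / 4)"
    using hermite_fun1_deriv2_gaussian_bound by metis
  show ?thesis
    using hermite_factor_gauss_bound[OF assms K(1), of "\<lambda>s. (s\<^sup>2 - real (2 * \<alpha> j + 1)) * hermite_fun1 (\<alpha> j) s" \<alpha>] K(2)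
    unfolding hermite_partial2_def hermite_fun_split[OF assms] by (simp add: mult.assoc)
qed

text \<open>A crude common bound, up to the factor 2, for the Hermite functions and their first
  derivatives. It is a product over the coordinates, so that sums over multi-indices factor.\<close>

definition hermite_weight :: "nat \<Rightarrow> (nat \<Rightarrow> nat) \<Rightarrow> real" where
  "hermite_weight n \<alpha> = (\<Prod>i<n. (real (\<alpha> i) + 3)\<^sup>2)"

lemma hermite_weight_pos: "hermite_weight n \<alpha> > 0"
  unfolding hermite_weight_def by (intro prod_pos) (auto intro!: zero_less_power add_nonneg_pos)

lemma abs_hermite_fun_le: "\<bar>hermite_fun n \<alpha> x\<bar> \<le> hermite_weight n \<alpha>"
  unfolding hermite_fun_def hermite_weight_def abs_prod
  by (intro prod_mono) (auto simp: abs_hermite_fun1_le)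

lemma abs_hermite_partial_le:
  assumes "j < n"
  shows "\<bar>hermite_partial n j \<alpha> x\<bar> \<le> 2 * hermite_weight n \<alpha>"
proof -
  have "\<bar>hermite_partial n j \<alpha> x\<bar> \<le> (2 * (real (\<alpha> j) + 3)\<^sup>2) * (\<Prod>i\<in>{..<n} - {j}. (real (\<alpha> i) + 3)\<^sup>2)"
    unfolding hermite_partial_def abs_mult abs_prod
    by (intro mult_mono abs_hermite_fun1_deriv_le prod_mono) (auto simp: abs_hermite_fun1_le prod_nonneg)
  also have "\<dots> = 2 * hermite_weight n \<alpha>"
    unfolding hermite_weight_def using assms by (subst prod.remove[of "{..<n}" j]) auto
  finally show ?thesis .
qed

lemma measurable_hermite_fun [measurable]: "hermite_fun n \<alpha> \<in> borel_measurable (lebesgue_Rn n)"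
  unfolding hermite_fun_def[abs_def] lebesgue_Rn_def by measurable

lemma measurable_hermite_partial [measurable]:
  "j < n \<Longrightarrow> hermite_partial n j \<alpha> \<in> borel_measurable (lebesgue_Rn n)"
  unfolding hermite_partial_def[abs_def] lebesgue_Rn_def by measurable

lemma measurable_gauss [measurable]: "gauss n \<in> borel_measurable (lebesgue_Rn n)"
  unfolding gauss_def[abs_def] lebesgue_Rn_def by measurable

interpretation lborel_product: product_sigma_finite "\<lambda>_::nat. lborel :: real measure" ..

lemma integrable_gauss: "integrable (lebesgue_Rn n) (gauss n)"
  unfolding gauss_def[abs_def] lebesgue_Rn_def
  by (intro lborel_product.product_integrable_prod integrable_gaussian) auto

lemma integrable_gauss_bound:
  fixes u :: "(nat \<Rightarrow> real) \<Rightarrow> 'a::{banach, second_countable_topology}"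
  assumes "u \<in> borel_measurable (lebesgue_Rn n)" "\<And>x. x \<in> Rn n \<Longrightarrow> norm (u x) \<le> K * gauss n x"
  shows "integrable (lebesgue_Rn n) u"
  by (rule Bochner_Integration.integrable_bound[OF integrable_mult_right[OF integrable_gauss, of n K]])
     (use assms in \<open>auto intro!: AE_I2 order_trans[OF assms(2)] simp: space_lebesgue_Rn\<close>)

lemma hermite_fun_orthonormal:
  assumes "\<alpha> \<in> {..<n} \<rightarrow>\<^sub>E UNIV" "\<beta> \<in> {..<n} \<rightarrow>\<^sub>E UNIV"
  shows "(\<integral>x. hermite_fun n \<beta> x * hermite_fun n \<alpha> x \<partial>lebesgue_Rn n) = (if \<alpha> = \<beta> then 1 else 0)"
proof -
  have "(\<integral>x. hermite_fun n \<beta> x * hermite_fun n \<alpha> x \<partial>lebesgue_Rn n)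
      = (\<Prod>i<n. \<integral>s. hermite_fun1 (\<beta> i) s * hermite_fun1 (\<alpha> i) s \<partial>lborel)"
    unfolding hermite_fun_def prod.distrib[symmetric] lebesgue_Rn_def
    by (rule lborel_product.product_integral_prod) (auto intro: integrable_hermite_mult)
  also have "\<dots> = (\<Prod>i<n. if \<alpha> i = \<beta> i then 1 else 0)"
    by (intro prod.cong refl) (auto simp: hermite_fun1_orthogonal hermite_fun1_normalized)
  also have "\<dots> = (if \<alpha> = \<beta> then 1 else 0)"
  proof (cases "\<alpha> = \<beta>")
    case False
    then obtain i where "i < n" "\<alpha> i \<noteq> \<beta> i"
      using PiE_ext[OF assms] by auto
    then show ?thesis using False by (auto intro!: prod_zero)
  qed simp
  finally show ?thesis .
qed

section \<open>Hermite coefficients\<close>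

definition hermite_sum :: "nat \<Rightarrow> (nat \<Rightarrow> nat) set \<Rightarrow> ((nat \<Rightarrow> nat) \<Rightarrow> complex) \<Rightarrow> (nat \<Rightarrow> real) \<Rightarrow> complex" where
  "hermite_sum n A c x = (\<Sum>\<alpha>\<in>A. c \<alpha> * of_real (hermite_fun n \<alpha> x))"

lemma measurable_hermite_sum [measurable]: "hermite_sum n A c \<in> borel_measurable (lebesgue_Rn n)"
  unfolding hermite_sum_def[abs_def] by measurable

lemma hermite_sum_gauss_bound: "\<exists>K\<ge>0. \<forall>x. cmod (hermite_sum n A c x) \<le> K * gauss n x"
proof -
  obtain K where K: "\<And>\<alpha>. K \<alpha> \<ge> 0" "\<And>\<alpha> x. \<bar>hermite_fun n \<alpha> x\<bar> \<le> K \<alpha> * gauss n x"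
    using hermite_fun_gauss_bound by metis
  have "cmod (hermite_sum n A c x) \<le> (\<Sum>\<alpha>\<in>A. cmod (c \<alpha>) * K \<alpha>) * gauss n x" for x
  proof -
    have "cmod (hermite_sum n A c x) \<le> (\<Sum>\<alpha>\<in>A. cmod (c \<alpha>) * \<bar>hermite_fun n \<alpha> x\<bar>)"
      unfolding hermite_sum_def by (rule order_trans[OF norm_sum]) (simp add: norm_mult)
    also have "\<dots> \<le> (\<Sum>\<alpha>\<in>A. cmod (c \<alpha>) * (K \<alpha> * gauss n x))"
      by (intro sum_mono mult_left_mono K) auto
    finally show ?thesis by (simp add: sum_distrib_right mult.assoc)
  qed
  then show ?thesis by (intro exI[of _ "\<Sum>\<alpha>\<in>A. cmod (c \<alpha>) * K \<alpha>"]) (auto intro!: sum_nonneg mult_nonneg_nonneg K)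
qed

lemma hermite_coeff_hermite_sum:
  assumes "finite A" "A \<subseteq> {..<n} \<rightarrow>\<^sub>E UNIV" "\<alpha> \<in> {..<n} \<rightarrow>\<^sub>E UNIV"
  shows "hermite_coeff n \<alpha> (hermite_sum n A c) = (if \<alpha> \<in> A then c \<alpha> else 0)"
proof -
  have int: "integrable (lebesgue_Rn n) (\<lambda>x. hermite_fun n \<beta> x * hermite_fun n \<alpha> x)" for \<beta>
  proof -
    obtain K where K: "K \<ge> 0" "\<And>x. \<bar>hermite_fun n \<beta> x\<bar> \<le> K * gauss n x"
      using hermite_fun_gauss_bound by metis
    have "\<bar>hermite_fun n \<beta> x * hermite_fun n \<alpha> x\<bar> \<le> (K * hermite_weight n \<alpha>) * gauss n x" for x
    proof -
      have "\<bar>hermite_fun n \<beta> x * hermite_fun n \<alpha> x\<bar> \<le> (K * gauss n x) * hermite_weight n \<alpha>"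
        unfolding abs_mult using K(1) gauss_pos[of n x] by (intro mult_mono K abs_hermite_fun_le) auto
      then show ?thesis by (simp add: mult_ac)
    qed
    then show ?thesis by (intro integrable_gauss_bound[of _ _ "K * hermite_weight n \<alpha>"]) auto
  qed
  have "hermite_coeff n \<alpha> (hermite_sum n A c)
      = (\<integral>x. (\<Sum>\<beta>\<in>A. c \<beta> * of_real (hermite_fun n \<beta> x * hermite_fun n \<alpha> x)) \<partial>lebesgue_Rn n)"
    unfolding hermite_coeff_def hermite_sum_def by (simp add: sum_distrib_right mult.assoc)
  also have "\<dots> = (\<Sum>\<beta>\<in>A. c \<beta> * of_real (\<integral>x. hermite_fun n \<beta> x * hermite_fun n \<alpha> x \<partial>lebesgue_Rn n))"
    by (simp only: Bochner_Integration.integral_sum integral_mult_right_zero integral_complex_of_real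
        int integrable_mult_right integrable_of_real)
  also have "\<dots> = (\<Sum>\<beta>\<in>A. if \<alpha> = \<beta> then c \<beta> else 0)"
    using assms by (intro sum.cong refl) (subst hermite_fun_orthonormal, auto)
  also have "\<dots> = (if \<alpha> \<in> A then c \<alpha> else 0)"
    using assms(1) by simp
  finally show ?thesis .
qed

text \<open>Applied to a difference of functions, this says that an error of size
  \<open>K * gauss n x\<close> moves every coefficient by at most a fixed multiple of
  \<open>K\<close> times its weight, at a rate uniform in \<alpha>.\<close>

lemma hermite_coeff_bound:
  assumes [measurable]: "u \<in> borel_measurable (lebesgue_Rn n)"
    and b: "\<And>x. x \<in> Rn n \<Longrightarrow> cmod (u x) \<le> K * gauss n x" and "K \<ge> 0"
  shows "cmod (hermite_coeff n \<alpha> u) \<le> K * (\<integral>x. gauss n x \<partial>lebesgue_Rn n) * hermite_weight n \<alpha>"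
proof -
  have le: "cmod (u x * of_real (hermite_fun n \<alpha> x)) \<le> K * hermite_weight n \<alpha> * gauss n x" if "x \<in> Rn n" for x
  proof -
    have "cmod (u x * of_real (hermite_fun n \<alpha> x)) \<le> (K * gauss n x) * hermite_weight n \<alpha>"
      unfolding norm_mult norm_of_real using that \<open>K \<ge> 0\<close> gauss_pos[of n x]
      by (intro mult_mono b abs_hermite_fun_le) auto
    then show ?thesis by (simp add: mult_ac)
  qed
  have "cmod (hermite_coeff n \<alpha> u) \<le> (\<integral>x. cmod (u x * of_real (hermite_fun n \<alpha> x)) \<partial>lebesgue_Rn n)"
    unfolding hermite_coeff_def by (rule integral_norm_bound)
  also have "\<dots> \<le> (\<integral>x. K * hermite_weight n \<alpha> * gauss n x \<partial>lebesgue_Rn n)"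
    by (intro integral_mono integrable_mult_right integrable_gauss
        integrable_gauss_bound[of _ _ "K * hermite_weight n \<alpha>"])
       (auto simp: space_lebesgue_Rn le)
  also have "\<dots> = K * (\<integral>x. gauss n x \<partial>lebesgue_Rn n) * hermite_weight n \<alpha>"
    by simp
  finally show ?thesis .
qed

lemma hermite_coeff_diff:
  assumes [measurable]: "u \<in> borel_measurable (lebesgue_Rn n)" "v \<in> borel_measurable (lebesgue_Rn n)"
    and "\<And>x. x \<in> Rn n \<Longrightarrow> cmod (u x) \<le> K * gauss n x" "\<And>x. x \<in> Rn n \<Longrightarrow> cmod (v x) \<le> L * gauss n x"
    and KL: "K \<ge> 0" "L \<ge> 0"
  shows "hermite_coeff n \<alpha> (\<lambda>x. u x - v x) = hermite_coeff n \<alpha> u - hermite_coeff n \<alpha> v"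
proof -
  have *: "integrable (lebesgue_Rn n) (\<lambda>x. w x * complex_of_real (hermite_fun n \<alpha> x))"
    if [measurable]: "w \<in> borel_measurable (lebesgue_Rn n)" and b: "\<And>x. x \<in> Rn n \<Longrightarrow> cmod (w x) \<le> K * gauss n x" and "K \<ge> 0"
    for w :: "(nat \<Rightarrow> real) \<Rightarrow> complex" and K
  proof (rule integrable_gauss_bound[where K = "K * hermite_weight n \<alpha>"])
    fix x assume "x \<in> Rn n"
    then have "cmod (w x * of_real (hermite_fun n \<alpha> x)) \<le> (K * gauss n x) * hermite_weight n \<alpha>"
      unfolding norm_mult norm_of_real using \<open>K \<ge> 0\<close> gauss_pos[of n x]
      by (intro mult_mono b abs_hermite_fun_le) auto
    then show "cmod (w x * of_real (hermite_fun n \<alpha> x)) \<le> K * hermite_weight n \<alpha> * gauss n x"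
      by (simp add: mult_ac)
  qed measurable
  have "integrable (lebesgue_Rn n) (\<lambda>x. u x * complex_of_real (hermite_fun n \<alpha> x))"
    "integrable (lebesgue_Rn n) (\<lambda>x. v x * complex_of_real (hermite_fun n \<alpha> x))"
    using *[OF assms(1,3) KL(1)] *[OF assms(2,4) KL(2)] by blast+
  then show ?thesis
    unfolding hermite_coeff_def left_diff_distrib by (rule Bochner_Integration.integral_diff)
qed

text \<open>The terms are enumerated by the natural numbers. A single majorant for terms and
  derivatives gives absolute convergence, so that the enumeration does not affect the sums, and by
  the Weierstrass test uniform convergence of the differentiated series.\<close>

lemma has_vector_derivative_infsum:
  fixes F :: "'i \<Rightarrow> real \<Rightarrow> 'b::banach"
  assumes "countable I" "s \<in> {a<..<b}"
    and der: "\<And>i r. i \<in> I \<Longrightarrow> r \<in> {a<..<b} \<Longrightarrow> (F i has_vector_derivative F' i r) (at r)"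
    and B: "B summable_on I"
    and F: "\<And>i r. i \<in> I \<Longrightarrow> r \<in> {a<..<b} \<Longrightarrow> norm (F i r) \<le> B i"
    and F': "\<And>i r. i \<in> I \<Longrightarrow> r \<in> {a<..<b} \<Longrightarrow> norm (F' i r) \<le> B i"
  shows "((\<lambda>r. \<Sum>\<^sub>\<infinity>i\<in>I. F i r) has_vector_derivative (\<Sum>\<^sub>\<infinity>i\<in>I. F' i s)) (at s)"
proof (cases "finite I")
  case True
  then show ?thesis
    using assms by (auto intro!: derivative_eq_intros)
next
  case False
  define e where "e = from_nat_into I"
  have bij: "bij_betw e UNIV I"
    unfolding e_def using assms(1) False by (rule bij_betw_from_nat_into)
  have eI: "e k \<in> I" for k using bij by (auto simp: bij_betw_def)
  have sB: "summable (\<lambda>k. B (e k))"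
  proof -
    have "(\<lambda>k. B (e k)) summable_on UNIV" using B summable_on_reindex_bij_betw[OF bij] by blast
    then show ?thesis by (rule summable_on_imp_summable)
  qed
  have inf: "G sums (\<Sum>\<^sub>\<infinity>i\<in>I. H i)" if "\<And>i. i \<in> I \<Longrightarrow> norm (H i) \<le> B i" "G = (\<lambda>k. H (e k))" for G and H :: "'i \<Rightarrow> 'b"
  proof -
    have "(\<lambda>i. norm (H i)) summable_on I"
      by (rule summable_on_comparison_test[OF B]) (use that in auto)
    then have "H summable_on I" by (rule abs_summable_summable)
    then have "(\<lambda>k. H (e k)) summable_on UNIV" using summable_on_reindex_bij_betw[OF bij] by blast
    then have "(\<lambda>k. H (e k)) sums (\<Sum>\<^sub>\<infinity>k. H (e k))" by (intro has_sum_imp_sums has_sum_infsum)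
    then show ?thesis using infsum_reindex_bij_betw[OF bij, of H] that by simp
  qed
  define g' where "g' r h = h *\<^sub>R (\<Sum>\<^sub>\<infinity>i\<in>I. F' i r)" for r h
  have u: "uniform_limit {a<..<b} (\<lambda>k r. \<Sum>i<k. F' (e i) r) (\<lambda>r. suminf (\<lambda>i. F' (e i) r)) sequentially"
    by (rule Weierstrass_m_test[OF _ sB]) (use F' eI in auto)
  have sm: "suminf (\<lambda>i. F' (e i) r) = (\<Sum>\<^sub>\<infinity>i\<in>I. F' i r)" if "r \<in> {a<..<b}" for r
    using inf[of "\<lambda>i. F' i r"] F' that by (simp add: sums_unique[symmetric])
  have "\<exists>g. \<forall>r\<in>{a<..<b}. (\<lambda>k. F (e k) r) sums (g r) \<and> (g has_derivative g' r) (at r within {a<..<b})"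
  proof (rule has_derivative_series)
    show "(F (e k) has_derivative (\<lambda>h. h *\<^sub>R F' (e k) r)) (at r within {a<..<b})" if "r \<in> {a<..<b}" for k r
      using der[OF eI that] by (auto simp: has_vector_derivative_def intro: has_derivative_at_withinI)
    show "(\<lambda>k. F (e k) s) sums (\<Sum>\<^sub>\<infinity>i\<in>I. F i s)"
      by (rule inf) (use F assms(2) in auto)
    fix \<epsilon> :: real assume "\<epsilon> > 0"
    then have "\<forall>\<^sub>F k in sequentially. \<forall>r\<in>{a<..<b}. norm ((\<Sum>i<k. F' (e i) r) - suminf (\<lambda>i. F' (e i) r)) < \<epsilon>"
      using u by (simp add: uniform_limit_iff dist_norm)
    then show "\<forall>\<^sub>F k in sequentially. \<forall>r\<in>{a<..<b}. \<forall>h. norm ((\<Sum>i<k. h *\<^sub>R F' (e i) r) - g' r h) \<le> \<epsilon> * norm h"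
    proof (eventually_elim, intro ballI allI)
      fix k r h assume "\<forall>r\<in>{a<..<b}. norm ((\<Sum>i<k. F' (e i) r) - suminf (\<lambda>i. F' (e i) r)) < \<epsilon>" and r: "r \<in> {a<..<b}"
      then have "norm ((\<Sum>i<k. F' (e i) r) - (\<Sum>\<^sub>\<infinity>i\<in>I. F' i r)) \<le> \<epsilon>" using sm by fastforce
      then have "\<bar>h\<bar> * norm ((\<Sum>i<k. F' (e i) r) - (\<Sum>\<^sub>\<infinity>i\<in>I. F' i r)) \<le> \<bar>h\<bar> * \<epsilon>"
        by (intro mult_left_mono) auto
      then show "norm ((\<Sum>i<k. h *\<^sub>R F' (e i) r) - g' r h) \<le> \<epsilon> * norm h"
        unfolding g'_def scaleR_right.sum[symmetric] scaleR_right_diff_distrib[symmetric] norm_scaleR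
        by (simp add: mult.commute)
    qed
  qed (use assms(2) in auto)
  then obtain g where g: "\<And>r. r \<in> {a<..<b} \<Longrightarrow> (\<lambda>k. F (e k) r) sums (g r)"
    "\<And>r. r \<in> {a<..<b} \<Longrightarrow> (g has_derivative g' r) (at r within {a<..<b})" by blast
  have geq: "g r = (\<Sum>\<^sub>\<infinity>i\<in>I. F i r)" if "r \<in> {a<..<b}" for r
  proof (rule sums_unique2[OF g(1)[OF that]])
    show "(\<lambda>k. F (e k) r) sums (\<Sum>\<^sub>\<infinity>i\<in>I. F i r)"
      by (rule inf) (use F that in auto)
  qed
  have "at s within {a<..<b} = at s"
    by (rule at_within_open[OF assms(2)]) simp
  then have "(g has_derivative g' s) (at s)"
    using g(2)[OF assms(2)] by simp
  then have "((\<lambda>r. \<Sum>\<^sub>\<infinity>i\<in>I. F i r) has_derivative g' s) (at s)"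
    by (rule has_derivative_transform_within_open[of _ _ _ _ "{a<..<b}"]) (use assms(2) geq in auto)
  then show ?thesis unfolding has_vector_derivative_def g'_def .
qed

section \<open>Summability over the multi-indices\<close>

lemma hermite_eigenvalue_nonneg: "hermite_eigenvalue n \<alpha> \<ge> 0"
  unfolding hermite_eigenvalue_def by (rule of_nat_0_le_iff)

lemma hermite_eigenvalue_ge: "i < n \<Longrightarrow> real (2 * \<alpha> i + 1) \<le> hermite_eigenvalue n \<alpha>"
proof -
  assume i: "i < n"
  have "\<alpha> i \<le> (\<Sum>i<n. \<alpha> i)" using i by (intro member_le_sum) auto
  then show ?thesis using i unfolding hermite_eigenvalue_def by (intro of_nat_mono) linarith
qed

lemma power_div_fact_le_exp:
  fixes y :: real assumes "y \<ge> 0" shows "y ^ m / fact m \<le> exp y"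
proof -
  have "(\<Sum>k\<in>{m}. y ^ k /\<^sub>R fact k) \<le> (\<Sum>k. y ^ k /\<^sub>R fact k)"
    using assms by (intro sum_le_suminf summable_exp_generic) auto
  then show ?thesis by (simp add: exp_def divide_inverse mult.commute)
qed

lemma exp_neg_le_power:
  fixes y :: real assumes "y > 0" shows "exp (- y) \<le> fact m / y ^ m"
  using power_div_fact_le_exp[of y m] assms by (simp add: exp_minus field_simps)

text \<open>The exponential is replaced by the power \<open>12 * n + 1\<close> of the inverse of
  \<open>t * sqrt \<lambda>\<close>. One power of \<open>sqrt \<lambda>\<close> absorbs the factor
  \<open>1 + sqrt \<lambda>\<close>, the others give \<open>\<lambda> ^ (6 * n)\<close>, which is at
  least the product of all \<open>(2 * \<alpha> i + 1) ^ 6\<close>. Against the fourth powers in the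
  squared weight this leaves quadratic decay in each coordinate. For \<open>n \<ge> 1\<close> the
  eigenvalue \<lambda> is at least 1.\<close>

lemma poisson_weight_summable:
  assumes "t > 0" "n \<ge> 1"
  shows "(\<lambda>\<alpha>. (1 + sqrt (hermite_eigenvalue n \<alpha>)) * exp (- t * sqrt (hermite_eigenvalue n \<alpha>)) * (hermite_weight n \<alpha>)\<^sup>2)
    summable_on ({..<n} \<rightarrow>\<^sub>E UNIV)"
proof -
  define C where "C = 2 * fact (12 * n + 1) / t ^ (12 * n + 1)"
  define \<phi> where "\<phi> k = (real k + 3) ^ 4 / real (2 * k + 1) ^ 6" for k :: nat
  have C: "C > 0" unfolding C_def using assms by simp
  have "summable \<phi>"
  proof (rule summable_comparison_test)
    show "summable (\<lambda>k. 81 * (1 / (real k + 1)\<^sup>2))"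
      using inverse_squares_sums[THEN sums_summable] by (intro summable_mult) (simp add: add.commute)
    show "\<exists>N. \<forall>k\<ge>N. norm (\<phi> k) \<le> 81 * (1 / (real k + 1)\<^sup>2)"
    proof (intro exI[of _ 0] allI impI)
      fix k :: nat
      have "(real k + 3) ^ 4 \<le> (3 * real (2 * k + 1)) ^ 4" by (intro power_mono) auto
      then have "\<phi> k \<le> (3 * real (2 * k + 1)) ^ 4 / real (2 * k + 1) ^ 6"
        unfolding \<phi>_def by (intro divide_right_mono) auto
      also have "\<dots> = 81 * (1 / (real (2 * k + 1))\<^sup>2)"
      proof -
        have *: "(3 * x) ^ 4 / x ^ 6 = 81 * (1 / x\<^sup>2)" if "x > 0" for x :: real
          using that by (simp add: power_mult_distrib field_simps flip: power_add)
        show ?thesis by (rule *) simp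
      qed
      also have "\<dots> \<le> 81 * (1 / (real k + 1)\<^sup>2)"
        by (intro mult_left_mono divide_left_mono power_mono mult_pos_pos) auto
      finally show "norm (\<phi> k) \<le> 81 * (1 / (real k + 1)\<^sup>2)" by (simp add: \<phi>_def)
    qed
  qed
  then have "Infinite_Set_Sum.abs_summable_on \<phi> UNIV"
  proof -
    have "(\<lambda>k. norm (\<phi> k)) = \<phi>" by (simp add: \<phi>_def fun_eq_iff)
    then show ?thesis using \<open>summable \<phi>\<close> by (simp add: abs_summable_on_nat_iff')
  qed
  then have "Infinite_Set_Sum.abs_summable_on (\<lambda>\<alpha>. \<Prod>i\<in>{..<n}. \<phi> (\<alpha> i)) ({..<n} \<rightarrow>\<^sub>E UNIV)"
    by (intro abs_summable_on_prod_PiE) auto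
  then have "(\<lambda>\<alpha>. norm (\<Prod>i\<in>{..<n}. \<phi> (\<alpha> i))) summable_on ({..<n} \<rightarrow>\<^sub>E UNIV)"
    unfolding abs_summable_equivalent[symmetric] .
  then have "(\<lambda>\<alpha>. C * norm (\<Prod>i\<in>{..<n}. \<phi> (\<alpha> i))) summable_on ({..<n} \<rightarrow>\<^sub>E UNIV)"
    by (rule summable_on_cmult_right)
  then show ?thesis
  proof (rule summable_on_comparison_test)
    fix \<alpha> :: "nat \<Rightarrow> nat"
    define l where "l = hermite_eigenvalue n \<alpha>"
    have l1: "l \<ge> 1" using hermite_eigenvalue_ge[of 0 n \<alpha>] assms by (simp add: l_def)
    then have sl: "sqrt l \<ge> 1" by simp
    have "(1 + sqrt l) * exp (- t * sqrt l) \<le> (2 * sqrt l) * (fact (12 * n + 1) / (t * sqrt l) ^ (12 * n + 1))"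
    proof (intro mult_mono)
      show "exp (- t * sqrt l) \<le> fact (12 * n + 1) / (t * sqrt l) ^ (12 * n + 1)"
        using exp_neg_le_power[of "t * sqrt l" "12 * n + 1"] assms l1 by simp
    qed (use sl in auto)
    also have "\<dots> = C / (sqrt l) ^ (12 * n)"
    proof -
      have *: "(2 * r) * (F / (t * r) ^ (N + 1)) = 2 * F / t ^ (N + 1) / r ^ N" if "r > 0" for r F :: real and N
        using that assms by (simp add: power_mult_distrib field_simps)
      show ?thesis unfolding C_def by (rule *) (use l1 in simp)
    qed
    also have "(sqrt l) ^ (12 * n) = l ^ (6 * n)"
    proof -
      have "(sqrt l) ^ (12 * n) = ((sqrt l)\<^sup>2) ^ (6 * n)" by (simp add: power_mult[symmetric])
      then show ?thesis using l1 by simp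
    qed
    finally have 1: "(1 + sqrt l) * exp (- t * sqrt l) \<le> C / l ^ (6 * n)" .
    have "(\<Prod>i<n. real (2 * \<alpha> i + 1) ^ 6) \<le> (\<Prod>i<n. l ^ 6)"
      unfolding l_def by (intro prod_mono conjI power_mono hermite_eigenvalue_ge) auto
    also have "\<dots> = l ^ (6 * n)" by (simp add: power_mult)
    finally have 2: "(\<Prod>i<n. real (2 * \<alpha> i + 1) ^ 6) \<le> l ^ (6 * n)" .
    have 3: "(\<Prod>i<n. real (2 * \<alpha> i + 1) ^ 6) > 0" by (intro prod_pos) auto
    have "(1 + sqrt l) * exp (- t * sqrt l) * (hermite_weight n \<alpha>)\<^sup>2 \<le> C / (\<Prod>i<n. real (2 * \<alpha> i + 1) ^ 6) * (hermite_weight n \<alpha>)\<^sup>2"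
    proof (intro mult_right_mono)
      have "C / l ^ (6 * n) \<le> C / (\<Prod>i<n. real (2 * \<alpha> i + 1) ^ 6)"
        using 2 3 C by (intro divide_left_mono mult_pos_pos) auto
      then show "(1 + sqrt l) * exp (- t * sqrt l) \<le> C / (\<Prod>i<n. real (2 * \<alpha> i + 1) ^ 6)"
        using 1 by linarith
    qed auto
    also have "\<dots> = C * (\<Prod>i<n. \<phi> (\<alpha> i))"
      unfolding hermite_weight_def \<phi>_def prod_dividef prod_power_distrib[symmetric]
      by (simp add: power_mult[symmetric])
    also have "\<dots> \<le> C * norm (\<Prod>i\<in>{..<n}. \<phi> (\<alpha> i))"
      using C by (intro mult_left_mono) auto
    finally show "(1 + sqrt (hermite_eigenvalue n \<alpha>)) * exp (- t * sqrt (hermite_eigenvalue n \<alpha>)) * (hermite_weight n \<alpha>)\<^sup>2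
        \<le> C * norm (\<Prod>i\<in>{..<n}. \<phi> (\<alpha> i))"
      unfolding l_def .
  next
    show "0 \<le> (1 + sqrt (hermite_eigenvalue n \<alpha>)) * exp (- t * sqrt (hermite_eigenvalue n \<alpha>)) * (hermite_weight n \<alpha>)\<^sup>2" for \<alpha>
      by (intro mult_nonneg_nonneg add_nonneg_nonneg) (auto simp: hermite_eigenvalue_nonneg)
  qed
qed

section \<open>Poisson extensions as Hermite series\<close>

abbreviation multi_indices :: "nat \<Rightarrow> (nat \<Rightarrow> nat) set" where
  "multi_indices n \<equiv> {..<n} \<rightarrow>\<^sub>E UNIV"

text \<open>The index set is a parameter: all multi-indices give the Poisson extension, finite sets
  the sums for which the estimate is proved first.\<close>

definition hermite_series :: "nat \<Rightarrow> (nat \<Rightarrow> nat) set \<Rightarrow> ((nat \<Rightarrow> nat) \<Rightarrow> complex) \<Rightarrow> real \<Rightarrow> (nat \<Rightarrow> real) \<Rightarrow> complex" where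
  "hermite_series n A c t x = (\<Sum>\<^sub>\<infinity>\<alpha>\<in>A. of_real (exp (- t * sqrt (hermite_eigenvalue n \<alpha>))) * c \<alpha> * of_real (hermite_fun n \<alpha> x))"

definition hermite_series_t :: "nat \<Rightarrow> (nat \<Rightarrow> nat) set \<Rightarrow> ((nat \<Rightarrow> nat) \<Rightarrow> complex) \<Rightarrow> real \<Rightarrow> (nat \<Rightarrow> real) \<Rightarrow> complex" where
  "hermite_series_t n A c t x = (\<Sum>\<^sub>\<infinity>\<alpha>\<in>A. of_real (- sqrt (hermite_eigenvalue n \<alpha>) * exp (- t * sqrt (hermite_eigenvalue n \<alpha>)))
     * c \<alpha> * of_real (hermite_fun n \<alpha> x))"

definition hermite_series_x :: "nat \<Rightarrow> nat \<Rightarrow> (nat \<Rightarrow> nat) set \<Rightarrow> ((nat \<Rightarrow> nat) \<Rightarrow> complex) \<Rightarrow> real \<Rightarrow> (nat \<Rightarrow> real) \<Rightarrow> complex" where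
  "hermite_series_x n j A c t x = (\<Sum>\<^sub>\<infinity>\<alpha>\<in>A. of_real (exp (- t * sqrt (hermite_eigenvalue n \<alpha>))) * c \<alpha> * of_real (hermite_partial n j \<alpha> x))"

definition star_series ::
  "nat \<Rightarrow> nat \<Rightarrow> (nat \<Rightarrow> nat) set \<Rightarrow> (nat \<Rightarrow> (nat \<Rightarrow> nat) \<Rightarrow> complex) \<Rightarrow> (nat \<Rightarrow> real) \<Rightarrow> real \<Rightarrow> real" where
  "star_series n N A c x t = sqrt (
     (norm_CN N (\<lambda>i. hermite_series_t n A (c i) t x))\<^sup>2
   + (\<Sum>j<n. (norm_CN N (\<lambda>i. hermite_series_x n j A (c i) t x))\<^sup>2)
   + (norm_Rn n x)\<^sup>2 * (norm_CN N (\<lambda>i. hermite_series n A (c i) t x))\<^sup>2)"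

text \<open>One majorant for the terms of all three series: \<open>1 + sqrt \<lambda>\<close> covers
  the time derivative, one factor \<open>hermite_weight\<close> the coefficient, the other, with the
  2, the Hermite function and its first partial derivatives.\<close>

definition poisson_weight :: "nat \<Rightarrow> real \<Rightarrow> (nat \<Rightarrow> nat) \<Rightarrow> real" where
  "poisson_weight n t \<alpha> = 2 * ((1 + sqrt (hermite_eigenvalue n \<alpha>)) * exp (- t * sqrt (hermite_eigenvalue n \<alpha>))
     * (hermite_weight n \<alpha>)\<^sup>2)"

lemma summable_poisson_weight: "t > 0 \<Longrightarrow> n \<ge> 1 \<Longrightarrow> poisson_weight n t summable_on multi_indices n"
  unfolding poisson_weight_def[abs_def] by (intro summable_on_cmult_right poisson_weight_summable)

lemma term_bound:
  assumes "t \<le> s" "\<bar>g\<bar> \<le> (1 + sqrt (hermite_eigenvalue n \<alpha>)) * exp (- s * sqrt (hermite_eigenvalue n \<alpha>))"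
    and "cmod z \<le> B * hermite_weight n \<alpha>" "\<bar>h\<bar> \<le> 2 * hermite_weight n \<alpha>" "B \<ge> 0"
  shows "cmod (of_real g * z * of_real h) \<le> B * poisson_weight n t \<alpha>"
proof -
  define l where "l = sqrt (hermite_eigenvalue n \<alpha>)"
  have l: "l \<ge> 0" by (simp add: l_def hermite_eigenvalue_nonneg)
  have w: "hermite_weight n \<alpha> > 0" by (rule hermite_weight_pos)
  have "exp (- s * l) \<le> exp (- t * l)" using assms(1) l by (simp add: mult_right_mono)
  then have "(1 + l) * exp (- s * l) \<le> (1 + l) * exp (- t * l)" using l by (intro mult_left_mono) auto
  then have g: "\<bar>g\<bar> \<le> (1 + l) * exp (- t * l)" using assms(2) unfolding l_def by linarith
  have "\<bar>g\<bar> * cmod z * \<bar>h\<bar> \<le> ((1 + l) * exp (- t * l)) * (B * hermite_weight n \<alpha>) * (2 * hermite_weight n \<alpha>)"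
    using g assms l w by (intro mult_mono) auto
  also have "\<dots> = B * poisson_weight n t \<alpha>"
    by (simp add: poisson_weight_def l_def power2_eq_square)
  finally show ?thesis by (simp add: norm_mult)
qed

lemma exp_factor_bound:
  "\<bar>exp (- s * sqrt (hermite_eigenvalue n \<alpha>))\<bar> \<le> (1 + sqrt (hermite_eigenvalue n \<alpha>)) * exp (- s * sqrt (hermite_eigenvalue n \<alpha>))"
  "\<bar>- sqrt (hermite_eigenvalue n \<alpha>) * exp (- s * sqrt (hermite_eigenvalue n \<alpha>))\<bar>
     \<le> (1 + sqrt (hermite_eigenvalue n \<alpha>)) * exp (- s * sqrt (hermite_eigenvalue n \<alpha>))"
  using hermite_eigenvalue_nonneg[of n \<alpha>] by (auto simp: abs_mult)

lemma abs_hermite_fun_le2: "\<bar>hermite_fun n \<alpha> x\<bar> \<le> 2 * hermite_weight n \<alpha>"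
  using abs_hermite_fun_le[of n \<alpha> x] hermite_weight_pos[of n \<alpha>] by linarith

lemma countable_multi_indices: "countable (multi_indices n)"
  by (intro countable_PiE) auto

lemma hermite_series_has_vector_derivative_t:
  assumes "t > 0" "n \<ge> 1" "\<And>\<alpha>. cmod (c \<alpha>) \<le> B * hermite_weight n \<alpha>"
  shows "((\<lambda>s. hermite_series n (multi_indices n) c s x) has_vector_derivative hermite_series_t n (multi_indices n) c t x) (at t)"
  unfolding hermite_series_def hermite_series_t_def
proof (rule has_vector_derivative_infsum)
  have B: "B \<ge> 0" using assms(3)[of undefined] hermite_weight_pos[of n undefined]
    by (meson norm_ge_zero order_trans zero_le_mult_iff not_less)
  \<comment> \<open>On this interval the majorant at time \<open>t / 2\<close> works for all
    times.\<close>
  show "t \<in> {t / 2<..<2 * t}" using assms by auto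
  show "(\<lambda>\<alpha>. B * poisson_weight n (t / 2) \<alpha>) summable_on multi_indices n"
    using assms by (intro summable_on_cmult_right summable_poisson_weight) auto
  fix \<alpha> r assume r: "r \<in> {t / 2<..<2 * t}"
  show "cmod (of_real (exp (- r * sqrt (hermite_eigenvalue n \<alpha>))) * c \<alpha> * of_real (hermite_fun n \<alpha> x)) \<le> B * poisson_weight n (t / 2) \<alpha>"
    using r by (intro term_bound[of _ r] exp_factor_bound assms abs_hermite_fun_le2 B) auto
  show "cmod (of_real (- sqrt (hermite_eigenvalue n \<alpha>) * exp (- r * sqrt (hermite_eigenvalue n \<alpha>))) * c \<alpha> * of_real (hermite_fun n \<alpha> x)) \<le> B * poisson_weight n (t / 2) \<alpha>"
    using r by (intro term_bound[of _ r] exp_factor_bound assms abs_hermite_fun_le2 B) auto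
  have "((\<lambda>r. exp (- r * sqrt (hermite_eigenvalue n \<alpha>))) has_real_derivative
      - sqrt (hermite_eigenvalue n \<alpha>) * exp (- r * sqrt (hermite_eigenvalue n \<alpha>))) (at r)"
    by (auto intro!: derivative_eq_intros)
  then show "((\<lambda>r. of_real (exp (- r * sqrt (hermite_eigenvalue n \<alpha>))) * c \<alpha> * of_real (hermite_fun n \<alpha> x))
      has_vector_derivative of_real (- sqrt (hermite_eigenvalue n \<alpha>) * exp (- r * sqrt (hermite_eigenvalue n \<alpha>)))
        * c \<alpha> * of_real (hermite_fun n \<alpha> x)) (at r)"
    by (intro has_vector_derivative_mult_left has_vector_derivative_of_real)
qed (rule countable_multi_indices)

lemma hermite_series_has_vector_derivative_x:
  assumes "t > 0" "j < n" "\<And>\<alpha>. cmod (c \<alpha>) \<le> B * hermite_weight n \<alpha>"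
  shows "((\<lambda>s. hermite_series n (multi_indices n) c t (x(j := s))) has_vector_derivative hermite_series_x n j (multi_indices n) c t x) (at (x j))"
proof -
  have B: "B \<ge> 0" using assms(3)[of undefined] hermite_weight_pos[of n undefined]
    by (meson norm_ge_zero order_trans zero_le_mult_iff not_less)
  have "((\<lambda>s. hermite_series n (multi_indices n) c t (x(j := s))) has_vector_derivative
    (\<Sum>\<^sub>\<infinity>\<alpha>\<in>multi_indices n. of_real (exp (- t * sqrt (hermite_eigenvalue n \<alpha>))) * c \<alpha>
        * of_real (hermite_partial n j \<alpha> (x(j := x j))))) (at (x j))"
    unfolding hermite_series_def
  \<comment> \<open>The bounds do not depend on the point, so any neighbourhood of
    \<open>x j\<close> will do.\<close>
  proof (rule has_vector_derivative_infsum[where a = "x j - 1" and b = "x j + 1"])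
    show "(\<lambda>\<alpha>. B * poisson_weight n t \<alpha>) summable_on multi_indices n"
      using assms by (intro summable_on_cmult_right summable_poisson_weight) auto
    fix \<alpha> and r :: real
    show "cmod (of_real (exp (- t * sqrt (hermite_eigenvalue n \<alpha>))) * c \<alpha> * of_real (hermite_fun n \<alpha> (x(j := r)))) \<le> B * poisson_weight n t \<alpha>"
      by (intro term_bound[of _ t] exp_factor_bound assms abs_hermite_fun_le2 B) auto
    show "cmod (of_real (exp (- t * sqrt (hermite_eigenvalue n \<alpha>))) * c \<alpha> * of_real (hermite_partial n j \<alpha> (x(j := r)))) \<le> B * poisson_weight n t \<alpha>"
      using assms by (intro term_bound[of _ t] exp_factor_bound assms abs_hermite_partial_le B) auto
    show "((\<lambda>r. of_real (exp (- t * sqrt (hermite_eigenvalue n \<alpha>))) * c \<alpha> * of_real (hermite_fun n \<alpha> (x(j := r))))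
      has_vector_derivative of_real (exp (- t * sqrt (hermite_eigenvalue n \<alpha>)))
        * c \<alpha> * of_real (hermite_partial n j \<alpha> (x(j := r)))) (at r)"
      by (intro has_vector_derivative_mult_right has_vector_derivative_of_real has_real_derivative_hermite_fun assms)
  qed (auto simp: countable_multi_indices)
  then show ?thesis by (simp add: hermite_series_x_def)
qed

text \<open>Replaces the derivatives in \<open>star_norm\<close> by explicit series, which can be
  compared with those of finite sums coefficient by coefficient.\<close>

lemma star_norm_poisson:
  assumes "t > 0" "n \<ge> 1" "\<And>i \<alpha>. i < N \<Longrightarrow> cmod (hermite_coeff n \<alpha> (\<lambda>y. f y i)) \<le> B * hermite_weight n \<alpha>"
  shows "star_norm n N (\<lambda>y s. poisson n s f y) x t
    = star_series n N (multi_indices n) (\<lambda>i \<alpha>. hermite_coeff n \<alpha> (\<lambda>y. f y i)) x t"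
proof -
  have p: "poisson n s f y i = hermite_series n (multi_indices n) (\<lambda>\<alpha>. hermite_coeff n \<alpha> (\<lambda>y. f y i)) s y" for s y i
    by (simp add: poisson_def hermite_calculus_def hermite_series_def)
  have 1: "vector_derivative (\<lambda>s. poisson n s f x i) (at t) = hermite_series_t n (multi_indices n) (\<lambda>\<alpha>. hermite_coeff n \<alpha> (\<lambda>y. f y i)) t x"
    if "i < N" for i
    unfolding p using assms that by (intro vector_derivative_at hermite_series_has_vector_derivative_t) auto
  have 2: "partial j (\<lambda>y. poisson n t f y i) x = hermite_series_x n j (multi_indices n) (\<lambda>\<alpha>. hermite_coeff n \<alpha> (\<lambda>y. f y i)) t x"
    if "i < N" "j < n" for i j
    unfolding p partial_def using assms that by (intro vector_derivative_at hermite_series_has_vector_derivative_x) auto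
  show ?thesis
    unfolding star_norm_def star_series_def norm_CN_def
    by (intro arg_cong[where f = sqrt] arg_cong2[where f = "(+)"] sum.cong refl
        arg_cong[where f = "\<lambda>x. x\<^sup>2"] arg_cong2[where f = "(*)"] L2_set_cong) (auto simp: p 1[unfolded p] 2[unfolded p])
qed

text \<open>The difference of the two series is again such a series, with coefficients bounded by
  \<open>e k * w \<alpha>\<close>, and so it is at most \<open>e k * infsum T S\<close>.\<close>

lemma infsum_weighted_tendsto:
  fixes c :: "'i \<Rightarrow> complex" and g h w T :: "'i \<Rightarrow> real"
  assumes T: "T summable_on S"
    and gh: "\<And>\<alpha> z b. \<alpha> \<in> S \<Longrightarrow> b \<ge> 0 \<Longrightarrow> cmod z \<le> b * w \<alpha> \<Longrightarrow> cmod (of_real (g \<alpha>) * z * of_real (h \<alpha>)) \<le> b * T \<alpha>"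
    and c: "\<And>\<alpha>. \<alpha> \<in> S \<Longrightarrow> cmod (c \<alpha>) \<le> B * w \<alpha>" "B \<ge> 0"
    and d: "\<And>k \<alpha>. \<alpha> \<in> S \<Longrightarrow> cmod (d k \<alpha> - c \<alpha>) \<le> e k * w \<alpha>" "\<And>k. e k \<ge> 0" and e: "e \<longlonglongrightarrow> 0"
  shows "(\<lambda>k. \<Sum>\<^sub>\<infinity>\<alpha>\<in>S. of_real (g \<alpha>) * d k \<alpha> * of_real (h \<alpha>)) \<longlonglongrightarrow> (\<Sum>\<^sub>\<infinity>\<alpha>\<in>S. of_real (g \<alpha>) * c \<alpha> * of_real (h \<alpha>))"
proof -
  have sm: "(\<lambda>\<alpha>. of_real (g \<alpha>) * z \<alpha> * of_real (h \<alpha>)) summable_on S \<and>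
      cmod (\<Sum>\<^sub>\<infinity>\<alpha>\<in>S. of_real (g \<alpha>) * z \<alpha> * of_real (h \<alpha>)) \<le> b * infsum T S"
    if "\<And>\<alpha>. \<alpha> \<in> S \<Longrightarrow> cmod (z \<alpha>) \<le> b * w \<alpha>" "b \<ge> 0" for z b
  proof
    have "(\<lambda>\<alpha>. b * T \<alpha>) summable_on S" by (intro summable_on_cmult_right T)
    then have a: "(\<lambda>\<alpha>. norm (of_real (g \<alpha>) * z \<alpha> * of_real (h \<alpha>))) summable_on S"
      by (rule summable_on_comparison_test) (use gh that in auto)
    then show "(\<lambda>\<alpha>. of_real (g \<alpha>) * z \<alpha> * of_real (h \<alpha>)) summable_on S"
      by (rule abs_summable_summable)
    have "cmod (\<Sum>\<^sub>\<infinity>\<alpha>\<in>S. of_real (g \<alpha>) * z \<alpha> * of_real (h \<alpha>)) \<le> (\<Sum>\<^sub>\<infinity>\<alpha>\<in>S. norm (of_real (g \<alpha>) * z \<alpha> * of_real (h \<alpha>)))"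
      by (rule norm_infsum_bound[OF a])
    also have "\<dots> \<le> (\<Sum>\<^sub>\<infinity>\<alpha>\<in>S. b * T \<alpha>)"
      by (intro infsum_mono a summable_on_cmult_right T) (use gh that in auto)
    finally show "cmod (\<Sum>\<^sub>\<infinity>\<alpha>\<in>S. of_real (g \<alpha>) * z \<alpha> * of_real (h \<alpha>)) \<le> b * infsum T S"
      by (simp add: infsum_cmult_right')
  qed
  have le: "cmod ((\<Sum>\<^sub>\<infinity>\<alpha>\<in>S. of_real (g \<alpha>) * d k \<alpha> * of_real (h \<alpha>)) - (\<Sum>\<^sub>\<infinity>\<alpha>\<in>S. of_real (g \<alpha>) * c \<alpha> * of_real (h \<alpha>)))
      \<le> e k * infsum T S" for k
  proof -
    have cs: "(\<lambda>\<alpha>. of_real (g \<alpha>) * c \<alpha> * of_real (h \<alpha>)) summable_on S" using sm[OF c(1) c(2)] by blast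
    have ds: "(\<lambda>\<alpha>. of_real (g \<alpha>) * (d k \<alpha> - c \<alpha>) * of_real (h \<alpha>)) summable_on S"
      and dl: "cmod (\<Sum>\<^sub>\<infinity>\<alpha>\<in>S. of_real (g \<alpha>) * (d k \<alpha> - c \<alpha>) * of_real (h \<alpha>)) \<le> e k * infsum T S"
      using sm[of "\<lambda>\<alpha>. d k \<alpha> - c \<alpha>" "e k"] d by auto
    have "(\<Sum>\<^sub>\<infinity>\<alpha>\<in>S. of_real (g \<alpha>) * d k \<alpha> * of_real (h \<alpha>))
      = (\<Sum>\<^sub>\<infinity>\<alpha>\<in>S. of_real (g \<alpha>) * c \<alpha> * of_real (h \<alpha>) + of_real (g \<alpha>) * (d k \<alpha> - c \<alpha>) * of_real (h \<alpha>))"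
      by (intro infsum_cong) (simp add: algebra_simps)
    also have "\<dots> = (\<Sum>\<^sub>\<infinity>\<alpha>\<in>S. of_real (g \<alpha>) * c \<alpha> * of_real (h \<alpha>))
       + (\<Sum>\<^sub>\<infinity>\<alpha>\<in>S. of_real (g \<alpha>) * (d k \<alpha> - c \<alpha>) * of_real (h \<alpha>))"
      by (rule infsum_add[OF cs ds])
    finally show ?thesis using dl by simp
  qed
  have "(\<lambda>k. e k * infsum T S) \<longlonglongrightarrow> 0" using tendsto_mult_left_zero[OF e] .
  then show ?thesis
    by (rule LIM_zero_cancel[OF Lim_null_comparison[OF always_eventually[OF allI[OF le]]]])
qed

lemma star_series_tendsto:
  assumes "t > 0" "n \<ge> 1" "B \<ge> 0"
    and c: "\<And>i \<alpha>. i < N \<Longrightarrow> cmod (c i \<alpha>) \<le> B * hermite_weight n \<alpha>"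
    and d: "\<And>k i \<alpha>. i < N \<Longrightarrow> \<alpha> \<in> multi_indices n \<Longrightarrow> cmod (d k i \<alpha> - c i \<alpha>) \<le> e k * hermite_weight n \<alpha>"
      "\<And>k. e k \<ge> 0" "e \<longlonglongrightarrow> 0"
  shows "(\<lambda>k. star_series n N (multi_indices n) (d k) x t) \<longlonglongrightarrow> star_series n N (multi_indices n) c x t"
proof -
  note T = summable_poisson_weight[OF assms(1,2)]
  have 1: "(\<lambda>k. hermite_series n (multi_indices n) (d k i) t x) \<longlonglongrightarrow> hermite_series n (multi_indices n) (c i) t x" if "i < N" for i
    unfolding hermite_series_def
    by (rule infsum_weighted_tendsto[OF T _ c[OF that] assms(3) d(1)[OF that] d(2,3)])
       (intro term_bound[of t t] exp_factor_bound abs_hermite_fun_le2 order_refl)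
  have 2: "(\<lambda>k. hermite_series_t n (multi_indices n) (d k i) t x) \<longlonglongrightarrow> hermite_series_t n (multi_indices n) (c i) t x" if "i < N" for i
    unfolding hermite_series_t_def
    by (rule infsum_weighted_tendsto[OF T _ c[OF that] assms(3) d(1)[OF that] d(2,3)])
       (intro term_bound[of t t] exp_factor_bound abs_hermite_fun_le2 order_refl)
  have 3: "(\<lambda>k. hermite_series_x n j (multi_indices n) (d k i) t x) \<longlonglongrightarrow> hermite_series_x n j (multi_indices n) (c i) t x"
    if "i < N" "j < n" for i j
    unfolding hermite_series_x_def
    by (rule infsum_weighted_tendsto[OF T _ c[OF that(1)] assms(3) d(1)[OF that(1)] d(2,3)])
       (intro term_bound[of t t] exp_factor_bound abs_hermite_partial_le that order_refl)
  show ?thesis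
    unfolding star_series_def norm_CN_def L2_set_def
    by (intro tendsto_intros) (auto intro!: 1 2 3)
qed

text \<open>A finite sum is a full series with zeros filled in, so that convergence of coefficients
  can be stated over all multi-indices.\<close>

lemma hermite_series_restrict:
  assumes "A \<subseteq> multi_indices n"
  defines "d c \<alpha> \<equiv> if \<alpha> \<in> A then c \<alpha> else 0"
  shows "hermite_series n (multi_indices n) (d c) t x = hermite_series n A c t x"
    "hermite_series_t n (multi_indices n) (d c) t x = hermite_series_t n A c t x"
    "hermite_series_x n j (multi_indices n) (d c) t x = hermite_series_x n j A c t x"
  unfolding hermite_series_def hermite_series_t_def hermite_series_x_def d_def
  by (rule infsum_cong_neutral; use assms in auto)+

lemma star_series_restrict:
  assumes "A \<subseteq> multi_indices n"
  shows "star_series n N (multi_indices n) (\<lambda>i \<alpha>. if \<alpha> \<in> A then c i \<alpha> else 0) x t = star_series n N A c x t"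
  unfolding star_series_def hermite_series_restrict[OF assms] ..

section \<open>The Bellman function\<close>

lemma DERIV_powr_const:
  fixes g :: "real \<Rightarrow> real"
  assumes "(g has_real_derivative g') (at x)" "g x > 0"
  shows "((\<lambda>x. g x powr r) has_real_derivative r * g x powr (r - 1) * g') (at x)"
  using DERIV_fun_powr[OF assms, of r] by simp

lemma powr_add_le_add_powr:
  fixes x y r :: real
  assumes "x \<ge> 0" "y \<ge> 0" "0 \<le> r" "r \<le> 1"
  shows "(x + y) powr r \<le> x powr r + y powr r"
proof (cases "x = 0 \<or> y = 0")
  case True
  then show ?thesis by auto
next
  case False
  then have p: "x > 0" "y > 0" using assms by auto
  have "(x + y) powr r = x * (x + y) powr (r - 1) + y * (x + y) powr (r - 1)"
  proof -
    have "(x + y) * (x + y) powr (r - 1) = (x + y) powr r" using p by (simp add: powr_diff)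
    then show ?thesis by (simp only: distrib_right)
  qed
  also have "\<dots> \<le> x * x powr (r - 1) + y * y powr (r - 1)"
    using p assms by (intro add_mono mult_left_mono powr_mono2') auto
  also have "\<dots> = x powr r + y powr r"
    using p by (simp add: powr_diff field_simps)
  finally show ?thesis .
qed

text \<open>Here \<open>m = p - 1\<close> with \<open>p \<ge> 2\<close>, and \<open>sg = 1 - q / 2\<close>.  At \<open>U = |\<zeta>|\<^sup>2\<close> and \<open>V = |\<eta>|\<^sup>2\<close> the function
  \<open>bell U V\<close> is \<open>|\<zeta>|\<^sup>p + |\<eta>|\<^sup>q + \<delta> |\<zeta>|\<^sup>2 (|\<eta>|\<^sup>2 + |\<zeta>| powr (2 p - 2)) powr (1 - q / 2)\<close> with \<open>\<delta>\<close> of order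
  \<open>1 / (p - 1)\<close>: a smooth substitute for the Bellman function of Nazarov and Treil, which is only
  piecewise \<open>C\<^sup>2\<close>.\<close>

locale bellman =
  fixes m :: real
  assumes m: "m \<ge> 1"
begin

definition sg :: real where "sg = (1 - 1 / m) / 2"
text \<open>The errors proportional to \<open>del\<close> in the Hessian estimate take away
  \<open>(1 + 4 + 2) * del\<close> from the available coefficient \<open>1 / m\<close>. With 14 this
  is exactly one half, and \<open>7 * del\<close> remains.\<close>

definition del :: real where "del = 1 / (14 * m)"

lemma sg: "0 \<le> sg" "sg < 1 / 2" "1 / m = 1 - 2 * sg" "m * sg = (m - 1) / 2"
  using m by (auto simp: sg_def field_simps)

lemma del_pos: "del > 0" using m by (simp add: del_def)

abbreviation DD :: "real \<Rightarrow> real \<Rightarrow> real" where "DD U V \<equiv> V + U powr m"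

definition bell :: "real \<Rightarrow> real \<Rightarrow> real" where
  "bell U V = U powr ((m + 1) / 2) + V powr (1 - sg) + del * (U * DD U V powr sg)"

definition bU :: "real \<Rightarrow> real \<Rightarrow> real" where
  "bU U V = (m + 1) / 2 * U powr ((m - 1) / 2)
     + del * (DD U V powr sg + sg * m * (U powr m * DD U V powr (sg - 1)))"

definition bV :: "real \<Rightarrow> real \<Rightarrow> real" where
  "bV U V = (1 - sg) * V powr (- sg) + del * (sg * (U * DD U V powr (sg - 1)))"

definition bUU :: "real \<Rightarrow> real \<Rightarrow> real" where
  "bUU U V = (m + 1) / 2 * ((m - 1) / 2) * U powr ((m - 3) / 2)
     + del * (sg * m * (m + 1) * (U powr (m - 1) * DD U V powr (sg - 1))
        - sg * (1 - sg) * m\<^sup>2 * (U powr m * U powr (m - 1) * DD U V powr (sg - 2)))"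

definition bUV :: "real \<Rightarrow> real \<Rightarrow> real" where
  "bUV U V = del * (sg * DD U V powr (sg - 1) - sg * (1 - sg) * m * (U powr m * DD U V powr (sg - 2)))"

definition bVV :: "real \<Rightarrow> real \<Rightarrow> real" where
  "bVV U V = - (sg * (1 - sg) * V powr (- sg - 1)) - del * (sg * (1 - sg) * (U * DD U V powr (sg - 2)))"

lemmas bell_defs = bell_def bU_def bV_def bUU_def bUV_def bVV_def

lemma DD_pos: "V > 0 \<Longrightarrow> DD U V > 0"
  using powr_ge_zero[of U m] by linarith

section \<open>Derivatives of the Bellman function\<close>

lemma DERIV_DD_powr:
  assumes "(U has_real_derivative U') (at s)" "(V has_real_derivative V') (at s)" "U s > 0" "V s > 0"
  shows "((\<lambda>s. DD (U s) (V s) powr r) has_real_derivative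
     r * DD (U s) (V s) powr (r - 1) * (V' + m * U s powr (m - 1) * U')) (at s)"
  using assms by (intro DERIV_powr_const DERIV_add DD_pos)

lemma powr_mult_self: "U > 0 \<Longrightarrow> U * U powr (r - 1) = U powr r" for U r :: real
  by (simp add: powr_diff)

lemma DERIV_bell:
  assumes U: "(U has_real_derivative U') (at s)" "U s > 0" and V: "(V has_real_derivative V') (at s)" "V s > 0"
  shows "((\<lambda>s. bell (U s) (V s)) has_real_derivative bU (U s) (V s) * U' + bV (U s) (V s) * V') (at s)"
proof -
  define D where "D = DD (U s) (V s)"
  have "((\<lambda>s. bell (U s) (V s)) has_real_derivative
      (m + 1) / 2 * U s powr ((m + 1) / 2 - 1) * U' + (1 - sg) * V s powr (1 - sg - 1) * V'
      + del * (U' * D powr sg + sg * D powr (sg - 1) * (V' + m * U s powr (m - 1) * U') * U s)) (at s)"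
    unfolding bell_def D_def
    by (intro DERIV_add DERIV_cmult DERIV_mult DERIV_powr_const DERIV_DD_powr U V)
  also have "(m + 1) / 2 - 1 = (m - 1) / 2" by (simp add: field_simps)
  also have "1 - sg - 1 = - sg" by simp
  also have "(m + 1) / 2 * U s powr ((m - 1) / 2) * U' + (1 - sg) * V s powr (- sg) * V'
      + del * (U' * D powr sg + sg * D powr (sg - 1) * (V' + m * U s powr (m - 1) * U') * U s)
     = ((m + 1) / 2 * U s powr ((m - 1) / 2) + del * (D powr sg + sg * m * ((U s * U s powr (m - 1)) * D powr (sg - 1)))) * U'
      + ((1 - sg) * V s powr (- sg) + del * (sg * (U s * D powr (sg - 1)))) * V'"
    by (simp add: algebra_simps)
  also have "\<dots> = bU (U s) (V s) * U' + bV (U s) (V s) * V'"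
    unfolding bU_def bV_def powr_mult_self[OF U(2)] D_def by simp
  finally show ?thesis .
qed

lemma DERIV_bU:
  assumes U: "(U has_real_derivative U') (at s)" "U s > 0" and V: "(V has_real_derivative V') (at s)" "V s > 0"
  shows "((\<lambda>s. bU (U s) (V s)) has_real_derivative bUU (U s) (V s) * U' + bUV (U s) (V s) * V') (at s)"
proof -
  define D where "D = DD (U s) (V s)"
  define W where "W = U s powr m"
  define W1 where "W1 = U s powr (m - 1)"
  have "((\<lambda>s. bU (U s) (V s)) has_real_derivative
      (m + 1) / 2 * ((m - 1) / 2 * U s powr ((m - 1) / 2 - 1) * U')
      + del * (sg * D powr (sg - 1) * (V' + m * W1 * U')
        + sg * m * (m * W1 * U' * D powr (sg - 1)
           + (sg - 1) * D powr (sg - 1 - 1) * (V' + m * W1 * U') * W))) (at s)"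
    unfolding bU_def D_def W_def W1_def
    by (intro DERIV_add DERIV_cmult DERIV_mult DERIV_powr_const DERIV_DD_powr U V)
  also have "(m - 1) / 2 - 1 = (m - 3) / 2" by (simp add: field_simps)
  also have "sg - 1 - 1 = sg - 2" by simp
  also have "(m + 1) / 2 * ((m - 1) / 2 * U s powr ((m - 3) / 2) * U')
      + del * (sg * D powr (sg - 1) * (V' + m * W1 * U')
        + sg * m * (m * W1 * U' * D powr (sg - 1)
           + (sg - 1) * D powr (sg - 2) * (V' + m * W1 * U') * W))
     = ((m + 1) / 2 * ((m - 1) / 2) * U s powr ((m - 3) / 2)
         + del * (sg * m * (m + 1) * (W1 * D powr (sg - 1)) - sg * (1 - sg) * m\<^sup>2 * (W * W1 * D powr (sg - 2)))) * U'
       + del * (sg * D powr (sg - 1) - sg * (1 - sg) * m * (W * D powr (sg - 2))) * V'"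
    by (simp only: distrib_left distrib_right left_diff_distrib right_diff_distrib power2_eq_square mult_ac mult_1_left mult_1_right)
  also have "\<dots> = bUU (U s) (V s) * U' + bUV (U s) (V s) * V'"
    unfolding bUU_def bUV_def D_def W_def W1_def by simp
  finally show ?thesis .
qed

lemma DERIV_bV:
  assumes U: "(U has_real_derivative U') (at s)" "U s > 0" and V: "(V has_real_derivative V') (at s)" "V s > 0"
  shows "((\<lambda>s. bV (U s) (V s)) has_real_derivative bUV (U s) (V s) * U' + bVV (U s) (V s) * V') (at s)"
proof -
  define D where "D = DD (U s) (V s)"
  have "((\<lambda>s. bV (U s) (V s)) has_real_derivative
      (1 - sg) * (- sg * V s powr (- sg - 1) * V')
      + del * (sg * (U' * D powr (sg - 1) + (sg - 1) * D powr (sg - 1 - 1) * (V' + m * U s powr (m - 1) * U') * U s))) (at s)"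
    unfolding bV_def D_def
    by (intro DERIV_add DERIV_cmult DERIV_mult DERIV_powr_const DERIV_DD_powr U V)
  also have "sg - 1 - 1 = sg - 2" by simp
  also have "(1 - sg) * (- sg * V s powr (- sg - 1) * V')
      + del * (sg * (U' * D powr (sg - 1) + (sg - 1) * D powr (sg - 2) * (V' + m * U s powr (m - 1) * U') * U s))
     = del * (sg * D powr (sg - 1) - sg * (1 - sg) * m * ((U s * U s powr (m - 1)) * D powr (sg - 2))) * U'
      + (- (sg * (1 - sg) * V s powr (- sg - 1)) - del * (sg * (1 - sg) * (U s * D powr (sg - 2)))) * V'"
    by (simp add: algebra_simps)
  also have "\<dots> = bUV (U s) (V s) * U' + bVV (U s) (V s) * V'"
    unfolding bUV_def bVV_def powr_mult_self[OF U(2)] D_def by simp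
  finally show ?thesis .
qed

section \<open>Lower bound for the Hessian\<close>

lemma U_eq_powr:
  assumes "U > 0" shows "U = (U powr m) powr (1 - 2 * sg)"
proof -
  have "m * (1 - 2 * sg) = 1" unfolding sg(3)[symmetric] using m by simp
  then show ?thesis using assms by (simp add: powr_powr)
qed

text \<open>Every monomial estimate below is homogeneous in \<open>W = U powr m\<close> and \<open>V\<close>, and follows by
  bounding both of them by \<open>D = V + W\<close>.\<close>

lemma UV_D_le:
  assumes "U > 0" "V > 0"
  shows "U * V * DD U V powr (sg - 2) \<le> V powr (- sg)"
proof -
  define W where "W = U powr m"
  define D where "D = V + W"
  have W: "W > 0" "W \<le> D" "V \<le> D" "D > 0" using assms by (auto simp: W_def D_def add_pos_pos)
  have V: "V = V powr (1 + sg) * V powr (- sg)" using assms by (simp add: powr_add[symmetric])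
  have "U * V * D powr (sg - 2) = W powr (1 - 2 * sg) * (V powr (1 + sg) * V powr (- sg)) * D powr (sg - 2)"
    using U_eq_powr[OF assms(1)] V by (simp add: W_def)
  also have "\<dots> \<le> D powr (1 - 2 * sg) * (D powr (1 + sg) * V powr (- sg)) * D powr (sg - 2)"
    using W assms sg by (intro order_refl mult_mono powr_mono2 mult_nonneg_nonneg) auto
  also have "\<dots> = (D powr (1 - 2 * sg) * D powr (1 + sg) * D powr (sg - 2)) * V powr (- sg)" by simp
  also have "D powr (1 - 2 * sg) * D powr (1 + sg) * D powr (sg - 2) = 1"
    using W by (simp add: powr_add[symmetric])
  finally show ?thesis by (simp add: D_def W_def)
qed

lemma W2UV_D_le:
  assumes "U > 0" "V > 0"
  shows "(U powr m)\<^sup>2 * (U * V) * (DD U V powr (sg - 2))\<^sup>2 \<le> U powr ((m - 1) / 2) * V powr (- sg)"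
proof -
  define W where "W = U powr m"
  define D where "D = V + W"
  have W: "W > 0" "W \<le> D" "V \<le> D" "D > 0" using assms by (auto simp: W_def D_def add_pos_pos)
  have X: "U powr ((m - 1) / 2) = W powr sg" unfolding W_def powr_powr sg(4) ..
  have V: "V = V powr (1 + sg) * V powr (- sg)" using assms by (simp add: powr_add[symmetric])
  have "W\<^sup>2 * W powr (1 - 2 * sg) = W powr (3 - 3 * sg) * W powr sg"
  proof -
    have w2: "W\<^sup>2 = W powr 2" using W by simp
    show ?thesis unfolding w2 powr_add[symmetric] by simp
  qed
  moreover have "(D powr (sg - 2))\<^sup>2 = D powr (2 * sg - 4)"
    by (simp add: power2_eq_square powr_add[symmetric])
  moreover have "W\<^sup>2 * (U * V) * (D powr (sg - 2))\<^sup>2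
     = (W\<^sup>2 * W powr (1 - 2 * sg)) * (V powr (1 + sg) * V powr (- sg)) * (D powr (sg - 2))\<^sup>2"
    using U_eq_powr[OF assms(1)] V by (simp add: W_def)
  ultimately have "W\<^sup>2 * (U * V) * (D powr (sg - 2))\<^sup>2
     = W powr (3 - 3 * sg) * W powr sg * (V powr (1 + sg) * V powr (- sg)) * D powr (2 * sg - 4)" by simp
  also have "\<dots> \<le> D powr (3 - 3 * sg) * W powr sg * (D powr (1 + sg) * V powr (- sg)) * D powr (2 * sg - 4)"
    using W assms sg by (intro order_refl mult_mono powr_mono2 mult_nonneg_nonneg) auto
  also have "\<dots> = (D powr (3 - 3 * sg) * D powr (1 + sg) * D powr (2 * sg - 4)) * (W powr sg * V powr (- sg))" by simp
  also have "D powr (3 - 3 * sg) * D powr (1 + sg) * D powr (2 * sg - 4) = 1"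
    using W by (simp add: powr_add[symmetric])
  finally show ?thesis by (simp add: D_def W_def X)
qed

text \<open>The lower bound is at least \<open>del (\<tau> a\<^sup>2 + b\<^sup>2 / \<tau>)\<close> with \<open>\<tau>\<close> depending on \<open>U\<close> and \<open>V\<close> only, so the
  estimate may be summed over all directions before the arithmetic-geometric mean inequality is used.
  A lower bound by a multiple of \<open>a * b\<close> would not be enough.\<close>

lemma bell_hessian:
  assumes U: "U > 0" and V: "V > 0" and a: "a \<ge> 0" and b: "b \<ge> 0"
    and u: "\<bar>u\<bar> \<le> 2 * sqrt U * a" and v: "\<bar>v\<bar> \<le> 2 * sqrt V * b"
  shows "del * (DD U V powr sg * a\<^sup>2 + 7 * (V powr (- sg) * b\<^sup>2))
    \<le> 2 * bU U V * a\<^sup>2 + 2 * bV U V * b\<^sup>2 + bUU U V * u\<^sup>2 + 2 * bUV U V * u * v + bVV U V * v\<^sup>2"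
proof -
  define W where "W = U powr m"
  define D where "D = DD U V"
  define X where "X = U powr ((m - 1) / 2)"
  define Y where "Y = V powr (- sg)"
  define E where "E = D powr sg"
  define E1 where "E1 = D powr (sg - 1)"
  define E2 where "E2 = D powr (sg - 2)"
  have W: "W > 0" "W \<le> D" "V \<le> D" "D > 0" using U V by (auto simp: W_def D_def add_pos_pos)
  have pos: "X > 0" "Y > 0" "E > 0" "E1 > 0" "E2 > 0" using U V W by (auto simp: X_def Y_def E_def E1_def E2_def)
  have E1: "E1 = D * E2" and E: "E = D * E1"
    using W by (auto simp: E_def E1_def E2_def powr_diff power2_eq_square)
  have I1: "U * V * E2 \<le> Y" using UV_D_le[OF U V] by (simp add: D_def E2_def Y_def)
  have I2: "W\<^sup>2 * (U * V) * E2\<^sup>2 \<le> X * Y" using W2UV_D_le[OF U V] by (simp add: D_def E2_def Y_def X_def W_def)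
  have u2: "u\<^sup>2 \<le> 4 * U * a\<^sup>2"
    using power_mono[OF u abs_ge_zero, of 2] U by (simp add: power_mult_distrib)
  have v2: "v\<^sup>2 \<le> 4 * V * b\<^sup>2"
    using power_mono[OF v abs_ge_zero, of 2] V by (simp add: power_mult_distrib)
  have uv: "\<bar>u * v\<bar> \<le> 4 * (sqrt U * sqrt V) * a * b"
  proof -
    have "\<bar>u\<bar> * \<bar>v\<bar> \<le> (2 * sqrt U * a) * (2 * sqrt V * b)"
      using u v a b U V by (intro mult_mono) auto
    then show ?thesis by (simp add: abs_mult mult_ac)
  qed
  \<comment> \<open>One of the two copies of \<open>del * E * a\<^sup>2\<close> is consumed by
    \<open>hUV\<close>, the other one is the result. The term with \<open>X\<close> is kept to
    absorb the rest of the mixed derivative.\<close>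
  have hU: "2 * bU U V * a\<^sup>2 \<ge> (m + 1) * X * a\<^sup>2 + 2 * del * E * a\<^sup>2"
  proof -
    have "del * (sg * m * (W * E1)) * a\<^sup>2 \<ge> 0"
      using del_pos sg m W pos by (intro mult_nonneg_nonneg) auto
    then show ?thesis unfolding bU_def unfolding D_def[symmetric] unfolding W_def[symmetric] X_def[symmetric] E_def[symmetric] E1_def[symmetric]
      by (simp add: field_simps)
  qed
  have hV: "2 * bV U V * b\<^sup>2 \<ge> 2 * (1 - sg) * Y * b\<^sup>2"
  proof -
    have "del * (sg * (U * E1)) * b\<^sup>2 \<ge> 0"
      using del_pos sg m U pos by (intro mult_nonneg_nonneg) auto
    then show ?thesis unfolding bV_def unfolding D_def[symmetric] unfolding Y_def[symmetric] E1_def[symmetric]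
      by (simp add: algebra_simps)
  qed
  \<comment> \<open>The negative part of \<open>bUU\<close> carries
    \<open>m\<^sup>2 * W * E2\<close>, the positive part \<open>m * (m + 1) * D * E2\<close>, and
    \<open>W \<le> D\<close>.\<close>
  have hUU: "bUU U V * u\<^sup>2 \<ge> 0"
  proof (intro mult_nonneg_nonneg)
    have "sg * (1 - sg) * m\<^sup>2 * (W * U powr (m - 1) * E2) \<le> sg * m * (m + 1) * (U powr (m - 1) * E1)"
    proof -
      have "(1 - sg) * (m * (m * (W * E2))) \<le> 1 * (m * ((m + 1) * (D * E2)))"
        using sg m W pos by (intro mult_mono) auto
      then have "(sg * U powr (m - 1)) * ((1 - sg) * (m * (m * (W * E2)))) \<le> (sg * U powr (m - 1)) * (1 * (m * ((m + 1) * (D * E2))))"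
        using sg by (intro mult_left_mono) auto
      then show ?thesis unfolding E1 by (simp add: power2_eq_square mult_ac)
    qed
    then show "0 \<le> bUU U V"
      unfolding bUU_def unfolding D_def[symmetric] unfolding W_def[symmetric] E1_def[symmetric] E2_def[symmetric]
      using del_pos m by (intro add_nonneg_nonneg mult_nonneg_nonneg) auto
  qed simp
  \<comment> \<open>The function is concave in \<open>V\<close>. The loss
    \<open>4 * sg * (1 - sg)\<close> is paid by the \<open>2 * (1 - sg)\<close> of
    \<open>hV\<close>; what remains is \<open>2 * (1 - sg) * (1 - 2 * sg)\<close>, at least
    \<open>1 / m\<close>. The part multiplied by \<open>del\<close> costs the first of the 7
    units.\<close>
  have hVV: "bVV U V * v\<^sup>2 \<ge> - (4 * sg * (1 - sg) * Y * b\<^sup>2) - del * (Y * b\<^sup>2)"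
  proof -
    have 1: "(sg * (1 - sg) * V powr (- sg - 1)) * v\<^sup>2 \<le> (sg * (1 - sg) * V powr (- sg - 1)) * (4 * V * b\<^sup>2)"
      using sg by (intro mult_left_mono v2) auto
    have "V * V powr (- sg - 1) = Y" unfolding Y_def by (rule powr_mult_self[OF V])
    then have 2: "(sg * (1 - sg) * V powr (- sg - 1)) * (4 * V * b\<^sup>2) = 4 * sg * (1 - sg) * Y * b\<^sup>2"
      by (metis (no_types, opaque_lifting) mult.assoc mult.left_commute)
    have "(sg * (1 - sg) * (U * E2)) * v\<^sup>2 \<le> (sg * (1 - sg) * (U * E2)) * (4 * V * b\<^sup>2)"
      using sg U pos by (intro mult_left_mono v2) auto
    also have "\<dots> = (4 * (sg * (1 - sg))) * ((U * V * E2) * b\<^sup>2)" by simp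
    also have "\<dots> \<le> 1 * (Y * b\<^sup>2)"
    proof (intro mult_mono mult_right_mono I1)
      have "(1 - 2 * sg)\<^sup>2 \<ge> 0" by simp
      then show "4 * (sg * (1 - sg)) \<le> 1" by (simp add: power2_eq_square algebra_simps)
    qed (use U V pos in auto)
    finally have "del * ((sg * (1 - sg) * (U * E2)) * v\<^sup>2) \<le> del * (Y * b\<^sup>2)"
      using del_pos by (intro mult_left_mono) auto
    then show ?thesis
      using 1 2 unfolding bVV_def unfolding D_def[symmetric] unfolding E2_def[symmetric] by (simp add: algebra_simps)
  qed
  \<comment> \<open>The two summands of \<open>bUV\<close> are treated separately. \<open>g1\<close>
    splits \<open>E1\<close> into \<open>sqrt E * sqrt E2\<close>, so that \<open>I1\<close> applies
    to the part with \<open>b\<close>. \<open>g2\<close> rests on \<open>I2\<close> and attaches the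
    factor \<open>m\<close> to \<open>X * a\<^sup>2\<close>, where
    \<open>2 * del * m\<^sup>2\<close> is small against the \<open>m + 1\<close> of
    \<open>hU\<close>.\<close>
  have hUV: "2 * bUV U V * u * v \<ge> - del * (E * a\<^sup>2 + 4 * (Y * b\<^sup>2)) - del * (2 * (m\<^sup>2 * X * a\<^sup>2 + Y * b\<^sup>2))"
  proof -
    define Z where "Z = sqrt U * sqrt V * a * b"
    have Z: "Z \<ge> 0" unfolding Z_def using a b U V by simp
    have Z2: "Z\<^sup>2 = U * V * a\<^sup>2 * b\<^sup>2" using U V by (simp add: Z_def power_mult_distrib)
    have g1: "8 * sg * E1 * Z \<le> E * a\<^sup>2 + 4 * (Y * b\<^sup>2)"
    proof -
      define y where "y = 4 * sg * sqrt E2 * sqrt (U * V) * b"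
      define x where "x = sqrt E * a"
      have "sqrt E * sqrt E2 = E1"
      proof -
        have "E * E2 = E1\<^sup>2" unfolding E E1 by (simp add: power2_eq_square)
        then show ?thesis using pos by (simp add: real_sqrt_mult[symmetric])
      qed
      moreover have "2 * x * y = 8 * sg * (sqrt E * sqrt E2) * Z"
        unfolding x_def y_def Z_def real_sqrt_mult by simp
      ultimately have "2 * x * y = 8 * sg * E1 * Z" by simp
      moreover have "2 * x * y \<le> x\<^sup>2 + y\<^sup>2" by (rule sum_squares_bound)
      moreover have "x\<^sup>2 = E * a\<^sup>2" unfolding x_def using pos by (simp add: power_mult_distrib)
      moreover have "y\<^sup>2 \<le> 4 * (Y * b\<^sup>2)"
      proof -
        have "y\<^sup>2 = (16 * sg\<^sup>2) * ((U * V * E2) * b\<^sup>2)"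
          unfolding y_def using pos U V by (simp add: power_mult_distrib)
        also have "\<dots> \<le> 4 * (Y * b\<^sup>2)"
        proof (intro mult_mono mult_right_mono I1)
          have "sg\<^sup>2 \<le> (1/2)\<^sup>2" using sg by (intro power_mono) auto
          then show "16 * sg\<^sup>2 \<le> 4" by (simp add: power2_eq_square)
        qed (use U V pos in auto)
        finally show ?thesis .
      qed
      ultimately show ?thesis by linarith
    qed
    have g2: "8 * (sg * (1 - sg) * m) * (W * E2) * Z \<le> 2 * (m\<^sup>2 * X * a\<^sup>2 + Y * b\<^sup>2)"
    proof -
      have "(W * E2 * Z)\<^sup>2 \<le> (sqrt (X * Y) * (a * b))\<^sup>2"
      proof -
        have "(W * E2 * Z)\<^sup>2 = (W\<^sup>2 * (U * V) * E2\<^sup>2) * (a\<^sup>2 * b\<^sup>2)"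
          by (simp add: power_mult_distrib Z2)
        also have "\<dots> \<le> (X * Y) * (a\<^sup>2 * b\<^sup>2)" by (intro mult_right_mono I2) auto
        finally show ?thesis using pos by (simp add: power_mult_distrib)
      qed
      then have w: "W * E2 * Z \<le> sqrt (X * Y) * (a * b)"
        by (rule power2_le_imp_le) (use a b pos in auto)
      have "8 * (sg * (1 - sg) * m) * (W * E2 * Z) \<le> (4 * m) * (sqrt (X * Y) * (a * b))"
      proof (rule mult_mono[OF _ w])
        have "sg * (1 - sg) \<le> (1 / 2) * 1" using sg by (intro mult_mono) auto
        then show "8 * (sg * (1 - sg) * m) \<le> 4 * m" using m mult_right_mono[of "sg * (1 - sg)" "1/2" m] by simp
      qed (use a b pos m W Z in auto)
      also have "\<dots> = 2 * (2 * (m * sqrt X * a) * (sqrt Y * b))"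
        by (simp add: real_sqrt_mult)
      also have "\<dots> \<le> 2 * ((m * sqrt X * a)\<^sup>2 + (sqrt Y * b)\<^sup>2)"
        by (intro mult_left_mono sum_squares_bound) auto
      also have "\<dots> = 2 * (m\<^sup>2 * X * a\<^sup>2 + Y * b\<^sup>2)"
        using pos by (simp add: power_mult_distrib)
      finally show ?thesis by simp
    qed
    have "\<bar>bUV U V\<bar> \<le> del * (sg * E1 + sg * (1 - sg) * m * (W * E2))"
      unfolding bUV_def unfolding D_def[symmetric] unfolding W_def[symmetric] E1_def[symmetric] E2_def[symmetric]
      using sg m pos W del_pos by (simp add: abs_mult) (intro order_trans[OF abs_triangle_ineq4] add_mono, auto simp: abs_mult)
    moreover have "\<bar>u * v\<bar> \<le> 4 * Z" using uv by (simp add: Z_def mult.assoc)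
    ultimately have "\<bar>bUV U V\<bar> * \<bar>u * v\<bar> \<le> del * (sg * E1 + sg * (1 - sg) * m * (W * E2)) * (4 * Z)"
      by (intro mult_mono) (auto intro: order_trans[OF abs_ge_zero])
    then have "2 * \<bar>bUV U V * u * v\<bar> \<le> del * (8 * sg * E1 * Z) + del * (8 * (sg * (1 - sg) * m) * (W * E2) * Z)"
      by (simp add: abs_mult algebra_simps)
    moreover have "del * (8 * sg * E1 * Z) \<le> del * (E * a\<^sup>2 + 4 * (Y * b\<^sup>2))"
      using g1 del_pos by (intro mult_left_mono) auto
    moreover have "del * (8 * (sg * (1 - sg) * m) * (W * E2) * Z) \<le> del * (2 * (m\<^sup>2 * X * a\<^sup>2 + Y * b\<^sup>2))"
      using g2 del_pos by (intro mult_left_mono) auto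
    moreover have "2 * bUV U V * u * v \<ge> - (2 * \<bar>bUV U V * u * v\<bar>)" using abs_ge_minus_self[of "bUV U V * u * v"] by linarith
    ultimately show ?thesis by (simp only: mult_minus_left)
  qed
  define S where "S = 2 * bU U V * a\<^sup>2 + 2 * bV U V * b\<^sup>2 + bUU U V * u\<^sup>2 + 2 * bUV U V * u * v + bVV U V * v\<^sup>2"
  have Yco: "2 * (1 - sg) * Y * b\<^sup>2 - 4 * sg * (1 - sg) * Y * b\<^sup>2 \<ge> 1 / m * (Y * b\<^sup>2)"
  proof -
    have "1 * (1 / m) \<le> (2 * (1 - sg)) * (1 - 2 * sg)"
      unfolding sg(3) using sg by (intro mult_right_mono) auto
    then have "1 / m * (Y * b\<^sup>2) \<le> ((2 * (1 - sg)) * (1 - 2 * sg)) * (Y * b\<^sup>2)"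
      using pos by (intro mult_right_mono) auto
    then show ?thesis by (simp add: algebra_simps)
  qed
  have Xco: "(m + 1) * (X * a\<^sup>2) - 2 * del * m\<^sup>2 * (X * a\<^sup>2) \<ge> 0"
  proof -
    have "2 * del * m\<^sup>2 \<le> m + 1" using m by (simp add: del_def power2_eq_square)
    then have "2 * del * m\<^sup>2 * (X * a\<^sup>2) \<le> (m + 1) * (X * a\<^sup>2)"
      using pos by (intro mult_right_mono) auto
    then show ?thesis by simp
  qed
  have "S \<ge> del * (E * a\<^sup>2) + (1 / m - 7 * del) * (Y * b\<^sup>2)"
    using hU hV hUU hVV hUV Yco Xco unfolding S_def by (simp add: algebra_simps)
  also have "1 / m - 7 * del = 7 * del" using m by (simp add: del_def field_simps)
  finally have S: "S \<ge> del * (E * a\<^sup>2 + 7 * (Y * b\<^sup>2))" by (simp add: algebra_simps)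
  then show ?thesis unfolding S_def E_def Y_def D_def .
qed

text \<open>The coefficients of \<open>a\<^sup>2\<close> and \<open>b\<^sup>2\<close> inside the
  bracket have product at least 7, because \<open>DD U V \<ge> V\<close>. The arithmetic-geometric
  mean inequality gives \<open>2 * sqrt 7 \<ge> 5\<close> times \<open>a * b\<close>, and
  \<open>5 * del\<close> is at least \<open>1 / (3 * m)\<close>.\<close>

lemma hessian_bound_ge_mult:
  assumes U: "U > 0" and V: "V > 0" and a: "a \<ge> 0" and b: "b \<ge> 0"
  shows "a * b / (3 * m) \<le> del * (DD U V powr sg * a\<^sup>2 + 7 * (V powr (- sg) * b\<^sup>2))"
proof -
  define Y where "Y = V powr (- sg)"
  define E where "E = DD U V powr sg"
  have pos: "Y > 0" "E > 0" using V DD_pos[OF V, of U] by (auto simp: Y_def E_def)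
  have EY: "E * Y \<ge> 1"
  proof -
    have "V powr sg \<le> E" unfolding E_def using V sg by (intro powr_mono2) auto
    then have "V powr sg * Y \<le> E * Y" using pos by (intro mult_right_mono) auto
    then show ?thesis unfolding Y_def using V by (simp add: powr_add[symmetric])
  qed
  have "2 * (sqrt E * a) * (sqrt (7 * Y) * b) \<le> (sqrt E * a)\<^sup>2 + (sqrt (7 * Y) * b)\<^sup>2"
    by (rule sum_squares_bound)
  also have "\<dots> = E * a\<^sup>2 + 7 * (Y * b\<^sup>2)" using pos by (simp add: power_mult_distrib)
  finally have 1: "2 * sqrt (7 * (E * Y)) * (a * b) \<le> E * a\<^sup>2 + 7 * (Y * b\<^sup>2)"
    by (simp add: real_sqrt_mult mult_ac)
  have "5 / 2 \<le> sqrt (7 * (E * Y))"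
    using EY by (intro real_le_rsqrt) (simp add: power2_eq_square)
  then have "5 * (a * b) \<le> 2 * sqrt (7 * (E * Y)) * (a * b)"
    using a b by (intro mult_right_mono) auto
  with 1 have "del * (5 * (a * b)) \<le> del * (E * a\<^sup>2 + 7 * (Y * b\<^sup>2))"
    using del_pos by (intro mult_left_mono) auto
  moreover have "a * b / (3 * m) \<le> del * (5 * (a * b))"
    using m a b by (simp add: del_def field_simps)
  ultimately show ?thesis unfolding E_def Y_def by linarith
qed

text \<open>The mixed term has the homogeneity of the other two: as
  \<open>U = W powr (1 - 2 * sg)\<close>, it is at most \<open>D powr (1 - sg)\<close>, which
  subadditivity of the concave power splits into exactly the other two terms.\<close>

lemma bell_upper:
  assumes U: "U > 0" and V: "V > 0"
  shows "bell U V \<le> 2 * (U powr ((m + 1) / 2) + V powr (1 - sg))"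
proof -
  define W where "W = U powr m"
  define D where "D = V + W"
  have W: "W > 0" "W \<le> D" "V \<le> D" "D > 0" using assms by (auto simp: W_def D_def add_pos_pos)
  have "U * D powr sg = W powr (1 - 2 * sg) * D powr sg"
    using U_eq_powr[OF assms(1)] by (simp add: W_def)
  also have "\<dots> \<le> D powr (1 - 2 * sg) * D powr sg"
    using W sg by (intro mult_right_mono powr_mono2) auto
  also have "\<dots> = D powr (1 - sg)" by (simp add: powr_add[symmetric])
  also have "\<dots> \<le> V powr (1 - sg) + W powr (1 - sg)"
    unfolding D_def using W V sg by (intro powr_add_le_add_powr) auto
  also have "W powr (1 - sg) = U powr ((m + 1) / 2)"
  proof -
    have e: "m * (1 - sg) = (m + 1) / 2" using sg(4) by (simp add: field_simps)
    show ?thesis unfolding W_def powr_powr e ..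
  qed
  finally have "del * (U * D powr sg) \<le> 1 * (V powr (1 - sg) + U powr ((m + 1) / 2))"
    using del_pos m U W by (intro mult_mono) (auto simp: del_def)
  moreover have "x + y + z \<le> 2 * (x + y)" if "z \<le> 1 * (y + x)" for x y z :: real using that by simp
  ultimately show ?thesis unfolding bell_def D_def W_def by blast
qed

section \<open>Growth and regularity of the Bellman function\<close>

lemma powr_diff_le:
  fixes e A R r :: real
  assumes "0 < e" "0 \<le> A" "A \<le> R" "e \<le> 1" "r \<ge> 1"
  shows "(A + e) powr r - e powr r \<le> r * (R + 1) powr (r - 1) * A"
proof (cases "A = 0")
  case False
  have "((\<lambda>x. x powr r) has_real_derivative r * x powr (r - 1)) (at x)" if "e \<le> x" for x :: real
    using DERIV_powr_const[OF DERIV_ident, of x r] that assms by simp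
  then obtain z where z: "e < z" "z < A + e" "(A + e) powr r - e powr r = A * (r * z powr (r - 1))"
    using MVT2[of e "A + e" "\<lambda>x. x powr r" "\<lambda>x. r * x powr (r - 1)"] False assms by auto
  have "z powr (r - 1) \<le> (R + 1) powr (r - 1)" using z assms by (intro powr_mono2) auto
  then have "A * (r * z powr (r - 1)) \<le> A * (r * (R + 1) powr (r - 1))"
    using assms by (intro mult_left_mono) auto
  then show ?thesis using z by (simp add: mult_ac)
qed simp

text \<open>The bound vanishes with \<open>A\<close> and \<open>B\<close> and is uniform in
  \<open>e\<close>, so for Hermite sums it is an integrable majorant under which \<open>e\<close>
  can tend to 0. The power of \<open>B\<close> stays because the derivative of
  \<open>V powr (1 - sg)\<close> can be unbounded near 0.\<close>

lemma bell_increment: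
  assumes "R \<ge> 0"
  shows "\<exists>K\<ge>0. \<forall>e A B. 0 < e \<longrightarrow> e \<le> 1 \<longrightarrow> 0 \<le> A \<longrightarrow> A \<le> R \<longrightarrow> 0 \<le> B \<longrightarrow> B \<le> R \<longrightarrow>
    bell (A + e) (B + e) - bell e e \<le> K * (A + B + B powr (1 - sg))"
proof -
  define K1 where "K1 = (m + 1) / 2 * (R + 1) powr ((m + 1) / 2 - 1)"
  define K2 where "K2 = (R + 1 + (R + 1) powr m) powr sg"
  define K3 where "K3 = m * (R + 1) powr (m - 1)"
  have K: "K1 \<ge> 0" "K2 \<ge> 0" "K3 \<ge> 0" unfolding K1_def K2_def K3_def using m by auto
  define K where "K = 1 + K1 + K2 + K3"
  have "bell (A + e) (B + e) - bell e e \<le> K * (A + B + B powr (1 - sg))"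
    if e: "0 < e" "e \<le> 1" and A: "0 \<le> A" "A \<le> R" and B: "0 \<le> B" "B \<le> R" for e A B
  proof -
    have 1: "(A + e) powr ((m + 1) / 2) - e powr ((m + 1) / 2) \<le> K1 * A"
      unfolding K1_def using e A m by (intro powr_diff_le) auto
    have 2: "(B + e) powr (1 - sg) - e powr (1 - sg) \<le> B powr (1 - sg)"
      using powr_add_le_add_powr[of B e "1 - sg"] e B sg by simp
    have 3: "(A + e) powr m - e powr m \<le> K3 * A"
      unfolding K3_def using e A m by (intro powr_diff_le) auto
    define D where "D = B + e + (A + e) powr m"
    define De where "De = e + e powr m"
    have "e powr m \<le> (A + e) powr m" using e A m by (intro powr_mono2) auto
    then have De: "De > 0" "De \<ge> e" "De \<le> D"
      unfolding D_def De_def using e B by (auto intro!: add_pos_pos)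
    have DK: "D powr sg \<le> K2" unfolding K2_def D_def
      using e A B m sg by (intro powr_mono2 add_mono) auto
    \<comment> \<open>The power \<open>sg < 1\<close> may fail to be Lipschitz at 0, but the
      prefactor compensates: all points of the interval exceed \<open>e\<close>, so \<open>e\<close>
      times the power \<open>sg - 1\<close> is at most \<open>e powr sg\<close>, hence at most
      1.\<close>
    have DD: "e * (D powr sg - De powr sg) \<le> D - De"
    proof (cases "De = D")
      case False
      have "((\<lambda>x. x powr sg) has_real_derivative sg * x powr (sg - 1)) (at x)" if "De \<le> x" for x :: real
        using DERIV_powr_const[OF DERIV_ident, of x sg] that De by simp
      then obtain z where z: "De < z" "z < D" "D powr sg - De powr sg = (D - De) * (sg * z powr (sg - 1))"
        using MVT2[of De D "\<lambda>x. x powr sg" "\<lambda>x. sg * x powr (sg - 1)"] False De by auto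
      have "e * z powr (sg - 1) \<le> e * e powr (sg - 1)"
        using z De e sg by (intro mult_left_mono powr_mono2') auto
      also have "\<dots> = e powr sg" by (rule powr_mult_self) fact
      also have "\<dots> \<le> 1" using e sg powr_mono2[of sg e 1] by simp
      finally have "sg * (e * z powr (sg - 1)) \<le> 1 * 1" using sg e by (intro mult_mono) auto
      then have "(D - De) * (sg * (e * z powr (sg - 1))) \<le> (D - De) * 1"
        using De by (intro mult_left_mono) auto
      then show ?thesis unfolding z(3) by (simp add: mult_ac)
    qed simp
    have "(A + e) * D powr sg - e * De powr sg = A * D powr sg + e * (D powr sg - De powr sg)"
      by (simp add: algebra_simps)
    also have "\<dots> \<le> A * K2 + (D - De)" by (intro add_mono DD mult_left_mono DK A)
    also have "D - De \<le> B + K3 * A" unfolding D_def De_def using 3 by simp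
    finally have "del * ((A + e) * D powr sg - e * De powr sg) \<le> del * (A * K2 + (B + K3 * A))"
      using del_pos by (intro mult_left_mono) auto
    also have "\<dots> \<le> 1 * (A * K2 + (B + K3 * A))"
      using m A B K by (intro mult_right_mono) (auto simp: del_def)
    finally have "bell (A + e) (B + e) - bell e e \<le> K1 * A + B powr (1 - sg) + (A * K2 + (B + K3 * A))"
      using 1 2 unfolding bell_def D_def De_def by (simp add: algebra_simps)
    also have "\<dots> \<le> K * (A + B + B powr (1 - sg))"
    proof -
      have "0 \<le> (K1 + K2 + K3) * (B + B powr (1 - sg)) + A"
        using K A B by (intro add_nonneg_nonneg mult_nonneg_nonneg) auto
      then show ?thesis unfolding K_def by (simp add: algebra_simps)
    qed
    finally show ?thesis .
  qed
  then show ?thesis using K by (intro exI[of _ K]) (auto simp: K_def)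
qed

lemma bell_mono:
  assumes "0 < U" "U \<le> U'" "0 < V" "V \<le> V'"
  shows "bell U V \<le> bell U' V'"
  unfolding bell_def using assms m sg del_pos
  by (intro add_mono mult_left_mono mult_mono powr_mono2) auto

lemma continuous_on_bell [continuous_intros]:
  fixes f g :: "'a::topological_space \<Rightarrow> real"
  assumes "continuous_on S f" "continuous_on S g" "\<And>x. x \<in> S \<Longrightarrow> f x > 0" "\<And>x. x \<in> S \<Longrightarrow> g x > 0"
  shows "continuous_on S (\<lambda>x. bell (f x) (g x))" "continuous_on S (\<lambda>x. bU (f x) (g x))"
    "continuous_on S (\<lambda>x. bV (f x) (g x))" "continuous_on S (\<lambda>x. bUU (f x) (g x))"
    "continuous_on S (\<lambda>x. bUV (f x) (g x))" "continuous_on S (\<lambda>x. bVV (f x) (g x))"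
proof -
  have D: "DD (f x) (g x) \<noteq> 0" if "x \<in> S" for x
    using DD_pos[of "g x" "f x"] assms(4)[OF that] by simp
  have f0: "\<And>x. x \<in> S \<Longrightarrow> f x \<noteq> 0" and g0: "\<And>x. x \<in> S \<Longrightarrow> g x \<noteq> 0" using assms(3,4) by fastforce+
  show "continuous_on S (\<lambda>x. bell (f x) (g x))" "continuous_on S (\<lambda>x. bU (f x) (g x))"
    "continuous_on S (\<lambda>x. bV (f x) (g x))" "continuous_on S (\<lambda>x. bUU (f x) (g x))"
    "continuous_on S (\<lambda>x. bUV (f x) (g x))" "continuous_on S (\<lambda>x. bVV (f x) (g x))"
    unfolding bell_defs using D f0 g0 by (intro continuous_intros assms(1,2); blast)+
qed

lemma measurable_bell [measurable (raw)]:
  assumes [measurable]: "f \<in> borel_measurable M" "g \<in> borel_measurable M"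
  shows "(\<lambda>x. bell (f x) (g x)) \<in> borel_measurable M" "(\<lambda>x. bU (f x) (g x)) \<in> borel_measurable M"
    "(\<lambda>x. bV (f x) (g x)) \<in> borel_measurable M" "(\<lambda>x. bUU (f x) (g x)) \<in> borel_measurable M"
    "(\<lambda>x. bUV (f x) (g x)) \<in> borel_measurable M" "(\<lambda>x. bVV (f x) (g x)) \<in> borel_measurable M"
  unfolding bell_defs by measurable

text \<open>The constant may blow up as \<open>e\<close> tends to 0. This does no harm, since it
  enters only the integrability needed for the integrations by parts, not the final
  inequality.\<close>

lemma bell_derivs_bounded:
  assumes "0 < e"
  shows "\<exists>K\<ge>0. \<forall>U\<in>{e..R}. \<forall>V\<in>{e..R}. \<bar>bU U V\<bar> \<le> K \<and> \<bar>bV U V\<bar> \<le> K \<and> \<bar>bUU U V\<bar> \<le> K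
     \<and> \<bar>bUV U V\<bar> \<le> K \<and> \<bar>bVV U V\<bar> \<le> K"
proof -
  have *: "\<exists>K\<ge>0. \<forall>U\<in>{e..R}. \<forall>V\<in>{e..R}. \<bar>F U V\<bar> \<le> K"
    if "continuous_on ({e..R} \<times> {e..R}) (\<lambda>z. F (fst z) (snd z))" for F :: "real \<Rightarrow> real \<Rightarrow> real"
  proof -
    have "bounded ((\<lambda>z. F (fst z) (snd z)) ` ({e..R} \<times> {e..R}))"
      by (intro compact_imp_bounded compact_continuous_image that compact_Times) auto
    then obtain K where "\<forall>z\<in>{e..R} \<times> {e..R}. \<bar>F (fst z) (snd z)\<bar> \<le> K"
      unfolding bounded_iff by auto
    then show ?thesis by (intro exI[of _ "max K 0"]) (auto simp: le_max_iff_disj)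
  qed
  have c: "continuous_on ({e..R} \<times> {e..R}) fst" "continuous_on ({e..R} \<times> {e..R}) snd" by (intro continuous_intros)+
  have p: "fst z > 0" "snd z > 0" if "z \<in> {e..R} \<times> {e..R}" for z :: "real \<times> real" using that assms by auto
  obtain K1 where K1: "K1 \<ge> 0" "\<And>U V. U \<in> {e..R} \<Longrightarrow> V \<in> {e..R} \<Longrightarrow> \<bar>bU U V\<bar> \<le> K1"
    using *[OF continuous_on_bell(2)[OF c p]] by blast
  obtain K2 where K2: "K2 \<ge> 0" "\<And>U V. U \<in> {e..R} \<Longrightarrow> V \<in> {e..R} \<Longrightarrow> \<bar>bV U V\<bar> \<le> K2"
    using *[OF continuous_on_bell(3)[OF c p]] by blast
  obtain K3 where K3: "K3 \<ge> 0" "\<And>U V. U \<in> {e..R} \<Longrightarrow> V \<in> {e..R} \<Longrightarrow> \<bar>bUU U V\<bar> \<le> K3"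
    using *[OF continuous_on_bell(4)[OF c p]] by blast
  obtain K4 where K4: "K4 \<ge> 0" "\<And>U V. U \<in> {e..R} \<Longrightarrow> V \<in> {e..R} \<Longrightarrow> \<bar>bUV U V\<bar> \<le> K4"
    using *[OF continuous_on_bell(5)[OF c p]] by blast
  obtain K5 where K5: "K5 \<ge> 0" "\<And>U V. U \<in> {e..R} \<Longrightarrow> V \<in> {e..R} \<Longrightarrow> \<bar>bVV U V\<bar> \<le> K5"
    using *[OF continuous_on_bell(6)[OF c p]] by blast
  show ?thesis
    using K1(1) K2(1) K3(1) K4(1) K5(1)
    by (intro exI[of _ "K1 + K2 + K3 + K4 + K5"] conjI ballI)
       (auto intro!: order_trans[OF K1(2)] order_trans[OF K2(2)] order_trans[OF K3(2)]
         order_trans[OF K4(2)] order_trans[OF K5(2)])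
qed

end

section \<open>Integration over the half space\<close>

lemma sigma_finite_lebesgue_Rn: "sigma_finite_measure (lebesgue_Rn n)"
  unfolding lebesgue_Rn_def by (rule lborel_product.sigma_finite) simp

lemma gauss_fun_upd_le: "j < n \<Longrightarrow> gauss n (x(j := s)) \<le> exp (- s\<^sup>2 / 4)"
proof -
  assume j: "j < n"
  have "(\<Prod>i\<in>{..<n} - {j}. exp (- (x i)\<^sup>2 / 4)) \<le> 1" by (intro prod_le_1) auto
  then show ?thesis unfolding gauss_split[OF j]
    using mult_left_le[of "\<Prod>i\<in>{..<n} - {j}. exp (- (x i)\<^sup>2 / 4)" "exp (- s\<^sup>2 / 4)"] by simp
qed

lemma integral_partial_eq_0:
  fixes G g :: "(nat \<Rightarrow> real) \<Rightarrow> real"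
  assumes j: "j < n"
    and der: "\<And>x s. ((\<lambda>s. G (x(j := s))) has_real_derivative g (x(j := s))) (at s)"
    and cont: "\<And>x. continuous_on UNIV (\<lambda>s. g (x(j := s)))"
    and G: "\<And>x. \<bar>G x\<bar> \<le> K * gauss n x" and g: "\<And>x. \<bar>g x\<bar> \<le> L * gauss n x"
    and KL: "K \<ge> 0" "L \<ge> 0"
    and meas: "g \<in> borel_measurable (lebesgue_Rn n)"
  shows "(\<integral>x. g x \<partial>lebesgue_Rn n) = 0"
proof -
  have ins: "insert j ({..<n} - {j}) = {..<n}" using j by auto
  have int: "integrable (PiM (insert j ({..<n} - {j})) (\<lambda>_. lborel)) g"
    unfolding ins lebesgue_Rn_def[symmetric] using g by (intro integrable_gauss_bound[OF meas]) auto
  have "(\<integral>x. g x \<partial>lebesgue_Rn n) = (\<integral>x. (\<integral>s. g (x(j := s)) \<partial>lborel) \<partial>PiM ({..<n} - {j}) (\<lambda>_. lborel))"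
    using lborel_product.product_integral_insert[OF _ _ int] unfolding ins lebesgue_Rn_def by simp
  also have "(\<lambda>x. \<integral>s. g (x(j := s)) \<partial>lborel) = (\<lambda>x. 0)"
  proof (rule ext, rule integral_derivative_eq_0[OF der cont])
    fix x s
    show "\<bar>G (x(j := s))\<bar> \<le> K * exp (- s\<^sup>2 / 4)" "\<bar>g (x(j := s))\<bar> \<le> L * exp (- s\<^sup>2 / 4)"
      using G[of "x(j := s)"] g[of "x(j := s)"] KL
        mult_left_mono[OF gauss_fun_upd_le[OF j, of x s] KL(1)] mult_left_mono[OF gauss_fun_upd_le[OF j, of x s] KL(2)]
      by linarith+
  qed
  finally show ?thesis by simp
qed

lemma integrable_t_exp: "integrable lborel (\<lambda>t::real. indicator {0<..} t * (t * exp (- t)))"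
proof -
  have "integrable lborel (\<lambda>x. x ^ 1 * exp (- x) * indicator {0::real ..} x)"
  proof (rule integrableI_nn_integral_finite)
    have "(\<integral>\<^sup>+x. ennreal (x ^ 1 * exp (- x) * indicator {0::real ..} x) \<partial>lborel)
        = (\<integral>\<^sup>+x. ennreal (x ^ 1 * exp (- x)) * indicator {0::real ..} x \<partial>lborel)"
      by (intro nn_integral_cong) (auto simp: indicator_def)
    then show "(\<integral>\<^sup>+x. ennreal (x ^ 1 * exp (- x) * indicator {0::real ..} x) \<partial>lborel) = ennreal 1"
      using nn_intergal_power_times_exp_Ici[of 1] by simp
  qed (auto simp: indicator_def)
  then show ?thesis
    by (rule Bochner_Integration.integrable_bound) (auto simp: indicator_def)
qed

text \<open>An antiderivative is \<open>t * F1 t - F0 t\<close>, equal to \<open>- F0 0\<close> at 0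
  and tending to 0 at infinity. The weight \<open>t\<close> thus removes \<open>F1 0\<close> from
  the boundary term.\<close>

lemma integral_t_second_derivative:
  fixes F0 F1 F2 :: "real \<Rightarrow> real"
  assumes F0: "\<And>t. (F0 has_real_derivative F1 t) (at t)" and F1: "\<And>t. (F1 has_real_derivative F2 t) (at t)"
    and cont: "continuous_on UNIV F2"
    and b0: "\<And>t. t \<ge> 0 \<Longrightarrow> \<bar>F0 t\<bar> \<le> K * exp (- t)" and b1: "\<And>t. t \<ge> 0 \<Longrightarrow> \<bar>F1 t\<bar> \<le> K * exp (- t)"
    and b2: "\<And>t. t \<ge> 0 \<Longrightarrow> \<bar>F2 t\<bar> \<le> K * exp (- t)"
  shows "(\<integral>t. indicator {0<..} t * (t * F2 t) \<partial>lborel) = F0 0"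
proof -
  have K: "K \<ge> 0" using b0[of 0] by simp
  define G where "G t = t * F1 t - F0 t" for t
  have der: "(G has_real_derivative t * F2 t) (at t)" for t
    unfolding G_def by (auto intro!: derivative_eq_intros F0 F1)
  have isc: "isCont F2 t" for t using cont by (simp add: continuous_on_eq_continuous_at)
  have [measurable]: "F2 \<in> borel_measurable borel" using cont by (intro borel_measurable_continuous_onI)
  have int: "integrable lborel (\<lambda>t. indicator {0<..} t * (t * F2 t))"
  proof (rule Bochner_Integration.integrable_bound[OF integrable_mult_right[OF integrable_t_exp, of K]])
    show "AE t in lborel. norm (indicator {0<..} t * (t * F2 t)) \<le> norm (K * (indicator {0<..} t * (t * exp (- t))))"
    proof (intro AE_I2)
      fix t :: real
      show "norm (indicator {0<..} t * (t * F2 t)) \<le> norm (K * (indicator {0<..} t * (t * exp (- t))))"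
        using mult_left_mono[OF b2[of t], of t] K by (auto simp: indicator_def abs_mult mult_ac)
    qed
  qed measurable
  have "(LBINT t=ereal 0..\<infinity>. t * F2 t) = 0 - (- F0 0)"
  proof (rule interval_integral_FTC_integrable[where F = G])
    show "(G has_vector_derivative t * F2 t) (at t)" for t
      using der by (simp add: has_real_derivative_iff_has_vector_derivative)
    show "isCont (\<lambda>t. t * F2 t) t" for t by (intro continuous_intros isc)
    show "set_integrable lborel (einterval (ereal 0) \<infinity>) (\<lambda>t. t * F2 t)"
      using int by (simp add: set_integrable_def greaterThan_def einterval_def)
    have "(G \<longlongrightarrow> G 0) (at 0)"
      using DERIV_isCont[OF der[of 0]] by (simp add: isCont_def)
    moreover have "G 0 = - F0 0" by (simp add: G_def)
    ultimately have "(G \<longlongrightarrow> - F0 0) (at_right 0)"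
      by (simp add: filterlim_at_split)
    then show "((G \<circ> real_of_ereal) \<longlongrightarrow> - F0 0) (at_right (ereal 0))"
      by (simp add: ereal_tendsto_simps)
    have "((\<lambda>t. K * ((t + 1) * exp (- t))) \<longlongrightarrow> 0) at_top"
      by (rule tendsto_mult_right_zero) real_asymp
    moreover have "\<forall>\<^sub>F t in at_top. norm (G t) \<le> K * ((t + 1) * exp (- t))"
      using eventually_ge_at_top[of 0]
    proof eventually_elim
      fix t :: real assume t: "0 \<le> t"
      have "\<bar>G t\<bar> \<le> t * \<bar>F1 t\<bar> + \<bar>F0 t\<bar>"
        unfolding G_def using t by (intro order_trans[OF abs_triangle_ineq4]) (simp add: abs_mult)
      also have "\<dots> \<le> t * (K * exp (- t)) + K * exp (- t)"
        using t by (intro add_mono mult_left_mono b0 b1) auto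
      finally show "norm (G t) \<le> K * ((t + 1) * exp (- t))" by (simp add: algebra_simps)
    qed
    ultimately have "(G \<longlongrightarrow> 0) at_top" by (rule Lim_null_comparison[rotated])
    then show "((G \<circ> real_of_ereal) \<longlongrightarrow> 0) (at_left \<infinity>)"
      by (simp add: ereal_tendsto_simps)
  qed simp
  also have "(LBINT t=ereal 0..\<infinity>. t * F2 t) = (\<integral>t. indicator {0<..} t * (t * F2 t) \<partial>lborel)"
    by (simp add: interval_lebesgue_integral_def set_lebesgue_integral_def einterval_def greaterThan_def)
  finally show ?thesis by simp
qed

text \<open>The time variable is treated as direction \<open>n\<close>.\<close>

lemma nn_integral_t_laplacian:
  fixes F0 :: "real \<Rightarrow> (nat \<Rightarrow> real) \<Rightarrow> real" and F1 F2 :: "nat \<Rightarrow> real \<Rightarrow> (nat \<Rightarrow> real) \<Rightarrow> real"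
  assumes t0: "\<And>t x. ((\<lambda>t. F0 t x) has_real_derivative F1 n t x) (at t)"
    and t1: "\<And>t x. ((\<lambda>t. F1 n t x) has_real_derivative F2 n t x) (at t)"
    and x1: "\<And>j t x s. j < n \<Longrightarrow> ((\<lambda>s. F1 j t (x(j := s))) has_real_derivative F2 j t (x(j := s))) (at s)"
    and ct: "\<And>x. continuous_on UNIV (\<lambda>t. F2 n t x)"
    and cx: "\<And>j t x. j < n \<Longrightarrow> continuous_on UNIV (\<lambda>s. F2 j t (x(j := s)))"
    and b0: "\<And>t x. t \<ge> 0 \<Longrightarrow> \<bar>F0 t x\<bar> \<le> K * (exp (- t) * gauss n x)"
    and b1: "\<And>j t x. j \<le> n \<Longrightarrow> t \<ge> 0 \<Longrightarrow> \<bar>F1 j t x\<bar> \<le> K * (exp (- t) * gauss n x)"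
    and b2: "\<And>j t x. j \<le> n \<Longrightarrow> t \<ge> 0 \<Longrightarrow> \<bar>F2 j t x\<bar> \<le> K * (exp (- t) * gauss n x)"
    and m2: "\<And>j. j \<le> n \<Longrightarrow> (\<lambda>z. F2 j (fst z) (snd z)) \<in> borel_measurable (borel \<Otimes>\<^sub>M lebesgue_Rn n)"
    and pos: "\<And>t x. t > 0 \<Longrightarrow> (\<Sum>j\<le>n. F2 j t x) \<ge> 0"
  shows "(\<integral>\<^sup>+t\<in>{0<..}. ((\<integral>\<^sup>+x. ennreal (\<Sum>j\<le>n. F2 j t x) \<partial>lebesgue_Rn n) * ennreal t) \<partial>lborel)
    = ennreal (\<integral>x. F0 0 x \<partial>lebesgue_Rn n)"
proof -
  interpret L: sigma_finite_measure "lebesgue_Rn n" by (rule sigma_finite_lebesgue_Rn)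
  interpret P: pair_sigma_finite lborel "lebesgue_Rn n" ..
  have K: "K \<ge> 0"
  proof -
    have "0 \<le> K * (exp (- 0) * gauss n (\<lambda>_. 0))" using b0[of 0 "\<lambda>_. 0"] by linarith
    then show ?thesis using gauss_pos[of n "\<lambda>_. 0"] by (simp add: zero_le_mult_iff)
  qed
  have m2': "F2 j t \<in> borel_measurable (lebesgue_Rn n)" if "j \<le> n" for j t
    using measurable_compose[OF measurable_Pair1' m2[OF that], of t] by simp
  have int2: "integrable (lebesgue_Rn n) (F2 j t)" if "j \<le> n" "t \<ge> 0" for j t
    by (rule integrable_gauss_bound[OF m2', of _ _ "K * exp (- t)"]) (use b2 that in \<open>auto simp: mult.assoc\<close>)
  \<comment> \<open>Each spatial second derivative has integral 0 at fixed time; only direction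
    \<open>n\<close> survives.\<close>
  have zero: "(\<integral>x. F2 j t x \<partial>lebesgue_Rn n) = 0" if "j < n" "t \<ge> 0" for j t
    by (rule integral_partial_eq_0[where G = "F1 j t" and K = "K * exp (- t)" and L = "K * exp (- t)",
          OF that(1) x1[OF that(1)] cx[OF that(1)]])
       (use that b1 b2 K m2' in \<open>auto simp: mult.assoc\<close>)
  define k where "k t x = indicator {0<..} t * (t * F2 n t x)" for t x
  have [measurable]: "(\<lambda>z. F2 n (fst z) (snd z)) \<in> borel_measurable (lborel \<Otimes>\<^sub>M lebesgue_Rn n)"
    using m2[of n] by (simp cong: measurable_cong_sets)
  have [measurable]: "gauss n \<in> borel_measurable (lebesgue_Rn n)" by (rule measurable_gauss)
  define T where "T t = indicator {0<..} t * (t * exp (- t))" for t :: real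
  have T [measurable]: "T \<in> borel_measurable borel" unfolding T_def by measurable
  have intT: "integrable lborel T" unfolding T_def by (rule integrable_t_exp)
  have T0: "T t \<ge> 0" for t by (simp add: T_def indicator_def)
  have "integrable (lborel \<Otimes>\<^sub>M lebesgue_Rn n) (\<lambda>(t, x). T t * gauss n x)"
  proof (rule P.Fubini_integrable)
    show "integrable lborel (\<lambda>t. \<integral>x. norm (case (t, x) of (t, x) \<Rightarrow> T t * gauss n x) \<partial>lebesgue_Rn n)"
      using T0 gauss_pos intT by (simp add: abs_mult less_imp_le)
    show "AE t in lborel. integrable (lebesgue_Rn n) (\<lambda>x. case (t, x) of (t, x) \<Rightarrow> T t * gauss n x)"
      using integrable_gauss by auto
  qed measurable
  then have "integrable (lborel \<Otimes>\<^sub>M lebesgue_Rn n) (\<lambda>z. K * (case z of (t, x) \<Rightarrow> T t * gauss n x))"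
    by (rule integrable_mult_right)
  then have intk: "integrable (lborel \<Otimes>\<^sub>M lebesgue_Rn n) (case_prod k)"
  proof (rule Bochner_Integration.integrable_bound)
    show "case_prod k \<in> borel_measurable (lborel \<Otimes>\<^sub>M lebesgue_Rn n)"
      unfolding k_def by (simp add: case_prod_beta)
    show "AE z in lborel \<Otimes>\<^sub>M lebesgue_Rn n. norm (case_prod k z) \<le> norm (K * (case z of (t, x) \<Rightarrow> T t * gauss n x))"
    proof (intro AE_I2, clarify)
      fix t x
      show "norm (k t x) \<le> norm (K * (T t * gauss n x))"
      proof (cases "t > 0")
        case True
        then have "t * \<bar>F2 n t x\<bar> \<le> t * (K * (exp (- t) * gauss n x))"
          using b2[of n t x] by (intro mult_left_mono) auto
        then show ?thesis using True K gauss_pos[of n x] by (simp add: k_def T_def abs_mult mult_ac)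
      qed (simp add: k_def T_def)
    qed
  qed
  \<comment> \<open>Only the sum over all directions is known to be nonnegative. Its spatial
    integral equals that of the time direction alone, which is therefore nonnegative too; so the
    nonnegative integral becomes a Bochner integral of \<open>k\<close>, to which Fubini
    applies.\<close>
  have inner: "ennreal (indicator {0<..} t) * ((\<integral>\<^sup>+x. ennreal (\<Sum>j\<le>n. F2 j t x) \<partial>lebesgue_Rn n) * ennreal t)
      = ennreal (\<integral>x. k t x \<partial>lebesgue_Rn n) \<and> (\<integral>x. k t x \<partial>lebesgue_Rn n) \<ge> 0" for t
  proof (cases "t > 0")
    case True
    have "(\<integral>x. (\<Sum>j\<le>n. F2 j t x) \<partial>lebesgue_Rn n) = (\<Sum>j\<le>n. \<integral>x. F2 j t x \<partial>lebesgue_Rn n)"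
      using True by (intro Bochner_Integration.integral_sum int2) auto
    also have "\<dots> = (\<integral>x. F2 n t x \<partial>lebesgue_Rn n)"
      using True zero by (simp add: lessThan_Suc_atMost[symmetric])
    finally have s: "(\<integral>x. (\<Sum>j\<le>n. F2 j t x) \<partial>lebesgue_Rn n) = (\<integral>x. F2 n t x \<partial>lebesgue_Rn n)" .
    have e: "(\<integral>\<^sup>+x. ennreal (\<Sum>j\<le>n. F2 j t x) \<partial>lebesgue_Rn n) = ennreal (\<integral>x. F2 n t x \<partial>lebesgue_Rn n)"
      unfolding s[symmetric]
      using pos[OF True] True by (intro nn_integral_eq_integral Bochner_Integration.integrable_sum int2) auto
    have p: "(\<integral>x. F2 n t x \<partial>lebesgue_Rn n) \<ge> 0"
      unfolding s[symmetric] by (intro integral_nonneg_AE AE_I2 pos True)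
    show ?thesis unfolding e k_def using True p by (simp add: ennreal_mult[symmetric] mult.commute)
  qed (simp add: k_def)
  have "(\<integral>\<^sup>+t\<in>{0<..}. ((\<integral>\<^sup>+x. ennreal (\<Sum>j\<le>n. F2 j t x) \<partial>lebesgue_Rn n) * ennreal t) \<partial>lborel)
     = (\<integral>\<^sup>+t. ennreal (\<integral>x. k t x \<partial>lebesgue_Rn n) \<partial>lborel)"
    by (intro nn_integral_cong) (use inner in \<open>simp add: mult_ac ennreal_indicator\<close>)
  also have "\<dots> = ennreal (\<integral>t. (\<integral>x. k t x \<partial>lebesgue_Rn n) \<partial>lborel)"
    using inner P.integrable_fst[OF intk] by (intro nn_integral_eq_integral) auto
  also have "(\<integral>t. (\<integral>x. k t x \<partial>lebesgue_Rn n) \<partial>lborel) = (\<integral>x. (\<integral>t. k t x \<partial>lborel) \<partial>lebesgue_Rn n)"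
    by (rule P.Fubini_integral[OF intk, symmetric])
  also have "(\<lambda>x. \<integral>t. k t x \<partial>lborel) = (\<lambda>x. F0 0 x)"
    unfolding k_def
  proof (rule ext, rule integral_t_second_derivative[OF t0 t1 ct])
    fix x t assume t: "(0::real) \<le> t"
    have g: "K * (exp (- t) * gauss n x) \<le> K * exp (- t)"
      using gauss_le_1[of n x] K by (intro mult_left_mono mult_left_le) auto
    show "\<bar>F0 t x\<bar> \<le> K * exp (- t)" "\<bar>F1 n t x\<bar> \<le> K * exp (- t)" "\<bar>F2 n t x\<bar> \<le> K * exp (- t)"
      using b0[OF t, of x] b1[OF _ t, of n x] b2[OF _ t, of n x] g by auto
  qed
  finally show ?thesis .
qed

section \<open>Complex N-space as a real Euclidean space\<close>

definition norm2_CN :: "nat \<Rightarrow> (nat \<Rightarrow> complex) \<Rightarrow> real" where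
  "norm2_CN N a = (\<Sum>i<N. a i \<bullet> a i)"

text \<open>The real part of the Hermitian product. The Bellman function sees its vectors only
  through their squared lengths, whose derivatives are real inner products.\<close>

definition inner_CN :: "nat \<Rightarrow> (nat \<Rightarrow> complex) \<Rightarrow> (nat \<Rightarrow> complex) \<Rightarrow> real" where
  "inner_CN N a b = (\<Sum>i<N. a i \<bullet> b i)"

lemma norm2_CN_nonneg: "norm2_CN N a \<ge> 0"
  unfolding norm2_CN_def by (intro sum_nonneg) simp

lemma norm_CN_sq: "(norm_CN N a)\<^sup>2 = norm2_CN N a"
  unfolding norm_CN_def L2_set_def norm2_CN_def
  by (simp add: sum_nonneg power2_norm_eq_inner)

lemma abs_ip_le: "\<bar>inner_CN N a b\<bar> \<le> sqrt (norm2_CN N a) * sqrt (norm2_CN N b)"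
proof -
  have "\<bar>inner_CN N a b\<bar> \<le> (\<Sum>i<N. \<bar>cmod (a i)\<bar> * \<bar>cmod (b i)\<bar>)"
    unfolding inner_CN_def by (intro order_trans[OF sum_abs] sum_mono) (simp add: Cauchy_Schwarz_ineq2)
  also have "\<dots> \<le> L2_set (\<lambda>i. cmod (a i)) {..<N} * L2_set (\<lambda>i. cmod (b i)) {..<N}"
    by (rule L2_set_mult_ineq)
  also have "\<dots> = sqrt (norm2_CN N a) * sqrt (norm2_CN N b)"
    unfolding L2_set_def norm2_CN_def by (simp add: power2_norm_eq_inner)
  finally show ?thesis .
qed

lemma DERIV_ip:
  assumes "\<And>i. i < N \<Longrightarrow> ((\<lambda>s. a s i) has_vector_derivative a1 i) (at s)"
    and "\<And>i. i < N \<Longrightarrow> ((\<lambda>s. b s i) has_vector_derivative b1 i) (at s)"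
  shows "((\<lambda>s. inner_CN N (a s) (b s)) has_real_derivative inner_CN N (a s) b1 + inner_CN N a1 (b s)) (at s)"
  unfolding inner_CN_def sum.distrib[symmetric] has_real_derivative_iff_has_vector_derivative
  by (intro has_vector_derivative_sum bounded_bilinear.has_vector_derivative[OF bounded_bilinear_inner] assms) auto

lemma norm2_CN_eq_ip: "norm2_CN N a = inner_CN N a a"
  by (simp add: norm2_CN_def inner_CN_def)

lemma inner_CN_commute: "inner_CN N a b = inner_CN N b a"
  unfolding inner_CN_def by (simp add: inner_commute)

lemma DERIV_sq:
  assumes "\<And>i. i < N \<Longrightarrow> ((\<lambda>s. a s i) has_vector_derivative a1 i) (at s)"
  shows "((\<lambda>s. norm2_CN N (a s)) has_real_derivative 2 * inner_CN N (a s) a1) (at s)"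
  using DERIV_ip[where N = N and a = a and b = a and ?a1.0 = a1 and ?b1.0 = a1 and s = s] assms
  unfolding norm2_CN_eq_ip inner_CN_commute[of N a1] by simp

lemma measurable_ip [measurable (raw)]:
  assumes "\<And>i. i < N \<Longrightarrow> (\<lambda>z. f z i) \<in> borel_measurable Q" "\<And>i. i < N \<Longrightarrow> (\<lambda>z. g z i) \<in> borel_measurable Q"
  shows "(\<lambda>z. inner_CN N (f z) (g z)) \<in> borel_measurable Q"
  unfolding inner_CN_def using assms by (intro borel_measurable_sum borel_measurable_inner) auto

section \<open>The Bellman function along a pair of curves\<close>

context bellman
begin

text \<open>\<open>beta0\<close>, \<open>beta1\<close>, \<open>beta2\<close> are the Bellman function along a pair of curves and its first two
  derivatives.  The shift by \<open>e > 0\<close> keeps the arguments away from the singularity at \<open>0\<close>; it amounts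
  to adding a constant component to each of the two vectors.\<close>

definition beta0 where
  "beta0 M N e a b = bell (norm2_CN M a + e) (norm2_CN N b + e) - bell e e"

definition beta1 where
  "beta1 M N e a a1 b b1 = bU (norm2_CN M a + e) (norm2_CN N b + e) * (2 * inner_CN M a a1) + bV (norm2_CN M a + e) (norm2_CN N b + e) * (2 * inner_CN N b b1)"

definition beta2 where
  "beta2 M N e a a1 a2 b b1 b2 =
     bUU (norm2_CN M a + e) (norm2_CN N b + e) * (2 * inner_CN M a a1)\<^sup>2
     + 2 * bUV (norm2_CN M a + e) (norm2_CN N b + e) * (2 * inner_CN M a a1) * (2 * inner_CN N b b1)
     + bVV (norm2_CN M a + e) (norm2_CN N b + e) * (2 * inner_CN N b b1)\<^sup>2
     + bU (norm2_CN M a + e) (norm2_CN N b + e) * (2 * (norm2_CN M a1 + inner_CN M a a2))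
     + bV (norm2_CN M a + e) (norm2_CN N b + e) * (2 * (norm2_CN N b1 + inner_CN N b b2))"

lemma norm2_CN_plus_pos: "e > 0 \<Longrightarrow> norm2_CN M a + e > 0"
  using norm2_CN_nonneg[of M a] by linarith

lemma DERIV_beta0:
  assumes "e > 0"
    and "\<And>i. i < M \<Longrightarrow> ((\<lambda>s. a s i) has_vector_derivative a1 i) (at s)"
    and "\<And>i. i < N \<Longrightarrow> ((\<lambda>s. b s i) has_vector_derivative b1 i) (at s)"
  shows "((\<lambda>s. beta0 M N e (a s) (b s)) has_real_derivative beta1 M N e (a s) a1 (b s) b1) (at s)"
proof -
  have U: "((\<lambda>s. norm2_CN M (a s) + e) has_real_derivative 2 * inner_CN M (a s) a1) (at s)"
    and V: "((\<lambda>s. norm2_CN N (b s) + e) has_real_derivative 2 * inner_CN N (b s) b1) (at s)"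
    using DERIV_add[OF DERIV_sq[OF assms(2)] DERIV_const[of e]] DERIV_add[OF DERIV_sq[OF assms(3)] DERIV_const[of e]] by auto
  from DERIV_diff[OF DERIV_bell[OF U _ V] DERIV_const[of "bell e e"]] show ?thesis
    unfolding beta0_def beta1_def using assms(1) by (simp add: norm2_CN_plus_pos)
qed

lemma DERIV_beta1:
  assumes "e > 0"
    and a: "\<And>i. i < M \<Longrightarrow> ((\<lambda>s. a s i) has_vector_derivative a1 s i) (at s)"
    and a1: "\<And>i. i < M \<Longrightarrow> ((\<lambda>s. a1 s i) has_vector_derivative a2 i) (at s)"
    and b: "\<And>i. i < N \<Longrightarrow> ((\<lambda>s. b s i) has_vector_derivative b1 s i) (at s)"
    and b1: "\<And>i. i < N \<Longrightarrow> ((\<lambda>s. b1 s i) has_vector_derivative b2 i) (at s)"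
  shows "((\<lambda>s. beta1 M N e (a s) (a1 s) (b s) (b1 s)) has_real_derivative
    beta2 M N e (a s) (a1 s) a2 (b s) (b1 s) b2) (at s)"
proof -
  have U: "((\<lambda>s. norm2_CN M (a s) + e) has_real_derivative 2 * inner_CN M (a s) (a1 s)) (at s)"
    and V: "((\<lambda>s. norm2_CN N (b s) + e) has_real_derivative 2 * inner_CN N (b s) (b1 s)) (at s)"
    using DERIV_add[OF DERIV_sq[OF a] DERIV_const[of e]] DERIV_add[OF DERIV_sq[OF b] DERIV_const[of e]] by auto
  have U0: "norm2_CN M (a s) + e > 0" and V0: "norm2_CN N (b s) + e > 0" using assms(1) by (auto simp: norm2_CN_plus_pos)
  have A: "((\<lambda>s. 2 * inner_CN M (a s) (a1 s)) has_real_derivative 2 * (inner_CN M (a s) a2 + inner_CN M (a1 s) (a1 s))) (at s)"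
    and B: "((\<lambda>s. 2 * inner_CN N (b s) (b1 s)) has_real_derivative 2 * (inner_CN N (b s) b2 + inner_CN N (b1 s) (b1 s))) (at s)"
    by (intro DERIV_cmult DERIV_ip a a1 b b1; assumption)+
  from DERIV_add[OF DERIV_mult[OF DERIV_bU[OF U U0 V V0] A] DERIV_mult[OF DERIV_bV[OF U U0 V V0] B]]
  show ?thesis
    unfolding beta1_def beta2_def norm2_CN_eq_ip[of _ "a1 s"] norm2_CN_eq_ip[of _ "b1 s"]
    by (rule back_subst[of "\<lambda>D. (_ has_real_derivative D) (at s)"]) (simp add: power2_eq_square algebra_simps)
qed

lemma continuous_on_beta2:
  assumes "e > 0"
    and "\<And>i. i < M \<Longrightarrow> continuous_on S (\<lambda>s. a s i)" "\<And>i. i < M \<Longrightarrow> continuous_on S (\<lambda>s. a1 s i)"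
      "\<And>i. i < M \<Longrightarrow> continuous_on S (\<lambda>s. a2 s i)"
    and "\<And>i. i < N \<Longrightarrow> continuous_on S (\<lambda>s. b s i)" "\<And>i. i < N \<Longrightarrow> continuous_on S (\<lambda>s. b1 s i)"
      "\<And>i. i < N \<Longrightarrow> continuous_on S (\<lambda>s. b2 s i)"
  shows "continuous_on S (\<lambda>s. beta2 M N e (a s) (a1 s) (a2 s) (b s) (b1 s) (b2 s))"
proof -
  have c: "continuous_on S (\<lambda>s. inner_CN N (f s) (g s))"
    if "\<And>i. i < N \<Longrightarrow> continuous_on S (\<lambda>s. f s i)" "\<And>i. i < N \<Longrightarrow> continuous_on S (\<lambda>s. g s i)" for N f g
    unfolding inner_CN_def using that by (intro continuous_intros) auto
  have "continuous_on S (\<lambda>s. norm2_CN M (a s) + e)" "continuous_on S (\<lambda>s. norm2_CN N (b s) + e)"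
    unfolding norm2_CN_eq_ip by (intro continuous_intros c assms; assumption)+
  note 1 = continuous_on_bell(2-6)[OF this norm2_CN_plus_pos[OF assms(1)] norm2_CN_plus_pos[OF assms(1)]]
  show ?thesis
    unfolding beta2_def norm2_CN_eq_ip[of _ "a1 _"] norm2_CN_eq_ip[of _ "b1 _"]
    by (intro continuous_on_add continuous_on_mult continuous_on_power continuous_on_const 1 c assms; assumption)
qed

lemma measurable_beta:
  assumes "\<And>i. i < M \<Longrightarrow> (\<lambda>s. a s i) \<in> borel_measurable Q" "\<And>i. i < M \<Longrightarrow> (\<lambda>s. a1 s i) \<in> borel_measurable Q"
      "\<And>i. i < M \<Longrightarrow> (\<lambda>s. a2 s i) \<in> borel_measurable Q"
    and "\<And>i. i < N \<Longrightarrow> (\<lambda>s. b s i) \<in> borel_measurable Q" "\<And>i. i < N \<Longrightarrow> (\<lambda>s. b1 s i) \<in> borel_measurable Q"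
      "\<And>i. i < N \<Longrightarrow> (\<lambda>s. b2 s i) \<in> borel_measurable Q"
  shows "(\<lambda>s. beta2 M N e (a s) (a1 s) (a2 s) (b s) (b1 s) (b2 s)) \<in> borel_measurable Q"
proof -
  have [measurable]: "(\<lambda>s. inner_CN M (a s) (a s)) \<in> borel_measurable Q" "(\<lambda>s. inner_CN M (a s) (a1 s)) \<in> borel_measurable Q"
    "(\<lambda>s. inner_CN M (a s) (a2 s)) \<in> borel_measurable Q" "(\<lambda>s. inner_CN M (a1 s) (a1 s)) \<in> borel_measurable Q"
    "(\<lambda>s. inner_CN N (b s) (b s)) \<in> borel_measurable Q" "(\<lambda>s. inner_CN N (b s) (b1 s)) \<in> borel_measurable Q"
    "(\<lambda>s. inner_CN N (b s) (b2 s)) \<in> borel_measurable Q" "(\<lambda>s. inner_CN N (b1 s) (b1 s)) \<in> borel_measurable Q"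
    by (intro measurable_ip assms; assumption)+
  show ?thesis unfolding beta2_def norm2_CN_eq_ip by measurable
qed

text \<open>The directions are summed while the bound is still quadratic with common coefficients
  \<open>E\<close> and \<open>Y\<close>; only then is it turned into a product. The second
  derivatives enter solely through their sum, a multiple \<open>X\<close> of the vector itself, with
  \<open>X\<close> the value |x|^2 in the application.\<close>

lemma beta2_sum_lower:
  fixes a b :: "nat \<Rightarrow> complex" and a1 a2 b1 b2 :: "'k \<Rightarrow> nat \<Rightarrow> complex"
  assumes e: "e > 0" and X: "X \<ge> 0"
    and a2: "\<And>i. i < M \<Longrightarrow> (\<Sum>k\<in>S. a2 k i) = of_real X * a i"
    and b2: "\<And>i. i < N \<Longrightarrow> (\<Sum>k\<in>S. b2 k i) = of_real X * b i"
  shows "sqrt ((\<Sum>k\<in>S. norm2_CN M (a1 k)) + X * norm2_CN M a) * sqrt ((\<Sum>k\<in>S. norm2_CN N (b1 k)) + X * norm2_CN N b) / (3 * m)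
    \<le> (\<Sum>k\<in>S. beta2 M N e a (a1 k) (a2 k) b (b1 k) (b2 k))"
proof -
  define U where "U = norm2_CN M a + e"
  define V where "V = norm2_CN N b + e"
  have U: "U > 0" "norm2_CN M a \<le> U" and V: "V > 0" "norm2_CN N b \<le> V"
    using e norm2_CN_nonneg by (auto simp: U_def V_def norm2_CN_plus_pos)
  define E where "E = DD U V powr sg"
  define Y where "Y = V powr (- sg)"
  have ipX: "(\<Sum>k\<in>S. inner_CN L c (c2 k)) = X * norm2_CN L c" if "\<And>i. i < L \<Longrightarrow> (\<Sum>k\<in>S. c2 k i) = of_real X * c i"
    for L c and c2 :: "'k \<Rightarrow> nat \<Rightarrow> complex"
  proof -
    have "(\<Sum>k\<in>S. inner_CN L c (c2 k)) = (\<Sum>i<L. c i \<bullet> (\<Sum>k\<in>S. c2 k i))"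
      unfolding inner_CN_def by (subst sum.swap) (simp add: inner_sum_right)
    also have "\<dots> = (\<Sum>i<L. X * (c i \<bullet> c i))"
      by (intro sum.cong refl) (use that in \<open>simp add: inner_mult_right scaleR_conv_of_real[symmetric]\<close>)
    finally show ?thesis by (simp add: norm2_CN_def sum_distrib_left)
  qed
  \<comment> \<open>One direction: \<open>bell_hessian\<close> with the lengths of the derivatives
    as \<open>a\<close> and \<open>b\<close>, and the derivatives of the squared lengths as
    \<open>u\<close> and \<open>v\<close>. Cauchy-Schwarz provides its hypotheses.\<close>
  have "del * (E * norm2_CN M (a1 k) + 7 * (Y * norm2_CN N (b1 k))) + 2 * bU U V * inner_CN M a (a2 k) + 2 * bV U V * inner_CN N b (b2 k)
      \<le> beta2 M N e a (a1 k) (a2 k) b (b1 k) (b2 k)" for k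
  proof -
    have "\<bar>2 * inner_CN M a (a1 k)\<bar> \<le> 2 * sqrt U * sqrt (norm2_CN M (a1 k))"
    proof -
      have "sqrt (norm2_CN M a) * sqrt (norm2_CN M (a1 k)) \<le> sqrt U * sqrt (norm2_CN M (a1 k))"
        using U norm2_CN_nonneg by (intro mult_right_mono) auto
      then show ?thesis using abs_ip_le[of M a "a1 k"] by (simp add: abs_mult)
    qed
    moreover have "\<bar>2 * inner_CN N b (b1 k)\<bar> \<le> 2 * sqrt V * sqrt (norm2_CN N (b1 k))"
    proof -
      have "sqrt (norm2_CN N b) * sqrt (norm2_CN N (b1 k)) \<le> sqrt V * sqrt (norm2_CN N (b1 k))"
        using V norm2_CN_nonneg by (intro mult_right_mono) auto
      then show ?thesis using abs_ip_le[of N b "b1 k"] by (simp add: abs_mult)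
    qed
    ultimately have "del * (E * (sqrt (norm2_CN M (a1 k)))\<^sup>2 + 7 * (Y * (sqrt (norm2_CN N (b1 k)))\<^sup>2))
      \<le> 2 * bU U V * (sqrt (norm2_CN M (a1 k)))\<^sup>2 + 2 * bV U V * (sqrt (norm2_CN N (b1 k)))\<^sup>2 + bUU U V * (2 * inner_CN M a (a1 k))\<^sup>2
        + 2 * bUV U V * (2 * inner_CN M a (a1 k)) * (2 * inner_CN N b (b1 k)) + bVV U V * (2 * inner_CN N b (b1 k))\<^sup>2"
      unfolding E_def Y_def using U V norm2_CN_nonneg by (intro bell_hessian) auto
    then show ?thesis
      unfolding beta2_def U_def[symmetric] V_def[symmetric] using norm2_CN_nonneg by (simp add: algebra_simps)
  qed
  then have "(\<Sum>k\<in>S. del * (E * norm2_CN M (a1 k) + 7 * (Y * norm2_CN N (b1 k))) + 2 * bU U V * inner_CN M a (a2 k) + 2 * bV U V * inner_CN N b (b2 k))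
      \<le> (\<Sum>k\<in>S. beta2 M N e a (a1 k) (a2 k) b (b1 k) (b2 k))"
    by (intro sum_mono)
  also have "(\<Sum>k\<in>S. del * (E * norm2_CN M (a1 k) + 7 * (Y * norm2_CN N (b1 k))) + 2 * bU U V * inner_CN M a (a2 k) + 2 * bV U V * inner_CN N b (b2 k))
     = del * (E * (\<Sum>k\<in>S. norm2_CN M (a1 k)) + 7 * (Y * (\<Sum>k\<in>S. norm2_CN N (b1 k))))
       + 2 * bU U V * (\<Sum>k\<in>S. inner_CN M a (a2 k)) + 2 * bV U V * (\<Sum>k\<in>S. inner_CN N b (b2 k))"
    by (simp add: sum.distrib sum_distrib_left distrib_left)
  also have "\<dots> = del * (E * (\<Sum>k\<in>S. norm2_CN M (a1 k)) + 7 * (Y * (\<Sum>k\<in>S. norm2_CN N (b1 k))))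
       + (2 * bU U V * (X * norm2_CN M a) + 2 * bV U V * (X * norm2_CN N b))"
    by (simp add: ipX[OF a2] ipX[OF b2])
  finally have 1: "del * (E * (\<Sum>k\<in>S. norm2_CN M (a1 k)) + 7 * (Y * (\<Sum>k\<in>S. norm2_CN N (b1 k))))
       + (2 * bU U V * (X * norm2_CN M a) + 2 * bV U V * (X * norm2_CN N b)) \<le> (\<Sum>k\<in>S. beta2 M N e a (a1 k) (a2 k) b (b1 k) (b2 k))" .
  \<comment> \<open>The gradient terms come from the same lemma: with \<open>u = v = 0\<close> only
    \<open>bU\<close> and \<open>bV\<close> are left on its right-hand side. This adds the
    zeroth-order part of the star norm.\<close>
  have "del * (E * (sqrt (X * norm2_CN M a))\<^sup>2 + 7 * (Y * (sqrt (X * norm2_CN N b))\<^sup>2))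
      \<le> 2 * bU U V * (sqrt (X * norm2_CN M a))\<^sup>2 + 2 * bV U V * (sqrt (X * norm2_CN N b))\<^sup>2 + bUU U V * 0\<^sup>2 + 2 * bUV U V * 0 * 0 + bVV U V * 0\<^sup>2"
    unfolding E_def Y_def using U V X norm2_CN_nonneg by (intro bell_hessian) auto
  then have 2: "del * (E * (X * norm2_CN M a) + 7 * (Y * (X * norm2_CN N b))) \<le> 2 * bU U V * (X * norm2_CN M a) + 2 * bV U V * (X * norm2_CN N b)"
    using X norm2_CN_nonneg by simp
  define SA where "SA = (\<Sum>k\<in>S. norm2_CN M (a1 k)) + X * norm2_CN M a"
  define SB where "SB = (\<Sum>k\<in>S. norm2_CN N (b1 k)) + X * norm2_CN N b"
  have S0: "SA \<ge> 0" "SB \<ge> 0"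
    unfolding SA_def SB_def using X norm2_CN_nonneg by (auto intro!: add_nonneg_nonneg sum_nonneg mult_nonneg_nonneg)
  have "sqrt SA * sqrt SB / (3 * m) \<le> del * (E * (sqrt SA)\<^sup>2 + 7 * (Y * (sqrt SB)\<^sup>2))"
    unfolding E_def Y_def using U V S0 by (intro hessian_bound_ge_mult) auto
  also have "\<dots> = del * (E * SA + 7 * (Y * SB))" using S0 by simp
  also have "\<dots> = del * (E * (\<Sum>k\<in>S. norm2_CN M (a1 k)) + 7 * (Y * (\<Sum>k\<in>S. norm2_CN N (b1 k)))) + del * (E * (X * norm2_CN M a) + 7 * (Y * (X * norm2_CN N b)))"
    unfolding SA_def SB_def by (simp add: algebra_simps)
  also have "\<dots> \<le> (\<Sum>k\<in>S. beta2 M N e a (a1 k) (a2 k) b (b1 k) (b2 k))" using 1 2 by linarith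
  finally show ?thesis unfolding SA_def SB_def .
qed

lemma beta0_nonneg: "e > 0 \<Longrightarrow> beta0 M N e a b \<ge> 0"
  unfolding beta0_def using bell_mono[of e "norm2_CN M a + e" e "norm2_CN N b + e"] norm2_CN_nonneg by auto

text \<open>\<open>G\<close> stands for \<open>exp (- t) * gauss n x\<close>. Linear decay in
  \<open>G\<close> of the function and its derivatives is what makes all integrals over the half
  space converge; for \<open>beta0\<close> it depends on the subtracted constant
  \<open>bell e e\<close>.\<close>

lemma beta_bounds:
  assumes e: "0 < e" "e \<le> 1" and K: "K \<ge> 0"
  shows "\<exists>L\<ge>0. \<forall>a a1 a2 b b1 b2 G. 0 \<le> G \<longrightarrow> G \<le> 1 \<longrightarrow>
     (\<forall>i<M. cmod (a i) \<le> K * G \<and> cmod (a1 i) \<le> K * G \<and> cmod (a2 i) \<le> K * G) \<longrightarrow>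
     (\<forall>i<N. cmod (b i) \<le> K * G \<and> cmod (b1 i) \<le> K * G \<and> cmod (b2 i) \<le> K * G) \<longrightarrow>
     \<bar>beta0 M N e a b\<bar> \<le> L * G \<and> \<bar>beta1 M N e a a1 b b1\<bar> \<le> L * G \<and> \<bar>beta2 M N e a a1 a2 b b1 b2\<bar> \<le> L * G"
proof -
  define P where "P = real (M + N) * K\<^sup>2"
  have P: "P \<ge> 0" by (simp add: P_def)
  obtain Kb where Kb: "Kb \<ge> 0" "\<And>U V. U \<in> {e..P + e} \<Longrightarrow> V \<in> {e..P + e} \<Longrightarrow>
     \<bar>bU U V\<bar> \<le> Kb \<and> \<bar>bV U V\<bar> \<le> Kb \<and> \<bar>bUU U V\<bar> \<le> Kb \<and> \<bar>bUV U V\<bar> \<le> Kb \<and> \<bar>bVV U V\<bar> \<le> Kb"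
    using bell_derivs_bounded[OF e(1), of "P + e"] by blast
  obtain Ki where Ki: "Ki \<ge> 0" "\<And>A B. 0 \<le> A \<Longrightarrow> A \<le> P \<Longrightarrow> 0 \<le> B \<Longrightarrow> B \<le> P \<Longrightarrow>
    bell (A + e) (B + e) - bell e e \<le> Ki * (A + B + B powr (1 - sg))"
    using bell_increment[OF P] e by blast
  \<comment> \<open>The numbers come from \<open>beta2\<close>: \<open>16 = 4 + 2 * 4 + 4\<close>
    for the three second derivatives, \<open>8 = 4 + 4\<close> for the two first ones.\<close>
  define L where "L = Ki * (2 * P + P powr (1 - sg)) + 16 * Kb * P\<^sup>2 + 8 * Kb * P"
  have "\<bar>beta0 M N e a b\<bar> \<le> L * G \<and> \<bar>beta1 M N e a a1 b b1\<bar> \<le> L * G \<and> \<bar>beta2 M N e a a1 a2 b b1 b2\<bar> \<le> L * G"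
    if G: "0 \<le> G" "G \<le> 1"
     and a: "\<And>i. i < M \<Longrightarrow> cmod (a i) \<le> K * G \<and> cmod (a1 i) \<le> K * G \<and> cmod (a2 i) \<le> K * G"
     and b: "\<And>i. i < N \<Longrightarrow> cmod (b i) \<le> K * G \<and> cmod (b1 i) \<le> K * G \<and> cmod (b2 i) \<le> K * G"
   for a a1 a2 b b1 b2 G
  proof -
    have ipb: "\<bar>inner_CN L c d\<bar> \<le> P * G\<^sup>2" if "L \<le> M + N" "\<And>i. i < L \<Longrightarrow> cmod (c i) \<le> K * G" "\<And>i. i < L \<Longrightarrow> cmod (d i) \<le> K * G" for L c d
    proof -
      have "\<bar>inner_CN L c d\<bar> \<le> (\<Sum>i<L. (K * G) * (K * G))"
        unfolding inner_CN_def using that K G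
        by (intro order_trans[OF sum_abs] sum_mono order_trans[OF Cauchy_Schwarz_ineq2] mult_mono) auto
      also have "\<dots> = real L * (K * G * (K * G))" by simp
      also have "\<dots> \<le> real (M + N) * (K * G * (K * G))"
        using that(1) K G by (intro mult_right_mono) auto
      finally show ?thesis by (simp add: P_def power2_eq_square mult_ac)
    qed
    have G2: "G\<^sup>2 \<le> G" using G by (simp add: power2_eq_square mult_left_le)
    have PG: "P * G\<^sup>2 \<le> P * G" "P * G \<le> P" using P G G2 by (auto intro!: mult_left_mono mult_left_le)
    have "\<bar>inner_CN M a a1\<bar> \<le> P * G\<^sup>2" "\<bar>inner_CN M a a2\<bar> \<le> P * G\<^sup>2" "\<bar>inner_CN M a a\<bar> \<le> P * G\<^sup>2" "\<bar>inner_CN M a1 a1\<bar> \<le> P * G\<^sup>2"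
      by (rule ipb; use a in simp)+
    moreover have "\<bar>inner_CN N b b1\<bar> \<le> P * G\<^sup>2" "\<bar>inner_CN N b b2\<bar> \<le> P * G\<^sup>2" "\<bar>inner_CN N b b\<bar> \<le> P * G\<^sup>2" "\<bar>inner_CN N b1 b1\<bar> \<le> P * G\<^sup>2"
      by (rule ipb; use b in simp)+
    ultimately have ai: "\<bar>inner_CN M a a1\<bar> \<le> P * G\<^sup>2" "\<bar>inner_CN M a a2\<bar> \<le> P * G\<^sup>2" "\<bar>inner_CN N b b1\<bar> \<le> P * G\<^sup>2" "\<bar>inner_CN N b b2\<bar> \<le> P * G\<^sup>2"
      "norm2_CN M a \<le> P * G\<^sup>2" "norm2_CN M a1 \<le> P * G\<^sup>2" "norm2_CN N b \<le> P * G\<^sup>2" "norm2_CN N b1 \<le> P * G\<^sup>2"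
      unfolding norm2_CN_eq_ip by (simp_all only: abs_le_iff)
    have "norm2_CN M a \<le> P" "norm2_CN N b \<le> P" using ai PG by linarith+
    then have UV: "norm2_CN M a + e \<in> {e..P + e}" "norm2_CN N b + e \<in> {e..P + e}" using norm2_CN_nonneg by auto
    note Kb' = Kb(2)[OF UV]
    have 0: "\<bar>beta0 M N e a b\<bar> \<le> L * G"
    proof -
      have "norm2_CN N b powr (1 - sg) \<le> (P * G\<^sup>2) powr (1 - sg)"
        using sg ai norm2_CN_nonneg by (intro powr_mono2) auto
      also have "\<dots> = P powr (1 - sg) * (G\<^sup>2) powr (1 - sg)" using P by (simp add: powr_mult)
      \<comment> \<open>Here \<open>sg < 1 / 2\<close> matters: the resulting exponent of
        \<open>G\<close> exceeds 1.\<close>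
      also have "(G\<^sup>2) powr (1 - sg) \<le> G"
      proof (cases "G = 0")
        case False
        then have "(G\<^sup>2) powr (1 - sg) = G powr (2 * (1 - sg))" using G by (simp add: powr_powr flip: powr_numeral)
        also have "\<dots> \<le> G powr 1" using G False sg by (intro powr_mono') auto
        finally show ?thesis using G False by simp
      qed simp
      finally have p: "norm2_CN N b powr (1 - sg) \<le> P powr (1 - sg) * G" by (simp add: mult_left_mono)
      have "beta0 M N e a b \<le> Ki * (norm2_CN M a + norm2_CN N b + norm2_CN N b powr (1 - sg))"
        unfolding beta0_def using ai PG norm2_CN_nonneg by (intro Ki) auto
      also have "\<dots> \<le> Ki * (P * G + P * G + P powr (1 - sg) * G)"
        using ai PG p Ki(1) by (intro mult_left_mono add_mono) auto
      also have "\<dots> \<le> L * G"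
      proof -
        have "0 \<le> (16 * Kb * P\<^sup>2 + 8 * Kb * P) * G" using Kb(1) P G by simp
        then show ?thesis unfolding L_def by (simp add: algebra_simps)
      qed
      finally show ?thesis using beta0_nonneg[OF e(1), of M N a b] by simp
    qed
    have mm: "\<bar>x * y\<bar> \<le> Kb * Z" if "\<bar>x\<bar> \<le> Kb" "\<bar>y\<bar> \<le> Z" for x y Z :: real
      unfolding abs_mult using that Kb(1) by (intro mult_mono) auto
    have 1: "\<bar>beta1 M N e a a1 b b1\<bar> \<le> L * G"
    proof -
      have "\<bar>beta1 M N e a a1 b b1\<bar> \<le> Kb * (2 * (P * G)) + Kb * (2 * (P * G))"
        unfolding beta1_def using ai PG Kb' by (intro order_trans[OF abs_triangle_ineq] add_mono mm) (auto simp: abs_mult)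
      also have "\<dots> \<le> L * G"
      proof -
        have "0 \<le> (Ki * (2 * P + P powr (1 - sg)) + 16 * Kb * P\<^sup>2 + 4 * Kb * P) * G"
          using Kb(1) Ki(1) P G by (intro mult_nonneg_nonneg add_nonneg_nonneg) auto
        then show ?thesis unfolding L_def by (simp add: algebra_simps)
      qed
      finally show ?thesis .
    qed
    have 2: "\<bar>beta2 M N e a a1 a2 b b1 b2\<bar> \<le> L * G"
    proof -
      have xy: "\<bar>(2 * inner_CN M a a1) * (2 * inner_CN N b b1)\<bar> \<le> 4 * (P\<^sup>2 * G)" "(2 * inner_CN M a a1)\<^sup>2 \<le> 4 * (P\<^sup>2 * G)" "(2 * inner_CN N b b1)\<^sup>2 \<le> 4 * (P\<^sup>2 * G)"
      proof -
        have *: "\<bar>x * y\<bar> \<le> P\<^sup>2 * G" if "\<bar>x\<bar> \<le> P * G\<^sup>2" "\<bar>y\<bar> \<le> P * G\<^sup>2" for x y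
        proof -
          have "\<bar>x * y\<bar> \<le> (P * G) * P" unfolding abs_mult using that PG P G by (intro mult_mono) auto
          then show ?thesis by (simp add: power2_eq_square mult_ac)
        qed
        show "\<bar>(2 * inner_CN M a a1) * (2 * inner_CN N b b1)\<bar> \<le> 4 * (P\<^sup>2 * G)"
          using *[OF ai(1,3)] by (simp add: abs_mult)
        show "(2 * inner_CN M a a1)\<^sup>2 \<le> 4 * (P\<^sup>2 * G)" "(2 * inner_CN N b b1)\<^sup>2 \<le> 4 * (P\<^sup>2 * G)"
          using *[OF ai(1,1)] *[OF ai(3,3)] by (simp_all add: power2_eq_square)
      qed
      have 3: "\<bar>2 * (norm2_CN M a1 + inner_CN M a a2)\<bar> \<le> 4 * (P * G)" "\<bar>2 * (norm2_CN N b1 + inner_CN N b b2)\<bar> \<le> 4 * (P * G)"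
        using ai PG norm2_CN_nonneg[of M a1] norm2_CN_nonneg[of N b1] by (auto simp: abs_le_iff)
      have t: "\<bar>x1 + 2 * x2 * p * r + x3 + x4 + x5\<bar> \<le> \<bar>x1\<bar> + 2 * \<bar>x2 * (p * r)\<bar> + \<bar>x3\<bar> + \<bar>x4\<bar> + \<bar>x5\<bar>" for x1 x2 x3 x4 x5 p r :: real
        by (simp add: mult.assoc)
      have "\<bar>beta2 M N e a a1 a2 b b1 b2\<bar> \<le> Kb * (4 * (P\<^sup>2 * G)) + 2 * (Kb * (4 * (P\<^sup>2 * G))) + Kb * (4 * (P\<^sup>2 * G))
          + Kb * (4 * (P * G)) + Kb * (4 * (P * G))"
        unfolding beta2_def using xy 3 Kb'
        by (intro order_trans[OF t] add_mono mult_left_mono mm) auto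
      also have "\<dots> \<le> L * G"
      proof -
        have "0 \<le> (Ki * (2 * P + P powr (1 - sg))) * G"
          using Ki(1) P G by (intro mult_nonneg_nonneg add_nonneg_nonneg) auto
        then show ?thesis unfolding L_def by (simp add: algebra_simps)
      qed
      finally show ?thesis .
    qed
    show ?thesis using 0 1 2 by blast
  qed
  moreover have "L \<ge> 0" unfolding L_def using Ki(1) Kb(1) P by (intro add_nonneg_nonneg mult_nonneg_nonneg) auto
  ultimately show ?thesis by blast
qed

end

section \<open>Finite Hermite sums\<close>

definition mode :: "nat \<Rightarrow> real \<Rightarrow> (nat \<Rightarrow> nat) \<Rightarrow> (nat \<Rightarrow> real) \<Rightarrow> real" where
  "mode n t \<alpha> x = exp (- t * sqrt (hermite_eigenvalue n \<alpha>)) * hermite_fun n \<alpha> x"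

definition mode1 :: "nat \<Rightarrow> nat \<Rightarrow> real \<Rightarrow> (nat \<Rightarrow> nat) \<Rightarrow> (nat \<Rightarrow> real) \<Rightarrow> real" where
  "mode1 n j t \<alpha> x = (if j = n then - sqrt (hermite_eigenvalue n \<alpha>) * mode n t \<alpha> x
     else exp (- t * sqrt (hermite_eigenvalue n \<alpha>)) * hermite_partial n j \<alpha> x)"

definition mode2 :: "nat \<Rightarrow> nat \<Rightarrow> real \<Rightarrow> (nat \<Rightarrow> nat) \<Rightarrow> (nat \<Rightarrow> real) \<Rightarrow> real" where
  "mode2 n j t \<alpha> x = (if j = n then hermite_eigenvalue n \<alpha> * mode n t \<alpha> x
     else exp (- t * sqrt (hermite_eigenvalue n \<alpha>)) * hermite_partial2 n j \<alpha> x)"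

lemma mode_deriv_t:
  "((\<lambda>t. mode n t \<alpha> x) has_real_derivative mode1 n n t \<alpha> x) (at t)"
  "((\<lambda>t. mode1 n n t \<alpha> x) has_real_derivative mode2 n n t \<alpha> x) (at t)"
proof -
  define l where "l = sqrt (hermite_eigenvalue n \<alpha>)"
  have l: "hermite_eigenvalue n \<alpha> = l * l" by (simp add: l_def hermite_eigenvalue_nonneg)
  show "((\<lambda>t. mode n t \<alpha> x) has_real_derivative mode1 n n t \<alpha> x) (at t)"
    unfolding mode_def mode1_def l_def[symmetric] by (auto intro!: derivative_eq_intros)
  show "((\<lambda>t. mode1 n n t \<alpha> x) has_real_derivative mode2 n n t \<alpha> x) (at t)"
    unfolding mode_def mode1_def mode2_def l_def[symmetric] l by (auto intro!: derivative_eq_intros)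
qed

lemma mode_deriv_x:
  assumes "j < n"
  shows "((\<lambda>s. mode n t \<alpha> (x(j := s))) has_real_derivative mode1 n j t \<alpha> (x(j := s))) (at s)"
    "((\<lambda>s. mode1 n j t \<alpha> (x(j := s))) has_real_derivative mode2 n j t \<alpha> (x(j := s))) (at s)"
  using assms unfolding mode_def mode1_def mode2_def
  by (auto intro!: DERIV_cmult has_real_derivative_hermite_fun has_real_derivative_hermite_partial simp del: fun_upd_apply)

lemma mode2_cont_t: "continuous_on UNIV (\<lambda>t. mode2 n n t \<alpha> x)"
  unfolding mode2_def mode_def by (auto intro!: continuous_intros)

lemma mode2_cont_x:
  assumes "j < n" shows "continuous_on UNIV (\<lambda>s. mode2 n j t \<alpha> (x(j := s)))"
proof -
  have "continuous_on UNIV (\<lambda>s. hermite_fun n \<alpha> (x(j := s)))"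
    using has_real_derivative_hermite_fun[OF assms]
    by (intro DERIV_continuous_on[where D = "\<lambda>s. hermite_partial n j \<alpha> (x(j := s))"]) auto
  then show ?thesis
    using assms unfolding mode2_def hermite_partial2_def by (auto intro!: continuous_intros)
qed

text \<open>The time variable is treated as direction \<open>n\<close>, so this is the equation \<open>(\<partial>\<^sub>t\<^sup>2 + \<Delta>) u = |x|\<^sup>2 u\<close>.\<close>

lemma sum_mode2: "(\<Sum>j\<le>n. mode2 n j t \<alpha> x) = (norm_Rn n x)\<^sup>2 * mode n t \<alpha> x"
proof -
  have "(\<Sum>j<n. mode2 n j t \<alpha> x) = (\<Sum>j<n. ((x j)\<^sup>2 - real (2 * \<alpha> j + 1)) * mode n t \<alpha> x)"
    by (intro sum.cong refl) (simp add: mode2_def mode_def hermite_partial2_def)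
  also have "\<dots> = (\<Sum>j<n. (x j)\<^sup>2 - real (2 * \<alpha> j + 1)) * mode n t \<alpha> x"
    by (rule sum_distrib_right[symmetric])
  also have "(\<Sum>j<n. (x j)\<^sup>2 - real (2 * \<alpha> j + 1)) = (norm_Rn n x)\<^sup>2 - hermite_eigenvalue n \<alpha>"
    by (simp add: hermite_eigenvalue_def norm_Rn_def L2_set_def sum_nonneg sum_subtractf sum.distrib sum_distrib_left)
  finally show ?thesis
    by (simp add: lessThan_Suc_atMost[symmetric] mode2_def algebra_simps)
qed

text \<open>For \<open>n \<ge> 1\<close> all eigenvalues are at least 1; this spectral gap is the
  source of the factor \<open>exp (- t)\<close>.\<close>

lemma mode_bounds:
  assumes "n \<ge> 1"
  shows "\<exists>K\<ge>0. \<forall>t\<ge>0. \<forall>x. \<bar>mode n t \<alpha> x\<bar> \<le> K * (exp (- t) * gauss n x) \<and>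
    (\<forall>j\<le>n. \<bar>mode1 n j t \<alpha> x\<bar> \<le> K * (exp (- t) * gauss n x) \<and> \<bar>mode2 n j t \<alpha> x\<bar> \<le> K * (exp (- t) * gauss n x))"
proof -
  define l where "l = sqrt (hermite_eigenvalue n \<alpha>)"
  have "hermite_eigenvalue n \<alpha> \<ge> 1" using hermite_eigenvalue_ge[of 0 n \<alpha>] assms by simp
  then have l1: "l \<ge> 1" unfolding l_def by simp
  have l2: "hermite_eigenvalue n \<alpha> = l * l" by (simp add: l_def hermite_eigenvalue_nonneg)
  obtain K0 where K0: "K0 \<ge> 0" "\<And>x. \<bar>hermite_fun n \<alpha> x\<bar> \<le> K0 * gauss n x"
    using hermite_fun_gauss_bound by metis
  obtain K1 where K1: "\<And>j. j < n \<Longrightarrow> K1 j \<ge> 0" "\<And>j x. j < n \<Longrightarrow> \<bar>hermite_partial n j \<alpha> x\<bar> \<le> K1 j * gauss n x"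
    using hermite_partial_gauss_bound[of _ n \<alpha>] by metis
  obtain K2 where K2: "\<And>j. j < n \<Longrightarrow> K2 j \<ge> 0" "\<And>j x. j < n \<Longrightarrow> \<bar>hermite_partial2 n j \<alpha> x\<bar> \<le> K2 j * gauss n x"
    using hermite_partial2_gauss_bound[of _ n \<alpha>] by metis
  define K where "K = l * l * K0 + (\<Sum>j<n. K1 j) + (\<Sum>j<n. K2 j)"
  have s: "(\<Sum>j<n. K1 j) \<ge> 0" "(\<Sum>j<n. K2 j) \<ge> 0" using K1(1) K2(1) by (auto intro!: sum_nonneg)
  have m: "j < n \<Longrightarrow> K1 j \<le> (\<Sum>j<n. K1 j)" "j < n \<Longrightarrow> K2 j \<le> (\<Sum>j<n. K2 j)" for j
    using K1(1) K2(1) by (auto intro!: member_le_sum)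
  have l3: "1 * 1 \<le> l * l" "l * 1 \<le> l * l" using l1 by (intro mult_mono; simp)+
  have l4: "K0 \<le> l * l * K0" "l * K0 \<le> l * l * K0" using mult_right_mono[OF l3(1) K0(1)] mult_right_mono[OF l3(2) K0(1)] by auto
  have "K0 \<le> K" "l * K0 \<le> K" "l * l * K0 \<le> K"
    unfolding K_def using s l4 K0(1) by linarith+
  moreover have "K1 j \<le> K" "K2 j \<le> K" if "j < n" for j
    unfolding K_def using s m[OF that] l4 K0(1) by linarith+
  ultimately have KK: "K0 \<le> K" "l * K0 \<le> K" "l * l * K0 \<le> K" "j < n \<Longrightarrow> K1 j \<le> K" "j < n \<Longrightarrow> K2 j \<le> K" for j
    by blast+
  have b: "\<bar>exp (- t * l) * h\<bar> \<le> C * (exp (- t) * gauss n x)"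
    if "t \<ge> 0" "\<bar>h\<bar> \<le> C' * gauss n x" "C' \<le> C" "C' \<ge> 0" for t h C C' x
  proof -
    have "\<bar>exp (- t * l) * h\<bar> \<le> exp (- t) * (C' * gauss n x)"
      unfolding abs_mult using that l1 by (intro mult_mono) (auto simp: mult_le_cancel_left1)
    also have "\<dots> \<le> exp (- t) * (C * gauss n x)"
      using that gauss_pos[of n x] by (intro mult_left_mono mult_right_mono) auto
    finally show ?thesis by (simp add: mult_ac)
  qed
  have g: "gauss n x \<ge> 0" for x using gauss_pos[of n x] by simp
  show ?thesis
  proof (intro exI[of _ K] conjI allI impI)
    show "K \<ge> 0" using KK(1) K0(1) by simp
    fix t :: real and x assume t: "t \<ge> 0"
    show "\<bar>mode n t \<alpha> x\<bar> \<le> K * (exp (- t) * gauss n x)"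
      unfolding mode_def l_def[symmetric] by (rule b[OF t K0(2) KK(1) K0(1)])
    fix j assume j: "j \<le> n"
    show "\<bar>mode1 n j t \<alpha> x\<bar> \<le> K * (exp (- t) * gauss n x)"
    proof (cases "j = n")
      case True
      have "\<bar>exp (- t * l) * (- l * hermite_fun n \<alpha> x)\<bar> \<le> K * (exp (- t) * gauss n x)"
        using mult_left_mono[OF K0(2)[of x], of l] l1 K0(1) by (intro b[OF t _ KK(2)]) (auto simp: abs_mult mult_ac)
      then show ?thesis using True by (simp add: mode1_def mode_def l_def[symmetric] mult_ac)
    next
      case False
      then have "j < n" using j by simp
      then show ?thesis unfolding mode1_def l_def[symmetric] using False b[OF t K1(2)[of j x] KK(4)[of j] K1(1)[of j]] by simp
    qed
    show "\<bar>mode2 n j t \<alpha> x\<bar> \<le> K * (exp (- t) * gauss n x)"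
    proof (cases "j = n")
      case True
      have "\<bar>exp (- t * l) * (l * l * hermite_fun n \<alpha> x)\<bar> \<le> K * (exp (- t) * gauss n x)"
        using mult_left_mono[OF K0(2)[of x], of "l * l"] l1 K0(1) by (intro b[OF t _ KK(3)]) (auto simp: abs_mult mult_ac)
      then show ?thesis unfolding mode2_def mode_def unfolding l_def[symmetric] unfolding l2
        using True by (simp add: mult_ac)
    next
      case False
      then have "j < n" using j by simp
      then show ?thesis unfolding mode2_def l_def[symmetric] using False b[OF t K2(2)[of j x] KK(5)[of j] K2(1)[of j]] by simp
    qed
  qed
qed

lemma measurable_hermite_partial2 [measurable]:
  "j < n \<Longrightarrow> hermite_partial2 n j \<alpha> \<in> borel_measurable (lebesgue_Rn n)"
proof -
  assume j: "j < n"
  have [measurable]: "(\<lambda>x. x j) \<in> borel_measurable (lebesgue_Rn n)"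
    unfolding lebesgue_Rn_def using j measurable_component_singleton[of j "{..<n}" "\<lambda>_. lborel"] by simp
  show ?thesis unfolding hermite_partial2_def[abs_def] by measurable
qed

lemma measurable_mode:
  assumes "j \<le> n"
  shows "(\<lambda>z. mode n (fst z) \<alpha> (snd z)) \<in> borel_measurable (borel \<Otimes>\<^sub>M lebesgue_Rn n)"
    "(\<lambda>z. mode1 n j (fst z) \<alpha> (snd z)) \<in> borel_measurable (borel \<Otimes>\<^sub>M lebesgue_Rn n)"
    "(\<lambda>z. mode2 n j (fst z) \<alpha> (snd z)) \<in> borel_measurable (borel \<Otimes>\<^sub>M lebesgue_Rn n)"
proof -
  have [measurable]: "hermite_partial n j \<alpha> \<in> borel_measurable (lebesgue_Rn n)"
    "hermite_partial2 n j \<alpha> \<in> borel_measurable (lebesgue_Rn n)" if "j \<noteq> n"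
    using that assms by auto
  show "(\<lambda>z. mode n (fst z) \<alpha> (snd z)) \<in> borel_measurable (borel \<Otimes>\<^sub>M lebesgue_Rn n)"
    "(\<lambda>z. mode1 n j (fst z) \<alpha> (snd z)) \<in> borel_measurable (borel \<Otimes>\<^sub>M lebesgue_Rn n)"
    "(\<lambda>z. mode2 n j (fst z) \<alpha> (snd z)) \<in> borel_measurable (borel \<Otimes>\<^sub>M lebesgue_Rn n)"
    unfolding mode_def mode1_def mode2_def by (cases "j = n"; simp)+
qed

text \<open>The scalar family \<phi> is an argument, so that an extension and all its derivatives
  are the same linear expression in different families, and derivatives pass to the family.\<close>

definition mode_sum :: "(nat \<Rightarrow> nat) set \<Rightarrow> ((nat \<Rightarrow> nat) \<Rightarrow> complex) \<Rightarrow> ((nat \<Rightarrow> nat) \<Rightarrow> real) \<Rightarrow> complex" where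
  "mode_sum A c \<phi> = (\<Sum>\<alpha>\<in>A. c \<alpha> * of_real (\<phi> \<alpha>))"

lemma mode_sum_deriv:
  assumes "\<And>\<alpha>. ((\<lambda>s. \<phi> s \<alpha>) has_real_derivative \<phi>' \<alpha>) (at s)"
  shows "((\<lambda>s. mode_sum A c (\<phi> s)) has_vector_derivative mode_sum A c \<phi>') (at s)"
  unfolding mode_sum_def
  by (intro has_vector_derivative_sum has_vector_derivative_mult_right has_vector_derivative_of_real assms)

lemma mode_sum_continuous:
  assumes "\<And>\<alpha>. continuous_on S (\<lambda>s. \<phi> s \<alpha>)"
  shows "continuous_on S (\<lambda>s. mode_sum A c (\<phi> s))"
  unfolding mode_sum_def by (intro continuous_intros assms)

lemma mode_sum_measurable:
  assumes "\<And>\<alpha>. (\<lambda>s. \<phi> s \<alpha>) \<in> borel_measurable Q"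
  shows "(\<lambda>s. mode_sum A c (\<phi> s)) \<in> borel_measurable Q"
  unfolding mode_sum_def by (intro borel_measurable_sum borel_measurable_times borel_measurable_const
      measurable_compose[OF assms borel_measurable_of_real])

lemma mode_sum_sum: "(\<Sum>j\<in>S. mode_sum A c (\<phi> j)) = mode_sum A c (\<lambda>\<alpha>. \<Sum>j\<in>S. \<phi> j \<alpha>)"
  unfolding mode_sum_def by (subst sum.swap) (simp add: sum_distrib_left)

lemma mode_sum_cmult: "mode_sum A c (\<lambda>\<alpha>. r * \<phi> \<alpha>) = of_real r * mode_sum A c \<phi>"
  unfolding mode_sum_def by (simp add: sum_distrib_left mult_ac)

lemma mode_sum_bound:
  assumes "\<And>\<alpha>. \<bar>\<phi> \<alpha>\<bar> \<le> K \<alpha> * G"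
  shows "cmod (mode_sum A c \<phi>) \<le> (\<Sum>\<alpha>\<in>A. cmod (c \<alpha>) * K \<alpha>) * G"
proof -
  have "cmod (mode_sum A c \<phi>) \<le> (\<Sum>\<alpha>\<in>A. cmod (c \<alpha>) * \<bar>\<phi> \<alpha>\<bar>)"
    unfolding mode_sum_def by (rule order_trans[OF norm_sum]) (simp add: norm_mult)
  also have "\<dots> \<le> (\<Sum>\<alpha>\<in>A. cmod (c \<alpha>) * (K \<alpha> * G))"
    by (intro sum_mono mult_left_mono assms) auto
  finally show ?thesis by (simp add: sum_distrib_right mult.assoc)
qed

lemma hermite_series_finite:
  assumes "finite A"
  shows "hermite_series n A c t x = mode_sum A c (\<lambda>\<alpha>. mode n t \<alpha> x)"
    "hermite_series_t n A c t x = mode_sum A c (\<lambda>\<alpha>. mode1 n n t \<alpha> x)"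
    "j < n \<Longrightarrow> hermite_series_x n j A c t x = mode_sum A c (\<lambda>\<alpha>. mode1 n j t \<alpha> x)"
  using assms unfolding hermite_series_def hermite_series_t_def hermite_series_x_def mode_sum_def
  by (auto intro!: sum.cong simp: mode_def mode1_def)

lemma star_series_finite:
  assumes "finite A"
  shows "star_series n N A c x t = sqrt ((\<Sum>j\<le>n. norm2_CN N (\<lambda>i. mode_sum A (c i) (\<lambda>\<alpha>. mode1 n j t \<alpha> x)))
    + (norm_Rn n x)\<^sup>2 * norm2_CN N (\<lambda>i. mode_sum A (c i) (\<lambda>\<alpha>. mode n t \<alpha> x)))"
proof -
  have "(\<Sum>j<n. (norm_CN N (\<lambda>i. hermite_series_x n j A (c i) t x))\<^sup>2) = (\<Sum>j<n. norm2_CN N (\<lambda>i. mode_sum A (c i) (\<lambda>\<alpha>. mode1 n j t \<alpha> x)))"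
    by (intro sum.cong refl) (simp add: hermite_series_finite[OF assms] norm_CN_sq)
  then show ?thesis
    unfolding star_series_def
    by (simp add: norm_CN_sq hermite_series_finite[OF assms] lessThan_Suc_atMost[symmetric] add.commute)
qed

lemma mode_sum_modes_bounds:
  fixes N :: nat
  assumes "n \<ge> 1"
  shows "\<exists>K\<ge>0. \<forall>t\<ge>0. \<forall>x. \<forall>i<N. cmod (mode_sum A (c i) (\<lambda>\<alpha>. mode n t \<alpha> x)) \<le> K * (exp (- t) * gauss n x) \<and>
    (\<forall>j\<le>n. cmod (mode_sum A (c i) (\<lambda>\<alpha>. mode1 n j t \<alpha> x)) \<le> K * (exp (- t) * gauss n x)
        \<and> cmod (mode_sum A (c i) (\<lambda>\<alpha>. mode2 n j t \<alpha> x)) \<le> K * (exp (- t) * gauss n x))"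
proof -
  obtain K where K: "\<And>\<alpha>. K \<alpha> \<ge> 0" "\<And>\<alpha> t x. t \<ge> 0 \<Longrightarrow> \<bar>mode n t \<alpha> x\<bar> \<le> K \<alpha> * (exp (- t) * gauss n x)"
    "\<And>\<alpha> t x j. t \<ge> 0 \<Longrightarrow> j \<le> n \<Longrightarrow> \<bar>mode1 n j t \<alpha> x\<bar> \<le> K \<alpha> * (exp (- t) * gauss n x)"
    "\<And>\<alpha> t x j. t \<ge> 0 \<Longrightarrow> j \<le> n \<Longrightarrow> \<bar>mode2 n j t \<alpha> x\<bar> \<le> K \<alpha> * (exp (- t) * gauss n x)"
    using mode_bounds[OF assms] by metis
  define k where "k i = (\<Sum>\<alpha>\<in>A. cmod (c i \<alpha>) * K \<alpha>)" for i
  have k0: "k i \<ge> 0" for i unfolding k_def using K(1) by (intro sum_nonneg mult_nonneg_nonneg) auto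
  have kle: "k i \<le> (\<Sum>i<N. k i)" if "i < N" for i using that k0 by (intro member_le_sum) auto
  have up: "y \<le> (\<Sum>i<N. k i) * (exp (- t) * gauss n x)" if "y \<le> k i * (exp (- t) * gauss n x)" "i < N" for i y t x
  proof -
    have "k i * (exp (- t) * gauss n x) \<le> (\<Sum>i<N. k i) * (exp (- t) * gauss n x)"
      using that gauss_pos[of n x] by (intro mult_right_mono kle) auto
    then show ?thesis using that by linarith
  qed
  show ?thesis
  proof (intro exI[of _ "\<Sum>i<N. k i"] conjI allI impI)
    show "0 \<le> (\<Sum>i<N. k i)" by (intro sum_nonneg k0)
    fix t :: real and x and i :: nat assume t: "0 \<le> t" and i: "i < N"
    show "cmod (mode_sum A (c i) (\<lambda>\<alpha>. mode n t \<alpha> x)) \<le> (\<Sum>i<N. k i) * (exp (- t) * gauss n x)"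
      by (rule up[OF _ i], unfold k_def, rule mode_sum_bound, rule K(2)[OF t])
    fix j assume j: "j \<le> n"
    show "cmod (mode_sum A (c i) (\<lambda>\<alpha>. mode1 n j t \<alpha> x)) \<le> (\<Sum>i<N. k i) * (exp (- t) * gauss n x)"
      by (rule up[OF _ i], unfold k_def, rule mode_sum_bound, rule K(3)[OF t j])
    show "cmod (mode_sum A (c i) (\<lambda>\<alpha>. mode2 n j t \<alpha> x)) \<le> (\<Sum>i<N. k i) * (exp (- t) * gauss n x)"
      by (rule up[OF _ i], unfold k_def, rule mode_sum_bound, rule K(4)[OF t j])
  qed
qed

section \<open>The estimate for finite sums with a shift\<close>

context bellman
begin

text \<open>The product of star norms is pointwise at most \<open>3 * m\<close> times the full
  Laplacian \<open>F2\<close> of \<open>F0\<close>, whose weighted integral is the value at time 0,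
  where each extension is the Hermite sum itself.\<close>

lemma finite_estimate_eps:
  assumes n: "n \<ge> 1" and A: "finite A" and A': "finite A'" and e: "0 < e" "e \<le> 1"
  shows "(\<integral>\<^sup>+t\<in>{0<..}. ((\<integral>\<^sup>+x. ennreal (star_series n M A c x t * star_series n N A' d x t) \<partial>lebesgue_Rn n) * ennreal t) \<partial>lborel)
    \<le> ennreal (3 * m * (\<integral>x. beta0 M N e (\<lambda>i. hermite_sum n A (c i) x) (\<lambda>i. hermite_sum n A' (d i) x) \<partial>lebesgue_Rn n))"
proof -
  define u where "u t x i = mode_sum A (c i) (\<lambda>\<alpha>. mode n t \<alpha> x)" for t x i
  define u1 where "u1 j t x i = mode_sum A (c i) (\<lambda>\<alpha>. mode1 n j t \<alpha> x)" for j t x i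
  define u2 where "u2 j t x i = mode_sum A (c i) (\<lambda>\<alpha>. mode2 n j t \<alpha> x)" for j t x i
  define v where "v t x i = mode_sum A' (d i) (\<lambda>\<alpha>. mode n t \<alpha> x)" for t x i
  define v1 where "v1 j t x i = mode_sum A' (d i) (\<lambda>\<alpha>. mode1 n j t \<alpha> x)" for j t x i
  define v2 where "v2 j t x i = mode_sum A' (d i) (\<lambda>\<alpha>. mode2 n j t \<alpha> x)" for j t x i
  define F0 where "F0 t x = beta0 M N e (u t x) (v t x)" for t x
  define F1 where "F1 j t x = beta1 M N e (u t x) (u1 j t x) (v t x) (v1 j t x)" for j t x
  define F2 where "F2 j t x = beta2 M N e (u t x) (u1 j t x) (u2 j t x) (v t x) (v1 j t x) (v2 j t x)" for j t x
  have ut: "((\<lambda>t. u t x i) has_vector_derivative u1 n t x i) (at t)" "((\<lambda>t. v t x i) has_vector_derivative v1 n t x i) (at t)"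
    "((\<lambda>t. u1 n t x i) has_vector_derivative u2 n t x i) (at t)" "((\<lambda>t. v1 n t x i) has_vector_derivative v2 n t x i) (at t)" for t x i
    unfolding u_def u1_def u2_def v_def v1_def v2_def by (intro mode_sum_deriv mode_deriv_t)+
  have ux: "((\<lambda>s. u t (x(j := s)) i) has_vector_derivative u1 j t (x(j := s)) i) (at s)" "((\<lambda>s. v t (x(j := s)) i) has_vector_derivative v1 j t (x(j := s)) i) (at s)"
    "((\<lambda>s. u1 j t (x(j := s)) i) has_vector_derivative u2 j t (x(j := s)) i) (at s)" "((\<lambda>s. v1 j t (x(j := s)) i) has_vector_derivative v2 j t (x(j := s)) i) (at s)" if "j < n" for t x i j s
    unfolding u_def u1_def u2_def v_def v1_def v2_def by (intro mode_sum_deriv mode_deriv_x that)+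
  have vc: "continuous_on UNIV f" if "\<And>s. (f has_vector_derivative f' s) (at s)" for f :: "real \<Rightarrow> complex" and f'
    using that by (meson continuous_at_imp_continuous_on has_vector_derivative_continuous)
  obtain K1 where K1: "K1 \<ge> 0" "\<And>t x i. t \<ge> 0 \<Longrightarrow> i < M \<Longrightarrow> cmod (u t x i) \<le> K1 * (exp (- t) * gauss n x)"
    "\<And>t x i j. t \<ge> 0 \<Longrightarrow> i < M \<Longrightarrow> j \<le> n \<Longrightarrow> cmod (u1 j t x i) \<le> K1 * (exp (- t) * gauss n x)"
    "\<And>t x i j. t \<ge> 0 \<Longrightarrow> i < M \<Longrightarrow> j \<le> n \<Longrightarrow> cmod (u2 j t x i) \<le> K1 * (exp (- t) * gauss n x)"
    using mode_sum_modes_bounds[OF n, of M A c] unfolding u_def u1_def u2_def by blast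
  obtain K2 where K2: "K2 \<ge> 0" "\<And>t x i. t \<ge> 0 \<Longrightarrow> i < N \<Longrightarrow> cmod (v t x i) \<le> K2 * (exp (- t) * gauss n x)"
    "\<And>t x i j. t \<ge> 0 \<Longrightarrow> i < N \<Longrightarrow> j \<le> n \<Longrightarrow> cmod (v1 j t x i) \<le> K2 * (exp (- t) * gauss n x)"
    "\<And>t x i j. t \<ge> 0 \<Longrightarrow> i < N \<Longrightarrow> j \<le> n \<Longrightarrow> cmod (v2 j t x i) \<le> K2 * (exp (- t) * gauss n x)"
    using mode_sum_modes_bounds[OF n, of N A' d] unfolding v_def v1_def v2_def by blast
  define K where "K = max K1 K2"
  have K: "K \<ge> 0" using K1(1) by (simp add: K_def)
  have up: "y \<le> K * (exp (- t) * gauss n x)" if "y \<le> K1 * (exp (- t) * gauss n x) \<or> y \<le> K2 * (exp (- t) * gauss n x)" for y t x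
  proof -
    have g: "exp (- t) * gauss n x \<ge> 0" using gauss_pos[of n x] by simp
    have "K1 * (exp (- t) * gauss n x) \<le> K * (exp (- t) * gauss n x)" "K2 * (exp (- t) * gauss n x) \<le> K * (exp (- t) * gauss n x)"
      by (intro mult_right_mono g; simp add: K_def)+
    then show ?thesis using that by linarith
  qed
  obtain L where L: "L \<ge> 0" "\<forall>a a1 a2 b b1 b2 G. 0 \<le> G \<longrightarrow> G \<le> 1 \<longrightarrow>
     (\<forall>i<M. cmod (a i) \<le> K * G \<and> cmod (a1 i) \<le> K * G \<and> cmod (a2 i) \<le> K * G) \<longrightarrow>
     (\<forall>i<N. cmod (b i) \<le> K * G \<and> cmod (b1 i) \<le> K * G \<and> cmod (b2 i) \<le> K * G) \<longrightarrow>
     \<bar>beta0 M N e a b\<bar> \<le> L * G \<and> \<bar>beta1 M N e a a1 b b1\<bar> \<le> L * G \<and> \<bar>beta2 M N e a a1 a2 b b1 b2\<bar> \<le> L * G"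
    using beta_bounds[OF e K, of M N] by blast
  have Fb: "\<bar>F0 t x\<bar> \<le> L * (exp (- t) * gauss n x) \<and> \<bar>F1 j t x\<bar> \<le> L * (exp (- t) * gauss n x) \<and> \<bar>F2 j t x\<bar> \<le> L * (exp (- t) * gauss n x)"
    if t: "t \<ge> 0" and j: "j \<le> n" for t x j
    unfolding F0_def F1_def F2_def
  proof (rule L(2)[rule_format])
    show "0 \<le> exp (- t) * gauss n x" using gauss_pos[of n x] by simp
    have "exp (- t) * gauss n x \<le> 1 * 1" using t gauss_le_1[of n x] gauss_pos[of n x] by (intro mult_mono) auto
    then show "exp (- t) * gauss n x \<le> 1" by simp
  qed (use t j K1 K2 in \<open>auto intro!: up\<close>)
  have lower: "star_series n M A c x t * star_series n N A' d x t \<le> 3 * m * (\<Sum>j\<le>n. F2 j t x)" for t x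
  proof -
    have su: "(\<Sum>j\<le>n. u2 j t x i) = of_real ((norm_Rn n x)\<^sup>2) * u t x i" for i
      unfolding u2_def u_def mode_sum_sum sum_mode2 mode_sum_cmult ..
    have sv: "(\<Sum>j\<le>n. v2 j t x i) = of_real ((norm_Rn n x)\<^sup>2) * v t x i" for i
      unfolding v2_def v_def mode_sum_sum sum_mode2 mode_sum_cmult ..
    have "sqrt ((\<Sum>j\<le>n. norm2_CN M (u1 j t x)) + (norm_Rn n x)\<^sup>2 * norm2_CN M (u t x)) * sqrt ((\<Sum>j\<le>n. norm2_CN N (v1 j t x)) + (norm_Rn n x)\<^sup>2 * norm2_CN N (v t x)) / (3 * m)
      \<le> (\<Sum>j\<le>n. F2 j t x)"
      unfolding F2_def by (intro beta2_sum_lower e su sv) simp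
    then have "star_series n M A c x t * star_series n N A' d x t / (3 * m) \<le> (\<Sum>j\<le>n. F2 j t x)"
      unfolding star_series_finite[OF A] star_series_finite[OF A'] u_def u1_def v_def v1_def .
    then show ?thesis using m by (simp add: field_simps)
  qed
  have pos: "0 \<le> (\<Sum>j\<le>n. F2 j t x)" for t x
  proof -
    have "0 \<le> star_series n M A c x t * star_series n N A' d x t"
      unfolding star_series_finite[OF A] star_series_finite[OF A']
      by (intro mult_nonneg_nonneg real_sqrt_ge_zero add_nonneg_nonneg sum_nonneg norm2_CN_nonneg) auto
    then have "0 \<le> 3 * m * (\<Sum>j\<le>n. F2 j t x)" using lower[of x t] by linarith
    then show ?thesis using m by (simp add: zero_le_mult_iff)
  qed
  have meas: "(\<lambda>z. F2 j (fst z) (snd z)) \<in> borel_measurable (borel \<Otimes>\<^sub>M lebesgue_Rn n)" if "j \<le> n" for j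
    unfolding F2_def u_def u1_def u2_def v_def v1_def v2_def
    by (intro measurable_beta mode_sum_measurable measurable_mode[OF that])
  have "(\<integral>\<^sup>+t\<in>{0<..}. ((\<integral>\<^sup>+x. ennreal (\<Sum>j\<le>n. F2 j t x) \<partial>lebesgue_Rn n) * ennreal t) \<partial>lborel)
    = ennreal (\<integral>x. F0 0 x \<partial>lebesgue_Rn n)"
  proof (rule nn_integral_t_laplacian[where ?F1.0 = F1 and K = L])
    show "((\<lambda>t. F0 t x) has_real_derivative F1 n t x) (at t)" for t x
      unfolding F0_def F1_def by (intro DERIV_beta0 e ut)
    show "((\<lambda>t. F1 n t x) has_real_derivative F2 n t x) (at t)" for t x
      unfolding F1_def F2_def by (intro DERIV_beta1 e ut)
    show "((\<lambda>s. F1 j t (x(j := s))) has_real_derivative F2 j t (x(j := s))) (at s)" if "j < n" for j t x s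
      unfolding F1_def F2_def by (intro DERIV_beta1 e ux that)
    show "continuous_on UNIV (\<lambda>t. F2 n t x)" for x
    proof -
      have "continuous_on UNIV (\<lambda>t. u2 n t x i)" "continuous_on UNIV (\<lambda>t. v2 n t x i)" for i
        unfolding u2_def v2_def by (intro mode_sum_continuous mode2_cont_t)+
      then show ?thesis unfolding F2_def by (intro continuous_on_beta2 e vc[OF ut(1)] vc[OF ut(2)] vc[OF ut(3)] vc[OF ut(4)])
    qed
    show "continuous_on UNIV (\<lambda>s. F2 j t (x(j := s)))" if "j < n" for j t x
    proof -
      have "continuous_on UNIV (\<lambda>s. u2 j t (x(j := s)) i)" "continuous_on UNIV (\<lambda>s. v2 j t (x(j := s)) i)" for i
        unfolding u2_def v2_def by (intro mode_sum_continuous mode2_cont_x that)+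
      then show ?thesis unfolding F2_def
        by (intro continuous_on_beta2 e vc[OF ux(1)[OF that]] vc[OF ux(2)[OF that]] vc[OF ux(3)[OF that]] vc[OF ux(4)[OF that]])
    qed
  qed (use Fb pos meas in blast)+
  moreover have "(\<integral>\<^sup>+t\<in>{0<..}. ((\<integral>\<^sup>+x. ennreal (star_series n M A c x t * star_series n N A' d x t) \<partial>lebesgue_Rn n) * ennreal t) \<partial>lborel)
    \<le> (\<integral>\<^sup>+t\<in>{0<..}. (ennreal (3 * m) * (\<integral>\<^sup>+x. ennreal (\<Sum>j\<le>n. F2 j t x) \<partial>lebesgue_Rn n) * ennreal t) \<partial>lborel)"
  proof (intro nn_integral_mono mult_right_mono)
    fix t
    have [measurable]: "F2 j t \<in> borel_measurable (lebesgue_Rn n)" if "j \<le> n" for j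
      using measurable_compose[OF measurable_Pair1' meas[OF that], of t] by simp
    have "(\<integral>\<^sup>+x. ennreal (star_series n M A c x t * star_series n N A' d x t) \<partial>lebesgue_Rn n)
       \<le> (\<integral>\<^sup>+x. ennreal (3 * m) * ennreal (\<Sum>j\<le>n. F2 j t x) \<partial>lebesgue_Rn n)"
      using m by (intro nn_integral_mono) (simp add: ennreal_mult[symmetric] pos ennreal_leI lower)
    also have "\<dots> = ennreal (3 * m) * (\<integral>\<^sup>+x. ennreal (\<Sum>j\<le>n. F2 j t x) \<partial>lebesgue_Rn n)"
      by (intro nn_integral_cmult) simp
    finally show "(\<integral>\<^sup>+x. ennreal (star_series n M A c x t * star_series n N A' d x t) \<partial>lebesgue_Rn n)
      \<le> ennreal (3 * m) * (\<integral>\<^sup>+x. ennreal (\<Sum>j\<le>n. F2 j t x) \<partial>lebesgue_Rn n)" .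
  qed auto
  moreover have "(\<integral>\<^sup>+t\<in>{0<..}. (ennreal (3 * m) * (\<integral>\<^sup>+x. ennreal (\<Sum>j\<le>n. F2 j t x) \<partial>lebesgue_Rn n) * ennreal t) \<partial>lborel)
    = ennreal (3 * m) * (\<integral>\<^sup>+t\<in>{0<..}. ((\<integral>\<^sup>+x. ennreal (\<Sum>j\<le>n. F2 j t x) \<partial>lebesgue_Rn n) * ennreal t) \<partial>lborel)"
  proof -
    interpret L: sigma_finite_measure "lebesgue_Rn n" by (rule sigma_finite_lebesgue_Rn)
    have "(\<lambda>z. \<Sum>j\<le>n. F2 j (fst z) (snd z)) \<in> borel_measurable (lborel \<Otimes>\<^sub>M lebesgue_Rn n)"
      using meas by (intro borel_measurable_sum) (simp cong: measurable_cong_sets)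
    then have [measurable]: "(\<lambda>t. \<integral>\<^sup>+x. ennreal (\<Sum>j\<le>n. F2 j t x) \<partial>lebesgue_Rn n) \<in> borel_measurable lborel"
      by (intro L.borel_measurable_nn_integral) (simp add: case_prod_beta)
    show ?thesis by (subst nn_integral_cmult[symmetric]) (auto simp: mult_ac)
  qed
  moreover have "F0 0 x = beta0 M N e (\<lambda>i. hermite_sum n A (c i) x) (\<lambda>i. hermite_sum n A' (d i) x)" for x
    unfolding F0_def u_def[abs_def] v_def[abs_def] hermite_sum_def mode_sum_def mode_def by simp
  moreover have "ennreal (3 * m * r) = ennreal (3 * m) * ennreal r" for r using m by (simp add: ennreal_mult')
  ultimately show ?thesis by simp
qed

end

section \<open>Density of the finite Hermite sums\<close>

text \<open>Closure of \<open>H\<close> in the supremum norm of the quotient by \<open>w\<close>. It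
  is used on the line and in n variables.\<close>

definition weighted_closure :: "(('a \<Rightarrow> complex) \<Rightarrow> bool) \<Rightarrow> 'a set \<Rightarrow> ('a \<Rightarrow> real) \<Rightarrow> ('a \<Rightarrow> complex) \<Rightarrow> bool" where
  "weighted_closure H X w f \<longleftrightarrow> (\<forall>e>0. \<exists>g. H g \<and> (\<forall>x\<in>X. cmod (g x - f x) \<le> e * w x))"

lemma weighted_closureE:
  assumes "weighted_closure H X w f" "e > 0"
  obtains g where "H g" "\<And>x. x \<in> X \<Longrightarrow> cmod (g x - f x) \<le> e * w x"
  using assms unfolding weighted_closure_def by blast

lemma weighted_closure_cmult:
  assumes H: "\<And>f. H f \<Longrightarrow> H (\<lambda>x. a * f x)" and w: "\<And>x. w x \<ge> 0" and f: "weighted_closure H X w f"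
  shows "weighted_closure H X w (\<lambda>x. a * f x)"
  unfolding weighted_closure_def
proof (intro allI impI)
  fix e :: real assume e: "e > 0"
  define d where "d = e / (cmod a + 1)"
  have "cmod a + 1 > 0" by (simp add: add_nonneg_pos)
  then have d: "d > 0" "cmod a * d \<le> e"
    using e by (simp_all add: d_def field_simps)
  obtain g where g: "H g" "\<And>x. x \<in> X \<Longrightarrow> cmod (g x - f x) \<le> d * w x"
    using weighted_closureE[OF f d(1)] by blast
  have "cmod (a * g x - a * f x) \<le> e * w x" if "x \<in> X" for x
  proof -
    have "cmod (a * g x - a * f x) = cmod a * cmod (g x - f x)" by (simp add: norm_mult flip: right_diff_distrib)
    also have "\<dots> \<le> cmod a * (d * w x)" by (intro mult_left_mono g that) auto
    also have "\<dots> \<le> e * w x" using mult_right_mono[OF d(2) w[of x]] by (simp add: mult.assoc)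
    finally show ?thesis .
  qed
  then show "\<exists>g. H g \<and> (\<forall>x\<in>X. cmod (g x - a * f x) \<le> e * w x)"
    using H[OF g(1)] by blast
qed

lemma weighted_closure_add:
  assumes H: "\<And>f g. H f \<Longrightarrow> H g \<Longrightarrow> H (\<lambda>x. f x + g x)"
    and f: "weighted_closure H X w f" and g: "weighted_closure H X w g"
  shows "weighted_closure H X w (\<lambda>x. f x + g x)"
  unfolding weighted_closure_def
proof (intro allI impI)
  fix e :: real assume e: "e > 0"
  obtain f' where f': "H f'" "\<And>x. x \<in> X \<Longrightarrow> cmod (f' x - f x) \<le> (e / 2) * w x"
    using weighted_closureE[OF f half_gt_zero[OF e]] by blast
  obtain g' where g': "H g'" "\<And>x. x \<in> X \<Longrightarrow> cmod (g' x - g x) \<le> (e / 2) * w x"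
    using weighted_closureE[OF g half_gt_zero[OF e]] by blast
  have "cmod ((f' x + g' x) - (f x + g x)) \<le> e * w x" if "x \<in> X" for x
    using norm_diff_triangle_ineq[of "f' x" "g' x" "f x" "g x"] f'(2)[OF that] g'(2)[OF that] by simp
  then show "\<exists>h. H h \<and> (\<forall>x\<in>X. cmod (h x - (f x + g x)) \<le> e * w x)"
    using H[OF f'(1) g'(1)] by blast
qed

lemma weighted_closure_limit:
  assumes "\<And>e. e > 0 \<Longrightarrow> \<exists>g. weighted_closure H X w g \<and> (\<forall>x\<in>X. cmod (g x - f x) \<le> e * w x)"
  shows "weighted_closure H X w f"
  unfolding weighted_closure_def
proof (intro allI impI)
  fix e :: real assume e: "e > 0"
  obtain g where g: "weighted_closure H X w g" "\<And>x. x \<in> X \<Longrightarrow> cmod (g x - f x) \<le> (e / 2) * w x"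
    using assms[OF half_gt_zero[OF e]] by blast
  obtain h where h: "H h" "\<And>x. x \<in> X \<Longrightarrow> cmod (h x - g x) \<le> (e / 2) * w x"
    using weighted_closureE[OF g(1) half_gt_zero[OF e]] by blast
  have "cmod (h x - f x) \<le> e * w x" if "x \<in> X" for x
    using norm_triangle_ineq[of "h x - g x" "g x - f x"] g(2)[OF that] h(2)[OF that] by simp
  then show "\<exists>g. H g \<and> (\<forall>x\<in>X. cmod (g x - f x) \<le> e * w x)" using h(1) by blast
qed

section \<open>Density in one variable\<close>

definition hermite_span1 :: "(real \<Rightarrow> complex) \<Rightarrow> bool" where
  "hermite_span1 f \<longleftrightarrow> (\<exists>K c. \<forall>s. f s = (\<Sum>k<(K::nat). c k * of_real (hermite_fun1 k s)))"

abbreviation gauss_approx1 :: "(real \<Rightarrow> complex) \<Rightarrow> bool" where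
  "gauss_approx1 \<equiv> weighted_closure hermite_span1 UNIV (\<lambda>s. exp (- s\<^sup>2 / 4))"

lemma hermite_span1_cmult: "hermite_span1 f \<Longrightarrow> hermite_span1 (\<lambda>s. a * f s)"
  unfolding hermite_span1_def
proof clarify
  fix K :: nat and c assume "\<forall>s. f s = (\<Sum>k<K. c k * of_real (hermite_fun1 k s))"
  then show "\<exists>K c'. \<forall>s. a * f s = (\<Sum>k<(K::nat). c' k * of_real (hermite_fun1 k s))"
    by (intro exI[of _ K] exI[of _ "\<lambda>k. a * c k"]) (simp add: sum_distrib_left mult.assoc)
qed

lemma hermite_span1_extend:
  "(\<Sum>k<K. c k * z k) = (\<Sum>k<max K L. (if k < K then c k else 0) * z k)" for z :: "nat \<Rightarrow> complex"
  by (rule sum.mono_neutral_cong_left) auto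

lemma hermite_span1_add: "hermite_span1 f \<Longrightarrow> hermite_span1 g \<Longrightarrow> hermite_span1 (\<lambda>s. f s + g s)"
  unfolding hermite_span1_def
proof clarify
  fix K L :: nat and c d
  assume f: "\<forall>s. f s = (\<Sum>k<K. c k * of_real (hermite_fun1 k s))" and g: "\<forall>s. g s = (\<Sum>k<L. d k * of_real (hermite_fun1 k s))"
  show "\<exists>K c. \<forall>s. f s + g s = (\<Sum>k<(K::nat). c k * of_real (hermite_fun1 k s))"
  proof (intro exI allI)
    fix s
    show "f s + g s = (\<Sum>k<max K L. ((if k < K then c k else 0) + (if k < L then d k else 0)) * of_real (hermite_fun1 k s))"
      using f g hermite_span1_extend[of c "\<lambda>k. of_real (hermite_fun1 k s)" K L] hermite_span1_extend[of d "\<lambda>k. of_real (hermite_fun1 k s)" L K]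
      by (simp add: sum.distrib distrib_right max.commute)
  qed
qed

lemma hermite_span1_hermite: "hermite_span1 (\<lambda>s. of_real (hermite_fun1 k s))"
  unfolding hermite_span1_def
  by (intro exI[of _ "Suc k"] exI[of _ "\<lambda>i. if i = k then 1 else 0"]) (simp add: if_distrib[of "\<lambda>x. x * _"] cong: if_cong)

lemma hermite_span1_zero: "hermite_span1 (\<lambda>s. 0)"
  unfolding hermite_span1_def by (intro exI[of _ 0]) simp

lemma hermite_span1_sum: "(\<And>i. i \<in> I \<Longrightarrow> hermite_span1 (f i)) \<Longrightarrow> hermite_span1 (\<lambda>s. \<Sum>i\<in>I. f i s)"
  by (induction I rule: infinite_finite_induct) (auto intro: hermite_span1_zero hermite_span1_add)

lemma hermite_span1_mult_arg: "hermite_span1 f \<Longrightarrow> hermite_span1 (\<lambda>s. of_real s * f s)"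
proof -
  assume "hermite_span1 f"
  then obtain K c where f: "\<And>s. f s = (\<Sum>k<(K::nat). c k * of_real (hermite_fun1 k s))" unfolding hermite_span1_def by blast
  have "(\<lambda>s. of_real s * f s) = (\<lambda>s. \<Sum>k<K. c k * (of_real (sqrt (real (k + 1) / 2)) * of_real (hermite_fun1 (k + 1) s)
     + of_real (sqrt (real k / 2)) * of_real (hermite_fun1 (k - 1) s)))"
    unfolding f sum_distrib_left of_real_mult[symmetric] of_real_add[symmetric] hermite_fun1_mult_arg[symmetric]
    by (simp add: mult_ac)
  moreover have "hermite_span1 (\<lambda>s. \<Sum>k<K. c k * (of_real (sqrt (real (k + 1) / 2)) * of_real (hermite_fun1 (k + 1) s)
     + of_real (sqrt (real k / 2)) * of_real (hermite_fun1 (k - 1) s)))"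
    by (intro hermite_span1_sum hermite_span1_cmult hermite_span1_add hermite_span1_hermite)
  ultimately show ?thesis by simp
qed

text \<open>Starting from the ground state, multiplication by the variable stays in the span because
  of the three-term recurrence.\<close>

lemma hermite_span1_monomial: "hermite_span1 (\<lambda>s. of_real s ^ k * of_real (exp (- s\<^sup>2 / 2)))"
proof (induction k)
  case 0
  have "(\<lambda>s::real. of_real s ^ 0 * of_real (exp (- s\<^sup>2 / 2))) = (\<lambda>s. of_real (sqrt (sqrt pi)) * complex_of_real (hermite_fun1 0 s))"
    by (rule ext) (simp add: hermite_fun1_def)
  then show ?case using hermite_span1_cmult[OF hermite_span1_hermite[of 0]] by simp
next
  case (Suc k)
  from hermite_span1_mult_arg[OF this] show ?case by (simp add: mult_ac)
qed

lemma gauss_approx1_cmult: "gauss_approx1 f \<Longrightarrow> gauss_approx1 (\<lambda>s. a * f s)"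
  by (rule weighted_closure_cmult[where H = "hermite_span1", OF hermite_span1_cmult]) auto

lemma gauss_approx1_add: "gauss_approx1 f \<Longrightarrow> gauss_approx1 g \<Longrightarrow> gauss_approx1 (\<lambda>s. f s + g s)"
  by (rule weighted_closure_add[where H = "hermite_span1", OF hermite_span1_add])

text \<open>Against the Gaussian weight the Taylor polynomials of a character converge uniformly on the
  whole line, which replaces the completeness of the Hermite functions.\<close>

lemma gauss_approx1_character: "gauss_approx1 (\<lambda>s. cis (\<xi> * s) * of_real (exp (- s\<^sup>2 / 2)))"
  unfolding weighted_closure_def
proof (intro allI impI)
  fix e :: real assume e: "e > 0"
  have "(\<lambda>j. inverse (fact j) * (4 * \<xi>\<^sup>2) ^ j) \<longlonglongrightarrow> 0" by (rule summable_LIMSEQ_zero[OF summable_exp])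
  then have "\<forall>\<^sub>F j in sequentially. \<bar>inverse (fact j) * (4 * \<xi>\<^sup>2) ^ j\<bar> < e"
    using e by (simp add: tendsto_iff)
  then obtain j0 where "\<And>j. j \<ge> j0 \<Longrightarrow> \<bar>inverse (fact j) * (4 * \<xi>\<^sup>2) ^ j\<bar> < e"
    unfolding eventually_sequentially by blast
  then have j0: "\<bar>inverse (fact (Suc j0)) * (4 * \<xi>\<^sup>2) ^ Suc j0\<bar> < e" by (meson le_SucI order_refl)
  define j where "j = Suc j0"
  have j: "inverse (fact j) * (4 * \<xi>\<^sup>2) ^ j < e" using j0 unfolding j_def by linarith
  \<comment> \<open>Chosen so that the Taylor remainder has the even order \<open>2 * j\<close> and
    is at most \<open>(4 * \<xi>\<^sup>2) ^ j * (s\<^sup>2 / 4) ^ j / fact (2 * j)\<close>. The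
    power of \<open>s\<^sup>2 / 4\<close> costs \<open>fact j * exp (s\<^sup>2 / 4)\<close>, and
    \<open>fact (2 * j) \<ge> fact j * fact j\<close> leaves a null sequence. As \<open>j\<close> is
    a successor, the subtraction is genuine.\<close>
  define N where "N = 2 * j - 1"
  have N: "Suc N = 2 * j" by (simp add: N_def j_def)
  define g where "g s = (\<Sum>k\<le>N. (\<i> * of_real (\<xi> * s)) ^ k / fact k) * of_real (exp (- s\<^sup>2 / 2))" for s :: real
  have gs: "g = (\<lambda>s. \<Sum>k\<le>N. ((\<i> * of_real \<xi>) ^ k / fact k) * (of_real s ^ k * of_real (exp (- s\<^sup>2 / 2))))"
    unfolding g_def by (rule ext) (simp add: sum_distrib_left power_mult_distrib mult_ac)
  have "hermite_span1 g"
    unfolding gs by (intro hermite_span1_sum hermite_span1_cmult hermite_span1_monomial)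
  moreover have "cmod (g s - cis (\<xi> * s) * of_real (exp (- s\<^sup>2 / 2))) \<le> e * exp (- s\<^sup>2 / 4)" for s
  proof -
    define E where "E = exp (- s\<^sup>2 / 4)"
    have E: "exp (- s\<^sup>2 / 2) = E * E" "exp (s\<^sup>2 / 4) * E = 1"
      unfolding E_def exp_add[symmetric] by simp_all
    have pow: "(s\<^sup>2 / 4) ^ j \<le> fact j * exp (s\<^sup>2 / 4)"
    proof -
      have "(s\<^sup>2 / 4) ^ j / fact j \<le> exp (s\<^sup>2 / 4)" by (rule power_div_fact_le_exp) simp
      then show ?thesis by (simp add: divide_le_eq mult.commute)
    qed
    have ff: "(fact j :: real) * fact j \<le> fact (2 * j)"
    proof -
      have "(fact j :: nat) * fact j \<le> fact (j + j)" by (intro dvd_imp_le fact_fact_dvd_fact) auto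
      then have "real (fact j * fact j) \<le> real (fact (j + j))" by (rule of_nat_mono)
      then show ?thesis by (simp add: mult_2)
    qed
    have "cmod (iexp (\<xi> * s) - (\<Sum>k\<le>N. (\<i> * of_real (\<xi> * s)) ^ k / fact k)) \<le> \<bar>\<xi> * s\<bar> ^ Suc N / fact (Suc N)"
      by (rule iexp_approx1)
    also have "\<dots> = (4 * \<xi>\<^sup>2) ^ j * (s\<^sup>2 / 4) ^ j / fact (2 * j)"
    proof -
      have "\<bar>\<xi> * s\<bar> ^ (2 * j) = ((4 * \<xi>\<^sup>2) * (s\<^sup>2 / 4)) ^ j"
        unfolding power_mult power2_abs by (simp add: power_mult_distrib)
      then show ?thesis unfolding N by (simp only: power_mult_distrib)
    qed
    also have "\<dots> \<le> (4 * \<xi>\<^sup>2) ^ j * (fact j * exp (s\<^sup>2 / 4)) / (fact j * fact j)"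
      by (intro frac_le mult_left_mono pow ff) auto
    also have "\<dots> = (inverse (fact j) * (4 * \<xi>\<^sup>2) ^ j) * exp (s\<^sup>2 / 4)"
      by (simp add: field_simps)
    also have "\<dots> \<le> e * exp (s\<^sup>2 / 4)" using j by (intro mult_right_mono) auto
    finally have *: "cmod (cis (\<xi> * s) - (\<Sum>k\<le>N. (\<i> * of_real (\<xi> * s)) ^ k / fact k)) \<le> e * exp (s\<^sup>2 / 4)"
      by (simp add: cis_conv_exp)
    have "cmod (g s - cis (\<xi> * s) * of_real (exp (- s\<^sup>2 / 2)))
      = cmod (cis (\<xi> * s) - (\<Sum>k\<le>N. (\<i> * of_real (\<xi> * s)) ^ k / fact k)) * exp (- s\<^sup>2 / 2)"
      unfolding g_def left_diff_distrib[symmetric] norm_mult by (simp add: norm_minus_commute)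
    also have "\<dots> \<le> (e * exp (s\<^sup>2 / 4)) * exp (- s\<^sup>2 / 2)" by (intro mult_right_mono *) auto
    also have "\<dots> = e * exp (- s\<^sup>2 / 4)" unfolding E(1) E_def[symmetric] using E(2) by (simp add: mult.assoc[symmetric])
    finally show ?thesis .
  qed
  ultimately show "\<exists>g. hermite_span1 g \<and> (\<forall>s\<in>UNIV. cmod (g s - cis (\<xi> * s) * of_real (exp (- s\<^sup>2 / 2))) \<le> e * exp (- s\<^sup>2 / 4))"
    by blast
qed

inductive trig_poly :: "(real \<Rightarrow> complex) \<Rightarrow> bool" where
  trig_poly_cis: "trig_poly (\<lambda>s. cis (\<xi> * s))"
| trig_poly_cmult: "trig_poly f \<Longrightarrow> trig_poly (\<lambda>s. c * f s)"
| trig_poly_add: "trig_poly f \<Longrightarrow> trig_poly g \<Longrightarrow> trig_poly (\<lambda>s. f s + g s)"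

lemma trig_poly_const: "trig_poly (\<lambda>s. c)"
  using trig_poly_cmult[OF trig_poly_cis[of 0], of c] by simp

lemma trig_poly_mult: "trig_poly f \<Longrightarrow> trig_poly g \<Longrightarrow> trig_poly (\<lambda>s. f s * g s)"
proof (induction f rule: trig_poly.induct)
  case (trig_poly_cis \<xi>)
  then show ?case
  proof (induction g rule: trig_poly.induct)
    case (trig_poly_cis \<xi>')
    have "trig_poly (\<lambda>s. cis ((\<xi> + \<xi>') * s))" by (rule trig_poly.trig_poly_cis)
    then show ?case by (simp add: cis_mult distrib_right)
  next
    case (trig_poly_cmult f c)
    then show ?case using trig_poly.trig_poly_cmult[of "\<lambda>s. cis (\<xi> * s) * f s" c] by (simp add: mult_ac)
  next
    case (trig_poly_add f g)
    then show ?case using trig_poly.trig_poly_add by (simp add: distrib_left)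
  qed
next
  case (trig_poly_cmult f c)
  then show ?case using trig_poly.trig_poly_cmult[of "\<lambda>s. f s * g s" c] by (simp add: mult_ac)
next
  case (trig_poly_add f h)
  then show ?case using trig_poly.trig_poly_add by (simp add: distrib_right)
qed

lemma gauss_approx1_trig: "trig_poly f \<Longrightarrow> gauss_approx1 (\<lambda>s. f s * of_real (exp (- s\<^sup>2 / 2)))"
proof (induction f rule: trig_poly.induct)
  case (trig_poly_cis \<xi>)
  show ?case by (rule gauss_approx1_character)
next
  case (trig_poly_cmult f c)
  from gauss_approx1_cmult[OF trig_poly_cmult.IH, of c] show ?case by (simp add: mult.assoc)
next
  case (trig_poly_add f g)
  from gauss_approx1_add[OF trig_poly_add.IH] show ?case by (simp add: distrib_right)
qed

text \<open>Links Stone-Weierstrass on the unit circle with the characters: the real coordinates of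
  a point of the circle are cosine and sine, hence combinations of two characters.\<close>

lemma trig_poly_real_polynomial:
  fixes p :: "complex \<Rightarrow> real"
  assumes "real_polynomial_function p"
  shows "trig_poly (\<lambda>s. of_real (p (cis (\<omega> * s))))"
  using assms
proof (induction p rule: real_polynomial_function.induct)
  case (linear f)
  have e: "f (cis \<theta>) = cos \<theta> * f 1 + sin \<theta> * f \<i>" for \<theta>
  proof -
    interpret bounded_linear f by fact
    have "cis \<theta> = cos \<theta> *\<^sub>R 1 + sin \<theta> *\<^sub>R \<i>" by (simp add: complex_eq_iff)
    then show ?thesis by (simp add: add scale)
  qed
  have c: "complex_of_real (cos \<theta>) = (1 / 2) * cis \<theta> + (1 / 2) * cis (- \<theta>)"
    and s: "complex_of_real (sin \<theta>) = (- \<i> / 2) * cis \<theta> + (\<i> / 2) * cis (- \<theta>)" for \<theta>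
    by (auto simp: complex_eq_iff)
  have "trig_poly (\<lambda>s. of_real (f 1) * ((1 / 2) * cis (\<omega> * s) + (1 / 2) * cis ((- \<omega>) * s))
     + of_real (f \<i>) * ((- \<i> / 2) * cis (\<omega> * s) + (\<i> / 2) * cis ((- \<omega>) * s)))"
    by (intro trig_poly_add trig_poly_cmult trig_poly_cis)
  then show ?case by (simp add: e c s mult.commute)
next
  case (const c)
  show ?case by (rule trig_poly_const)
next
  case (add f g)
  then show ?case using trig_poly_add by simp
next
  case (mult f g)
  then show ?case using trig_poly_mult by simp
qed

text \<open>Dividing by \<open>exp (- s\<^sup>2 / 2)\<close> gives a compactly supported \<psi>,
  which is wrapped around a circle of circumference \<open>2 * T\<close> and approximated there by a
  trigonometric polynomial \<open>h\<close>. On the line \<open>h\<close> is periodic and does not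
  decay, but the error allowed for it is \<open>e * exp (s\<^sup>2 / 4)\<close>, which is large away
  from the support if \<open>T\<close> is.\<close>

lemma gauss_approx1_compact_support:
  fixes \<phi> :: "real \<Rightarrow> real"
  assumes cont: "continuous_on UNIV \<phi>" and supp: "\<And>s. \<bar>s\<bar> \<ge> R \<Longrightarrow> \<phi> s = 0"
  shows "gauss_approx1 (\<lambda>s. of_real (\<phi> s))"
proof (rule weighted_closure_limit)
  fix e :: real assume e: "e > 0"
  define \<psi> where "\<psi> s = \<phi> s * exp (s\<^sup>2 / 2)" for s
  have contp: "continuous_on A \<psi>" for A
    unfolding \<psi>_def using cont by (intro continuous_intros) (auto intro: continuous_on_subset)
  define R1 where "R1 = max R 1"
  have R1: "R1 > 0" "\<And>s. \<bar>s\<bar> \<ge> R1 \<Longrightarrow> \<psi> s = 0" by (auto simp: R1_def \<psi>_def supp)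
  have "compact (\<psi> ` {-R1..R1})" by (intro compact_continuous_image contp) auto
  then have "bounded (\<psi> ` {-R1..R1})" by (rule compact_imp_bounded)
  then obtain Mx where "\<And>s. s \<in> {-R1..R1} \<Longrightarrow> \<bar>\<psi> s\<bar> \<le> Mx"
    unfolding bounded_iff real_norm_def by blast
  then have Mx: "\<bar>\<psi> s\<bar> \<le> max Mx 0" for s
    by (cases "s \<in> {-R1..R1}") (fastforce simp: R1(2) le_max_iff_disj)+
  define M where "M = max Mx 0"
  \<comment> \<open>Beyond \<open>T\<close> the periodic approximation cannot follow \<psi>, and the
    difference is only known to be at most \<open>M + e\<close>; \<open>T\<close> is chosen so that
    this is already an admissible error.\<close>
  have "filterlim (\<lambda>T::real. e * exp (T\<^sup>2 / 4)) at_top at_top" using e by real_asymp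
  then have "\<forall>\<^sub>F T in at_top. e * exp (T\<^sup>2 / 4) \<ge> M + e \<and> T > R1"
    by (intro eventually_conj eventually_gt_at_top) (simp add: filterlim_at_top)
  then obtain T where T: "e * exp (T\<^sup>2 / 4) \<ge> M + e" "T > R1"
    by (auto simp: eventually_at_top_linorder)
  have T0: "T > 0" using T R1 by simp
  \<comment> \<open>The jump of \<open>Arg\<close> along the negative axis does not show, because
    \<psi> vanishes near both ends of the interval from \<open>- T\<close> to
    \<open>T\<close>.\<close>
  define g where "g z = \<psi> (T * Arg z / pi)" for z
  define \<kappa> where "\<kappa> = cos (pi * R1 / T)"
  have kp: "0 \<le> pi * R1 / T" "pi * R1 / T < pi" using T T0 R1(1) by (auto simp: field_simps)
  have k1: "\<kappa> > -1" unfolding \<kappa>_def using cos_monotone_0_pi[of "pi * R1 / T" pi] kp by simp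
  have gzero: "g z = 0" if "cmod z = 1" "Re z < \<kappa>" for z
  proof -
    have z0: "z \<noteq> 0" using that by auto
    have "Re z = cos \<bar>Arg z\<bar>" using cis_Arg[OF z0] that by (metis Re_sgn cis.simps(1) cos_abs_real div_by_1)
    then have "cos \<bar>Arg z\<bar> < cos (pi * R1 / T)" using that by (simp add: \<kappa>_def)
    moreover have "\<bar>Arg z\<bar> \<le> pi" using Arg_bounded[of z] by auto
    ultimately have "\<bar>Arg z\<bar> > pi * R1 / T"
      using cos_monotone_0_pi_le[of "\<bar>Arg z\<bar>" "pi * R1 / T"] kp by (meson abs_ge_zero less_imp_le not_less)
    then have "\<bar>T * Arg z / pi\<bar> \<ge> R1"
      using T0 by (simp add: abs_mult field_simps)
    then show ?thesis unfolding g_def by (rule R1(2))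
  qed
  \<comment> \<open>Two open arcs cover the circle: on the first \<open>Arg\<close> is continuous,
    on the second \<open>g\<close> is 0, since real part below \<kappa> means an argument of modulus
    above \<open>pi * R1 / T\<close>.\<close>
  let ?S1 = "{z \<in> sphere (0::complex) 1. Re z > -1}" and ?S2 = "{z \<in> sphere (0::complex) 1. Re z < \<kappa>}"
  have Sp: "sphere (0::complex) 1 = ?S1 \<union> ?S2" using k1 by auto
  have "continuous_on (?S1 \<union> ?S2) g"
  proof (rule continuous_on_Un_local_open)
    have "open {z::complex. Re z > -1}" "open {z::complex. Re z < \<kappa>}"
      by (simp_all add: open_halfspace_Re_gt open_halfspace_Re_lt)
    then show "openin (top_of_set (?S1 \<union> ?S2)) ?S1" "openin (top_of_set (?S1 \<union> ?S2)) ?S2"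
      unfolding Sp[symmetric] openin_open by blast+
    show "continuous_on ?S1 g"
    proof -
      have "continuous_on ?S1 Arg"
      proof (intro continuous_at_imp_continuous_on ballI continuous_at_Arg)
        fix z assume z: "z \<in> ?S1"
        show "z \<notin> \<real>\<^sub>\<le>\<^sub>0"
        proof
          assume "z \<in> \<real>\<^sub>\<le>\<^sub>0"
          then have "z = of_real (Re z)" "Re z \<le> 0" by (auto simp: complex_nonpos_Reals_iff complex_eq_iff)
          moreover have "cmod z = 1" using z by simp
          ultimately have "\<bar>Re z\<bar> = 1" by (metis norm_of_real)
          then show False using z \<open>Re z \<le> 0\<close> by auto
        qed
      qed
      then have "continuous_on ?S1 (\<lambda>z. T * Arg z / pi)"
        by (intro continuous_on_divide continuous_on_mult continuous_on_const) auto
      then show ?thesis unfolding g_def by (rule continuous_on_compose2[OF contp[of UNIV]]) auto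
    qed
    have "continuous_on ?S2 (\<lambda>z. 0::real)" by (rule continuous_on_const)
    then show "continuous_on ?S2 g"
      by (rule continuous_on_eq) (use gzero in auto)
  qed
  then have contg: "continuous_on (sphere 0 1) g" unfolding Sp[symmetric] .
  obtain p where p: "real_polynomial_function p" "\<And>z. z \<in> sphere 0 1 \<Longrightarrow> \<bar>g z - p z\<bar> < e"
    using Stone_Weierstrass_real_polynomial_function[OF compact_sphere contg e] by blast
  define h where "h s = p (cis (pi / T * s))" for s
  have h1: "\<bar>h s - \<psi> s\<bar> \<le> e" if "\<bar>s\<bar> < T" for s
  proof -
    have "- pi < pi / T * s" "pi / T * s < pi"
      using that T0 mult_strict_left_mono[of "-T" s pi] mult_strict_left_mono[of s T pi] by (auto simp: field_simps abs_less_iff)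
    then have "Arg (cis (pi / T * s)) = pi / T * s" by (intro Arg_cis) auto
    then have "g (cis (pi / T * s)) = \<psi> s" unfolding g_def using T0 by simp
    then show ?thesis using p(2)[of "cis (pi / T * s)"] unfolding h_def by simp
  qed
  have h2: "\<bar>h s - \<psi> s\<bar> \<le> M + e" if "\<bar>s\<bar> \<ge> T" for s
  proof -
    have "\<psi> s = 0" using that T R1(2)[of s] by simp
    moreover have "\<bar>g (cis (pi / T * s))\<bar> \<le> M" unfolding g_def M_def by (rule Mx)
    ultimately show ?thesis using p(2)[of "cis (pi / T * s)"] unfolding h_def by simp
  qed
  have h: "\<bar>h s - \<psi> s\<bar> \<le> e * exp (s\<^sup>2 / 4)" for s
  proof (cases "\<bar>s\<bar> < T")
    case True
    have "e * 1 \<le> e * exp (s\<^sup>2 / 4)" using e by (intro mult_left_mono) auto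
    then show ?thesis using h1[OF True] by simp
  next
    case False
    then have "T\<^sup>2 \<le> s\<^sup>2" using T0 by (simp add: abs_le_square_iff[symmetric])
    then have "e * exp (T\<^sup>2 / 4) \<le> e * exp (s\<^sup>2 / 4)" using e by (intro mult_left_mono) auto
    then show ?thesis using h2[of s] False T(1) by simp
  qed
  have "gauss_approx1 (\<lambda>s. of_real (h s) * of_real (exp (- s\<^sup>2 / 2)))"
    unfolding h_def by (intro gauss_approx1_trig trig_poly_real_polynomial p)
  moreover have "cmod (of_real (h s) * of_real (exp (- s\<^sup>2 / 2)) - of_real (\<phi> s)) \<le> e * exp (- s\<^sup>2 / 4)" for s
  proof -
    have "\<phi> s = \<psi> s * exp (- s\<^sup>2 / 2)" unfolding \<psi>_def by (simp flip: exp_add)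
    then have "cmod (of_real (h s) * of_real (exp (- s\<^sup>2 / 2)) - of_real (\<phi> s)) = \<bar>h s - \<psi> s\<bar> * exp (- s\<^sup>2 / 2)"
      by (simp add: norm_mult flip: of_real_diff left_diff_distrib)
    also have "\<dots> \<le> (e * exp (s\<^sup>2 / 4)) * exp (- s\<^sup>2 / 2)" by (intro mult_right_mono h) auto
    also have "\<dots> = e * exp (- s\<^sup>2 / 4)" by (simp add: mult.assoc flip: exp_add)
    finally show ?thesis .
  qed
  ultimately show "\<exists>g. gauss_approx1 g \<and> (\<forall>s\<in>UNIV. cmod (g s - of_real (\<phi> s)) \<le> e * exp (- s\<^sup>2 / 4))" by blast
qed

section \<open>Density in several variables\<close>

definition hermite_span :: "nat \<Rightarrow> ((nat \<Rightarrow> real) \<Rightarrow> complex) \<Rightarrow> bool" where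
  "hermite_span n f \<longleftrightarrow> (\<exists>A c. finite A \<and> A \<subseteq> multi_indices n \<and> (\<forall>x. f x = hermite_sum n A c x))"

abbreviation gauss_approx :: "nat \<Rightarrow> ((nat \<Rightarrow> real) \<Rightarrow> complex) \<Rightarrow> bool" where
  "gauss_approx n \<equiv> weighted_closure (hermite_span n) (Rn n) (gauss n)"

lemma hermite_span_cmult: "hermite_span n f \<Longrightarrow> hermite_span n (\<lambda>x. a * f x)"
  unfolding hermite_span_def
proof clarify
  fix A c assume A: "finite A" "A \<subseteq> multi_indices n" "\<forall>x. f x = hermite_sum n A c x"
  then show "\<exists>A c. finite A \<and> A \<subseteq> multi_indices n \<and> (\<forall>x. a * f x = hermite_sum n A c x)"
    by (intro exI[of _ A] exI[of _ "\<lambda>\<alpha>. a * c \<alpha>"]) (simp add: hermite_sum_def sum_distrib_left mult.assoc)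
qed

lemma hermite_sum_extend:
  "finite A \<Longrightarrow> finite B \<Longrightarrow> A \<subseteq> B \<Longrightarrow> hermite_sum n A c x = hermite_sum n B (\<lambda>\<alpha>. if \<alpha> \<in> A then c \<alpha> else 0) x"
  unfolding hermite_sum_def by (rule sum.mono_neutral_cong_left) auto

lemma hermite_span_add: "hermite_span n f \<Longrightarrow> hermite_span n g \<Longrightarrow> hermite_span n (\<lambda>x. f x + g x)"
  unfolding hermite_span_def
proof clarify
  fix A B c d
  assume A: "finite A" "A \<subseteq> multi_indices n" "\<forall>x. f x = hermite_sum n A c x"
    and B: "finite B" "B \<subseteq> multi_indices n" "\<forall>x. g x = hermite_sum n B d x"
  have "f x + g x = hermite_sum n (A \<union> B) (\<lambda>\<alpha>. (if \<alpha> \<in> A then c \<alpha> else 0) + (if \<alpha> \<in> B then d \<alpha> else 0)) x" for x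
    using A B hermite_sum_extend[of A "A \<union> B" n c x] hermite_sum_extend[of B "A \<union> B" n d x]
    by (simp add: hermite_sum_def sum.distrib distrib_right)
  then show "\<exists>A c. finite A \<and> A \<subseteq> multi_indices n \<and> (\<forall>x. f x + g x = hermite_sum n A c x)"
    using A B by (intro exI[of _ "A \<union> B"] exI[of _ "\<lambda>\<alpha>. (if \<alpha> \<in> A then c \<alpha> else 0) + (if \<alpha> \<in> B then d \<alpha> else 0)"]) auto
qed

lemma gauss_approx_cmult: "gauss_approx n f \<Longrightarrow> gauss_approx n (\<lambda>x. a * f x)"
  by (rule weighted_closure_cmult[where H = "hermite_span n", OF hermite_span_cmult]) (auto simp: gauss_pos less_imp_le)

lemma gauss_approx_add: "gauss_approx n f \<Longrightarrow> gauss_approx n g \<Longrightarrow> gauss_approx n (\<lambda>x. f x + g x)"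
  by (rule weighted_closure_add[where H = "hermite_span n", OF hermite_span_add])

lemma hermite_span_prod:
  assumes "\<And>i. i < n \<Longrightarrow> hermite_span1 (\<psi> i)"
  shows "hermite_span n (\<lambda>x. \<Prod>i<n. \<psi> i (x i))"
proof -
  have "\<forall>i. \<exists>K c. i < n \<longrightarrow> (\<forall>s. \<psi> i s = (\<Sum>k<(K::nat). c k * of_real (hermite_fun1 k s)))"
    using assms unfolding hermite_span1_def by blast
  then obtain K c where Kc: "\<And>i s. i < n \<Longrightarrow> \<psi> i s = (\<Sum>k<K i. c i k * of_real (hermite_fun1 k s))"
    by metis
  define A where "A = PiE {..<n} (\<lambda>i. {..<K i})"
  have "(\<Prod>i<n. \<psi> i (x i)) = hermite_sum n A (\<lambda>\<alpha>. \<Prod>i<n. c i (\<alpha> i)) x" for x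
  proof -
    have "(\<Prod>i<n. \<psi> i (x i)) = (\<Prod>i<n. \<Sum>k<K i. c i k * of_real (hermite_fun1 k (x i)))"
      by (intro prod.cong refl) (simp add: Kc)
    also have "\<dots> = (\<Sum>\<alpha>\<in>A. \<Prod>i<n. c i (\<alpha> i) * of_real (hermite_fun1 (\<alpha> i) (x i)))"
      unfolding A_def by (rule prod_sum_PiE) auto
    finally show ?thesis by (simp add: hermite_sum_def hermite_fun_def prod.distrib)
  qed
  moreover have "finite A" "A \<subseteq> multi_indices n"
    unfolding A_def by (auto intro!: finite_PiE PiE_mono)
  ultimately show ?thesis unfolding hermite_span_def by blast
qed

text \<open>After division by \<open>D * exp (- s\<^sup>2 / 4)\<close> all factors have modulus at
  most 1, so the difference of the two products is at most the sum of the differences of the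
  factors.\<close>

lemma gauss_approx_prod:
  assumes "\<And>i. i < n \<Longrightarrow> gauss_approx1 (\<phi> i)" and C: "C \<ge> 0" "\<And>i s. i < n \<Longrightarrow> cmod (\<phi> i s) \<le> C * exp (- s\<^sup>2 / 4)"
  shows "gauss_approx n (\<lambda>x. \<Prod>i<n. \<phi> i (x i))"
  unfolding weighted_closure_def
proof (intro allI impI)
  fix e :: real assume e: "e > 0"
  define D where "D = C + 1"
  \<comment> \<open>The bound 1 keeps the approximating factors below
    \<open>(C + 1) * exp (- s\<^sup>2 / 4)\<close>, the reason for \<open>D = C + 1\<close>. The
    quotient pays for the n summands and for the product \<open>D ^ n\<close> of the normalizing
    constants.\<close>
  define \<eta> where "\<eta> = min 1 (e / ((real n + 1) * D ^ n))"
  have D: "D \<ge> 1" using C by (simp add: D_def)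
  have \<eta>: "\<eta> > 0" "\<eta> \<le> 1" using e D by (auto simp: \<eta>_def)
  have "\<exists>\<psi>. hermite_span1 \<psi> \<and> (\<forall>s. cmod (\<psi> s - \<phi> i s) \<le> \<eta> * exp (- s\<^sup>2 / 4))" if "i < n" for i
    using weighted_closureE[OF assms(1)[OF that] \<eta>(1)] by auto
  then obtain \<psi> where \<psi>: "\<And>i. i < n \<Longrightarrow> hermite_span1 (\<psi> i)" "\<And>i s. i < n \<Longrightarrow> cmod (\<psi> i s - \<phi> i s) \<le> \<eta> * exp (- s\<^sup>2 / 4)"
    by metis
  have "cmod ((\<Prod>i<n. \<psi> i (x i)) - (\<Prod>i<n. \<phi> i (x i))) \<le> e * gauss n x" for x
  proof -
    define w where "w i = D * exp (- (x i)\<^sup>2 / 4)" for i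
    have w: "w i > 0" for i using D by (simp add: w_def)
    have p: "(\<Prod>i<n. f i) = of_real (\<Prod>i<n. w i) * (\<Prod>i<n. f i / of_real (w i))" for f :: "nat \<Rightarrow> complex"
      unfolding of_real_prod prod.distrib[symmetric] using w by (intro prod.cong refl) (simp add: less_imp_neq[symmetric])
    have W: "(\<Prod>i<n. w i) = D ^ n * gauss n x" unfolding w_def gauss_def by (simp add: prod.distrib)
    have z: "cmod (\<psi> i (x i) / of_real (w i)) \<le> 1" "cmod (\<phi> i (x i) / of_real (w i)) \<le> 1"
      "cmod (\<psi> i (x i) / of_real (w i) - \<phi> i (x i) / of_real (w i)) \<le> \<eta>" if "i < n" for i
    proof -
      have E: "exp (- (x i)\<^sup>2 / 4) > 0" by simp
      have 1: "cmod (\<phi> i (x i)) \<le> C * exp (- (x i)\<^sup>2 / 4)" by (rule C(2)[OF that])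
      have 2: "cmod (\<psi> i (x i) - \<phi> i (x i)) \<le> \<eta> * exp (- (x i)\<^sup>2 / 4)" by (rule \<psi>(2)[OF that])
      have "\<eta> * exp (- (x i)\<^sup>2 / 4) \<le> 1 * exp (- (x i)\<^sup>2 / 4)" using \<eta> by (intro mult_right_mono) auto
      then have "cmod (\<psi> i (x i)) \<le> w i"
        using norm_triangle_ineq2[of "\<psi> i (x i)" "\<phi> i (x i)"] 1 2 unfolding w_def D_def distrib_right by linarith
      then show "cmod (\<psi> i (x i) / of_real (w i)) \<le> 1" using w[of i] by (simp add: norm_divide)
      have "cmod (\<phi> i (x i)) \<le> w i" using 1 E unfolding w_def D_def distrib_right by linarith
      then show "cmod (\<phi> i (x i) / of_real (w i)) \<le> 1" using w[of i] by (simp add: norm_divide)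
      have "\<eta> * exp (- (x i)\<^sup>2 / 4) \<le> \<eta> * w i"
        unfolding w_def using \<eta> D by (intro mult_left_mono) auto
      then have "cmod (\<psi> i (x i) - \<phi> i (x i)) \<le> \<eta> * w i" using 2 by linarith
      then show "cmod (\<psi> i (x i) / of_real (w i) - \<phi> i (x i) / of_real (w i)) \<le> \<eta>"
        using w[of i] by (simp add: norm_divide divide_le_eq flip: diff_divide_distrib)
    qed
    have "cmod ((\<Prod>i<n. \<psi> i (x i)) - (\<Prod>i<n. \<phi> i (x i)))
      = (\<Prod>i<n. w i) * cmod ((\<Prod>i<n. \<psi> i (x i) / of_real (w i)) - (\<Prod>i<n. \<phi> i (x i) / of_real (w i)))"
      unfolding p[of "\<lambda>i. \<psi> i (x i)"] p[of "\<lambda>i. \<phi> i (x i)"] right_diff_distrib[symmetric] norm_mult norm_of_real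
      using w by (simp add: prod_nonneg less_imp_le)
    also have "\<dots> \<le> (\<Prod>i<n. w i) * (\<Sum>i<n. cmod (\<psi> i (x i) / of_real (w i) - \<phi> i (x i) / of_real (w i)))"
      using z w by (intro mult_left_mono norm_prod_diff prod_nonneg) (auto simp: less_imp_le)
    also have "\<dots> \<le> (\<Prod>i<n. w i) * (\<Sum>i<n. \<eta>)"
      using z w by (intro mult_left_mono sum_mono prod_nonneg) (auto simp: less_imp_le)
    also have "\<dots> = (real n * D ^ n * \<eta>) * gauss n x" unfolding W by simp
    also have "\<dots> \<le> e * gauss n x"
    proof (rule mult_right_mono)
      have "real n * D ^ n * \<eta> \<le> (real n + 1) * D ^ n * (e / ((real n + 1) * D ^ n))"
        using D e \<eta> by (intro mult_mono) (auto simp: \<eta>_def)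
      also have "\<dots> = e"
      proof -
        have "(real n + 1) * D ^ n > 0" using D by (intro mult_pos_pos) auto
        then show ?thesis by (metis nonzero_mult_div_cancel_left less_irrefl times_divide_eq_right)
      qed
      finally show "real n * D ^ n * \<eta> \<le> e" .
    qed (simp add: gauss_pos less_imp_le)
    finally show ?thesis .
  qed
  then show "\<exists>g. hermite_span n g \<and> (\<forall>x\<in>Rn n. cmod (g x - (\<Prod>i<n. \<phi> i (x i))) \<le> e * gauss n x)"
    using hermite_span_prod[of n \<psi>] \<psi>(1) by blast
qed

text \<open>An algebra to which Stone-Weierstrass applies on a box, and whose elements, once cut
  off, are sums of products that can be approximated coordinate by coordinate.\<close>

inductive tensor_sum :: "nat \<Rightarrow> ((nat \<Rightarrow> real) \<Rightarrow> real) \<Rightarrow> bool" for n where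
  tensor_sum_prod: "(\<And>i. i < n \<Longrightarrow> continuous_on UNIV (\<phi> i)) \<Longrightarrow> tensor_sum n (\<lambda>x. c * (\<Prod>i<n. \<phi> i (x i)))"
| tensor_sum_add: "tensor_sum n f \<Longrightarrow> tensor_sum n g \<Longrightarrow> tensor_sum n (\<lambda>x. f x + g x)"

lemma tensor_sum_mult: "tensor_sum n f \<Longrightarrow> tensor_sum n g \<Longrightarrow> tensor_sum n (\<lambda>x. f x * g x)"
proof (induction f rule: tensor_sum.induct)
  case (tensor_sum_prod \<phi> c)
  show ?case using tensor_sum_prod(2)
  proof (induction g rule: tensor_sum.induct)
    case (tensor_sum_prod \<phi>' c')
    have "tensor_sum n (\<lambda>x. (c * c') * (\<Prod>i<n. \<phi> i (x i) * \<phi>' i (x i)))"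
      by (rule tensor_sum.tensor_sum_prod) (intro continuous_intros \<open>\<And>i. i < n \<Longrightarrow> continuous_on UNIV (\<phi> i)\<close> tensor_sum_prod; assumption)
    then show ?case by (simp add: prod.distrib mult_ac)
  next
    case (tensor_sum_add f g)
    then show ?case using tensor_sum.tensor_sum_add by (simp add: distrib_left)
  qed
next
  case (tensor_sum_add f h)
  then show ?case using tensor_sum.tensor_sum_add by (simp add: distrib_right)
qed

lemma tensor_sum_continuous: "tensor_sum n f \<Longrightarrow> continuous_on S f"
proof (induction f rule: tensor_sum.induct)
  case (tensor_sum_prod \<phi> c)
  have "continuous_on S (\<lambda>x. \<phi> i (x i))" if "i < n" for i
    by (rule continuous_on_compose2[OF tensor_sum_prod[OF that]])
       (auto intro: continuous_on_subset[OF continuous_on_product_coordinates])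
  then show ?case by (intro continuous_intros) auto
next
  case (tensor_sum_add f g)
  then show ?case by (intro continuous_intros)
qed

lemma gauss_approx_tens_cutoff:
  assumes "tensor_sum n f" and \<zeta>: "continuous_on UNIV \<zeta>" "\<And>s. \<bar>s\<bar> \<ge> R \<Longrightarrow> \<zeta> s = 0"
  shows "gauss_approx n (\<lambda>x. of_real (f x * (\<Prod>i<n. \<zeta> (x i))))"
  using assms(1)
proof (induction f rule: tensor_sum.induct)
  case (tensor_sum_prod \<phi> c)
  define \<psi> where "\<psi> i s = \<phi> i s * \<zeta> s" for i s
  have cp: "continuous_on UNIV (\<psi> i)" if "i < n" for i
    unfolding \<psi>_def by (intro continuous_intros tensor_sum_prod that \<zeta>)
  have z: "\<psi> i s = 0" if "\<bar>s\<bar> \<ge> R" for i s using that by (simp add: \<psi>_def \<zeta>)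
  have a: "gauss_approx1 (\<lambda>s. of_real (\<psi> i s))" if "i < n" for i
    by (rule gauss_approx1_compact_support[OF cp[OF that] z])
  have "\<exists>C\<ge>0. \<forall>s. cmod (of_real (\<psi> i s)) \<le> C * exp (- s\<^sup>2 / 4)" if "i < n" for i
  proof -
    have "compact ((\<lambda>s. \<psi> i s * exp (s\<^sup>2 / 4)) ` {-\<bar>R\<bar>..\<bar>R\<bar>})"
      by (intro compact_continuous_image continuous_intros continuous_on_subset[OF cp[OF that]]) auto
    then have "bounded ((\<lambda>s. \<psi> i s * exp (s\<^sup>2 / 4)) ` {-\<bar>R\<bar>..\<bar>R\<bar>})" by (rule compact_imp_bounded)
    then obtain C where "\<forall>y\<in>(\<lambda>s. \<psi> i s * exp (s\<^sup>2 / 4)) ` {-\<bar>R\<bar>..\<bar>R\<bar>}. norm y \<le> C"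
      unfolding bounded_iff by blast
    then have C: "\<bar>\<psi> i s * exp (s\<^sup>2 / 4)\<bar> \<le> C" if "s \<in> {-\<bar>R\<bar>..\<bar>R\<bar>}" for s
      unfolding real_norm_def using that by (rule bspec[OF _ imageI])
    have "\<bar>\<psi> i s\<bar> \<le> max C 0 * exp (- s\<^sup>2 / 4)" for s
    proof (cases "s \<in> {-\<bar>R\<bar>..\<bar>R\<bar>}")
      case True
      then have "\<bar>\<psi> i s\<bar> * exp (s\<^sup>2 / 4) * exp (- s\<^sup>2 / 4) \<le> max C 0 * exp (- s\<^sup>2 / 4)"
        using C[OF True] by (intro mult_right_mono) (auto simp: abs_mult le_max_iff_disj)
      then show ?thesis by (simp add: mult.assoc flip: exp_add)
    next
      case False
      then have "\<bar>s\<bar> \<ge> R" by auto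
      then show ?thesis by (simp add: z)
    qed
    then show ?thesis by (intro exI[of _ "max C 0"]) auto
  qed
  then obtain C where C: "\<And>i. i < n \<Longrightarrow> C i \<ge> 0" "\<And>i s. i < n \<Longrightarrow> cmod (of_real (\<psi> i s)) \<le> C i * exp (- s\<^sup>2 / 4)"
    by metis
  have "gauss_approx n (\<lambda>x. \<Prod>i<n. of_real (\<psi> i (x i)))"
  proof (rule gauss_approx_prod[where C = "\<Sum>i<n. C i"])
    show "0 \<le> (\<Sum>i<n. C i)" using C(1) by (intro sum_nonneg) auto
    fix i s assume i: "i < n"
    have "C i \<le> (\<Sum>i<n. C i)" using C(1) i by (intro member_le_sum) auto
    then have "C i * exp (- s\<^sup>2 / 4) \<le> (\<Sum>i<n. C i) * exp (- s\<^sup>2 / 4)" by (intro mult_right_mono) auto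
    then show "cmod (of_real (\<psi> i s)) \<le> (\<Sum>i<n. C i) * exp (- s\<^sup>2 / 4)" using C(2)[OF i, of s] by linarith
  qed (rule a)
  from gauss_approx_cmult[OF this, of "of_real c"] show ?case
    by (simp add: \<psi>_def prod.distrib mult.assoc)
next
  case (tensor_sum_add f g)
  from gauss_approx_add[OF tensor_sum_add.IH] show ?case by (simp add: distrib_right)
qed

text \<open>The coordinates from \<open>n\<close> on are frozen at \<open>undefined\<close>, so the
  box is a product of compact sets over all indices and Tychonoff's theorem applies.\<close>

lemma compact_box: "compact ({..<n} \<rightarrow>\<^sub>E {a..b::real})"
proof -
  have "{..<n} \<rightarrow>\<^sub>E {a..b} = PiE UNIV (\<lambda>i. if i < n then {a..b} else {undefined})"
    by (auto simp: PiE_iff extensional_def split: if_splits)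
  moreover have "compactin (product_topology (\<lambda>_. euclidean) UNIV) (PiE UNIV (\<lambda>i. if i < n then {a..b} else {undefined::real}))"
    unfolding compactin_PiE by auto
  ultimately show ?thesis by (simp add: euclidean_product_topology)
qed

text \<open>Stone-Weierstrass says nothing about \<open>g\<close> outside the box, so
  \<open>g\<close> is multiplied by a product of cutoffs which is 1 where \<open>f\<close> is
  nonzero and 0 outside the box. This leaves \<open>f\<close> unchanged.\<close>

lemma gauss_approx_real_compact_support:
  fixes f :: "(nat \<Rightarrow> real) \<Rightarrow> real"
  assumes cont: "continuous_on (Rn n) f" and R: "R > 0"
    and supp: "\<And>x i. x \<in> Rn n \<Longrightarrow> f x \<noteq> 0 \<Longrightarrow> i < n \<Longrightarrow> \<bar>x i\<bar> \<le> R"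
  shows "gauss_approx n (\<lambda>x. of_real (f x))"
proof (rule weighted_closure_limit)
  fix e :: real assume e: "e > 0"
  define S where "S = ({..<n} \<rightarrow>\<^sub>E {- 2 * R..2 * R})"
  define \<zeta> where "\<zeta> s = max 0 (min 1 (2 - \<bar>s\<bar> / R))" for s
  have \<zeta>: "continuous_on UNIV \<zeta>" "\<And>s. \<bar>s\<bar> \<ge> 2 * R \<Longrightarrow> \<zeta> s = 0" "\<And>s. \<bar>s\<bar> \<le> R \<Longrightarrow> \<zeta> s = 1" "\<And>s. 0 \<le> \<zeta> s" "\<And>s. \<zeta> s \<le> 1"
  proof -
    show "continuous_on UNIV \<zeta>" unfolding \<zeta>_def using R by (intro continuous_intros) auto
  qed (use R in \<open>auto simp: \<zeta>_def field_simps max_def min_def\<close>)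
  have SR: "S \<subseteq> Rn n" by (auto simp: S_def Rn_def PiE_iff)
  interpret function_ring_on "Collect (tensor_sum n)" S
  proof
    show "compact S" unfolding S_def by (rule compact_box)
    show "\<And>f. f \<in> Collect (tensor_sum n) \<Longrightarrow> continuous_on S f" by (simp add: tensor_sum_continuous)
    show "\<And>f g. f \<in> Collect (tensor_sum n) \<Longrightarrow> g \<in> Collect (tensor_sum n) \<Longrightarrow> (\<lambda>x. f x + g x) \<in> Collect (tensor_sum n)" by (simp add: tensor_sum_add)
    show "\<And>f g. f \<in> Collect (tensor_sum n) \<Longrightarrow> g \<in> Collect (tensor_sum n) \<Longrightarrow> (\<lambda>x. f x * g x) \<in> Collect (tensor_sum n)" by (simp add: tensor_sum_mult)
    show "(\<lambda>_. c) \<in> Collect (tensor_sum n)" for c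
      using tensor_sum_prod[of n "\<lambda>_ _. 1" c] by simp
    fix x y assume xy: "x \<in> S" "y \<in> S" "x \<noteq> y"
    then obtain i where i: "i < n" "x i \<noteq> y i" using PiE_ext[of x "{..<n}" _ y] unfolding S_def by blast
    have "tensor_sum n (\<lambda>x. 1 * (\<Prod>k<n. (if k = i then x k else 1)))"
    proof (rule tensor_sum_prod[of n "\<lambda>k s. if k = i then s else 1"])
      show "continuous_on UNIV (\<lambda>s::real. if k = i then s else 1)" for k
        by (cases "k = i") auto
    qed
    then have "tensor_sum n (\<lambda>x. x i)" using i by (simp add: prod.delta)
    then show "\<exists>f\<in>Collect (tensor_sum n). f x \<noteq> f y" using i by auto
  qed
  \<comment> \<open>A lower bound for \<open>gauss n\<close> on the box, where
    \<open>\<bar>x i\<bar> \<le> 2 * R\<close>; it converts the uniform error on the box into a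
    weighted one.\<close>
  define \<gamma> where "\<gamma> = exp (- R\<^sup>2) ^ n"
  have "\<exists>g\<in>Collect (tensor_sum n). \<forall>x\<in>S. \<bar>f x - g x\<bar> < e * \<gamma>"
    using e by (intro Stone_Weierstrass_basic continuous_on_subset[OF cont SR]) (simp add: \<gamma>_def)
  then obtain g where g: "tensor_sum n g" "\<And>x. x \<in> S \<Longrightarrow> \<bar>f x - g x\<bar> < e * \<gamma>" by auto
  have "cmod (of_real (g x * (\<Prod>i<n. \<zeta> (x i))) - of_real (f x)) \<le> e * gauss n x" if x: "x \<in> Rn n" for x
  proof -
    define P where "P = (\<Prod>i<n. \<zeta> (x i))"
    have P: "0 \<le> P" "P \<le> 1" unfolding P_def using \<zeta> by (auto intro!: prod_nonneg prod_le_1)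
    have fP: "f x = f x * P"
    proof (cases "f x = 0")
      case False
      then have "P = 1" unfolding P_def using supp[OF x] \<zeta>(3) by (intro prod.neutral) auto
      then show ?thesis by simp
    qed simp
    have "\<bar>g x * P - f x\<bar> \<le> e * gauss n x"
    proof (cases "x \<in> S")
      case True
      have "\<bar>g x * P - f x\<bar> = \<bar>f x - g x\<bar> * P"
        using P by (subst fP) (simp add: abs_mult abs_minus_commute flip: left_diff_distrib)
      also have "\<dots> \<le> (e * \<gamma>) * 1" using g(2)[OF True] P by (intro mult_mono) auto
      also have "\<gamma> \<le> gauss n x"
      proof -
        have "(\<Prod>i<n. exp (- R\<^sup>2)) \<le> gauss n x"
          unfolding gauss_def
        proof (intro prod_mono conjI)
          fix i assume "i \<in> {..<n}"
          with True have "x i \<in> {- 2 * R..2 * R}" unfolding S_def by (rule PiE_mem)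
          then have "\<bar>x i\<bar> \<le> 2 * R" by auto
          then have "\<bar>x i\<bar>\<^sup>2 \<le> (2 * R)\<^sup>2" by (intro power_mono) auto
          then show "exp (- R\<^sup>2) \<le> exp (- (x i)\<^sup>2 / 4)" by (simp add: power_mult_distrib)
        qed auto
        then show ?thesis by (simp add: \<gamma>_def)
      qed
      finally show ?thesis using e by simp
    next
      case False
      then obtain i where i: "i < n" "x i \<notin> {- 2 * R..2 * R}"
        using x unfolding S_def Rn_def by (auto simp: PiE_iff)
      then have "\<bar>x i\<bar> \<ge> 2 * R" by auto
      then have "P = 0" unfolding P_def using i \<zeta>(2) by (intro prod_zero) auto
      then have "g x * P - f x = 0" using fP by simp
      then show ?thesis using e gauss_pos[of n x] by simp
    qed
    then show ?thesis unfolding P_def[symmetric] of_real_diff[symmetric] norm_of_real .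
  qed
  moreover have "gauss_approx n (\<lambda>x. of_real (g x * (\<Prod>i<n. \<zeta> (x i))))"
    by (rule gauss_approx_tens_cutoff[OF g(1) \<zeta>(1,2)])
  ultimately show "\<exists>g. gauss_approx n g \<and> (\<forall>x\<in>Rn n. cmod (g x - of_real (f x)) \<le> e * gauss n x)" by blast
qed

lemma support_bounded:
  fixes u :: "(nat \<Rightarrow> real) \<Rightarrow> complex"
  assumes "compact (closure {x \<in> Rn n. u x \<noteq> 0})"
  shows "\<exists>R>0. \<forall>x\<in>Rn n. u x \<noteq> 0 \<longrightarrow> (\<forall>i<n. \<bar>x i\<bar> \<le> R)"
proof -
  have "\<exists>r. \<forall>x\<in>Rn n. u x \<noteq> 0 \<longrightarrow> \<bar>x i\<bar> \<le> r" for i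
  proof -
    have "compact ((\<lambda>x. x i) ` closure {x \<in> Rn n. u x \<noteq> 0})"
      by (intro compact_continuous_image continuous_on_subset[OF continuous_on_product_coordinates] assms) auto
    then have "bounded ((\<lambda>x. x i) ` closure {x \<in> Rn n. u x \<noteq> 0})" by (rule compact_imp_bounded)
    then obtain r where "\<forall>y\<in>(\<lambda>x. x i) ` closure {x \<in> Rn n. u x \<noteq> 0}. \<bar>y\<bar> \<le> r"
      unfolding bounded_iff real_norm_def by blast
    then show ?thesis using closure_subset[of "{x \<in> Rn n. u x \<noteq> 0}"] by blast
  qed
  then obtain r where r: "\<And>i x. x \<in> Rn n \<Longrightarrow> u x \<noteq> 0 \<Longrightarrow> \<bar>x i\<bar> \<le> r i" by metis
  have "\<bar>x i\<bar> \<le> 1 + (\<Sum>i<n. \<bar>r i\<bar>)" if "x \<in> Rn n" "u x \<noteq> 0" "i < n" for x i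
  proof -
    have "\<bar>r i\<bar> \<le> (\<Sum>i<n. \<bar>r i\<bar>)" using that by (intro member_le_sum) auto
    then show ?thesis using r[OF that(1,2), of i] by linarith
  qed
  moreover have "1 + (\<Sum>i<n. \<bar>r i\<bar>) > 0" by (simp add: add_pos_nonneg sum_nonneg)
  ultimately show ?thesis by blast
qed

lemma gauss_approx_compact_support:
  fixes u :: "(nat \<Rightarrow> real) \<Rightarrow> complex"
  assumes "continuous_on (Rn n) u" "compact (closure {x \<in> Rn n. u x \<noteq> 0})"
  shows "gauss_approx n u"
proof -
  obtain R where R: "R > 0" "\<And>x i. x \<in> Rn n \<Longrightarrow> u x \<noteq> 0 \<Longrightarrow> i < n \<Longrightarrow> \<bar>x i\<bar> \<le> R"
    using support_bounded[OF assms(2)] by blast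
  have "gauss_approx n (\<lambda>x. of_real (Re (u x)))" "gauss_approx n (\<lambda>x. of_real (Im (u x)))"
    by (rule gauss_approx_real_compact_support[of n _ R]; use R in \<open>auto intro!: continuous_intros assms R(2)\<close>)+
  from gauss_approx_add[OF this(1) gauss_approx_cmult[OF this(2), of \<i>]] show ?thesis
    by (simp add: complex_eq[symmetric])
qed

section \<open>The bilinear embedding\<close>

lemma powr_le_gauss:
  assumes "0 \<le> y" "y \<le> P * (gauss n x)\<^sup>2" "P \<ge> 0" "r \<ge> 1 / 2"
  shows "y powr r \<le> P powr r * gauss n x"
proof -
  have g: "gauss n x > 0" "gauss n x \<le> 1" by (rule gauss_pos, rule gauss_le_1)
  have "y powr r \<le> (P * (gauss n x)\<^sup>2) powr r" using assms by (intro powr_mono2) auto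
  also have "\<dots> = P powr r * (gauss n x)\<^sup>2 powr r" using assms by (simp add: powr_mult)
  also have "(gauss n x)\<^sup>2 powr r = gauss n x powr (2 * r)" using g by (simp add: powr_powr flip: powr_numeral)
  also have "\<dots> \<le> gauss n x powr 1" using g assms by (intro powr_mono') auto
  finally show ?thesis using g by (simp add: mult_left_mono)
qed

lemma norm_CN_nonneg: "norm_CN N v \<ge> 0"
  unfolding norm_CN_def by (rule L2_set_nonneg)

lemma norm2_CN_powr: "norm2_CN N v powr r = norm_CN N v powr (2 * r)"
proof (cases "norm_CN N v = 0")
  case True
  then show ?thesis by (simp flip: norm_CN_sq)
next
  case False
  then have "norm_CN N v > 0" using norm_CN_nonneg[of N v] by simp
  then show ?thesis by (simp add: powr_powr flip: norm_CN_sq powr_numeral)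
qed

lemma norm2_CN_gauss_bound:
  assumes "\<And>i. i < N \<Longrightarrow> cmod (v i) \<le> K * gauss n x"
  shows "norm2_CN N v \<le> (real N * K\<^sup>2) * (gauss n x)\<^sup>2"
proof -
  have "norm2_CN N v \<le> (\<Sum>i<N. (K * gauss n x)\<^sup>2)"
    unfolding norm2_CN_def using assms by (intro sum_mono) (simp add: power2_norm_eq_inner[symmetric] power_mono)
  then show ?thesis by (simp add: power_mult_distrib mult_ac)
qed

lemma norm_CN_powr_gauss_bound:
  assumes "\<And>i. i < N \<Longrightarrow> cmod (v i) \<le> K * gauss n x" "r \<ge> 1"
  shows "norm_CN N v powr r \<le> (real N * K\<^sup>2) powr (r / 2) * gauss n x"
  using powr_le_gauss[OF norm2_CN_nonneg norm2_CN_gauss_bound[OF assms(1)], where r = "r / 2"] assms(2) by (simp add: norm2_CN_powr)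

lemma hermite_sums_gauss_bound:
  fixes N :: nat
  shows "\<exists>K\<ge>0. \<forall>i<N. \<forall>x. cmod (hermite_sum n A (c i) x) \<le> K * gauss n x"
proof -
  obtain K where K: "\<And>i. K i \<ge> 0" "\<And>i x. cmod (hermite_sum n A (c i) x) \<le> K i * gauss n x"
  proof -
    have "\<forall>i. \<exists>K\<ge>0. \<forall>x. cmod (hermite_sum n A (c i) x) \<le> K * gauss n x"
      using hermite_sum_gauss_bound by blast
    then show ?thesis using that by metis
  qed
  have "cmod (hermite_sum n A (c i) x) \<le> (\<Sum>i<N. K i) * gauss n x" if "i < N" for i x
  proof -
    have "K i \<le> (\<Sum>i<N. K i)" using that K(1) by (intro member_le_sum) auto
    then have "K i * gauss n x \<le> (\<Sum>i<N. K i) * gauss n x" using gauss_pos[of n x] by (intro mult_right_mono) auto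
    then show ?thesis using K(2)[of i x] by linarith
  qed
  then show ?thesis using K(1) by (intro exI[of _ "\<Sum>i<N. K i"]) (auto intro: sum_nonneg)
qed

lemma measurable_norm_CN [measurable (raw)]:
  assumes "\<And>i. i < N \<Longrightarrow> (\<lambda>x. f x i) \<in> borel_measurable Q"
  shows "(\<lambda>x. norm_CN N (f x)) \<in> borel_measurable Q"
proof -
  have "(\<lambda>x. sqrt (inner_CN N (f x) (f x))) \<in> borel_measurable Q"
    unfolding inner_CN_def using assms by (intro measurable_compose[OF _ borel_measurable_sqrt] borel_measurable_sum borel_measurable_inner) auto
  moreover have "sqrt (inner_CN N (f x) (f x)) = norm_CN N (f x)" for x
    using norm_CN_sq[of N "f x"] norm_CN_nonneg[of N "f x"] by (metis real_sqrt_unique norm2_CN_eq_ip)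
  ultimately show ?thesis by simp
qed

section \<open>Removing the shift\<close>

context bellman
begin

text \<open>For \<open>e > 0\<close> the sharp bound \<open>H e\<close> is not integrable over the
  space, while the majorant \<open>mm\<close> from \<open>bell_increment\<close> is integrable but
  has the wrong constants. Their minimum is dominated by \<open>mm\<close> and tends to a limit
  below \<open>H 0\<close>, so both virtues survive.\<close>

lemma finite_estimate_sum:
  assumes n: "n \<ge> 1" and A: "finite A" and A': "finite A'"
  shows "(\<integral>\<^sup>+t\<in>{0<..}. ((\<integral>\<^sup>+x. ennreal (star_series n M A c x t * star_series n N A' d x t) \<partial>lebesgue_Rn n) * ennreal t) \<partial>lborel)
    \<le> ennreal (6 * m * ((\<integral>x. norm_CN M (\<lambda>i. hermite_sum n A (c i) x) powr (m + 1) \<partial>lebesgue_Rn n)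
       + (\<integral>x. norm_CN N (\<lambda>i. hermite_sum n A' (d i) x) powr (1 + 1 / m) \<partial>lebesgue_Rn n)))"
    (is "?I \<le> ennreal (6 * m * (?a + ?b))")
proof -
  define f where "f x i = hermite_sum n A (c i) x" for x i
  define g where "g x i = hermite_sum n A' (d i) x" for x i
  obtain K1 where K1: "K1 \<ge> 0" "\<And>i x. i < M \<Longrightarrow> cmod (f x i) \<le> K1 * gauss n x"
    using hermite_sums_gauss_bound[of M n A c] unfolding f_def by blast
  obtain K2 where K2: "K2 \<ge> 0" "\<And>i x. i < N \<Longrightarrow> cmod (g x i) \<le> K2 * gauss n x"
    using hermite_sums_gauss_bound[of N n A' d] unfolding g_def by blast
  have fm [measurable]: "(\<lambda>x. f x i) \<in> borel_measurable (lebesgue_Rn n)" for i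
    unfolding f_def by measurable
  have gm [measurable]: "(\<lambda>x. g x i) \<in> borel_measurable (lebesgue_Rn n)" for i
    unfolding g_def by measurable
  have [measurable]: "(\<lambda>x. norm2_CN M (f x)) \<in> borel_measurable (lebesgue_Rn n)" "(\<lambda>x. norm2_CN N (g x)) \<in> borel_measurable (lebesgue_Rn n)"
    unfolding norm2_CN_eq_ip by (intro measurable_ip fm gm)+
  define P where "P = real M * K1\<^sup>2 + real N * K2\<^sup>2"
  have P: "P \<ge> 0" by (simp add: P_def)
  have g1: "(gauss n x)\<^sup>2 \<le> gauss n x" "(gauss n x)\<^sup>2 \<le> 1" for x
    using gauss_pos[of n x] gauss_le_1[of n x] by (auto simp: power2_eq_square mult_left_le mult_le_one less_imp_le)
  have fP: "norm2_CN M (f x) \<le> P * (gauss n x)\<^sup>2" and gP: "norm2_CN N (g x) \<le> P * (gauss n x)\<^sup>2" for x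
  proof -
    have "real M * K1\<^sup>2 * (gauss n x)\<^sup>2 \<le> P * (gauss n x)\<^sup>2" "real N * K2\<^sup>2 * (gauss n x)\<^sup>2 \<le> P * (gauss n x)\<^sup>2"
      by (intro mult_right_mono; simp add: P_def)+
    then show "norm2_CN M (f x) \<le> P * (gauss n x)\<^sup>2" "norm2_CN N (g x) \<le> P * (gauss n x)\<^sup>2"
      using norm2_CN_gauss_bound[of M "f x" K1 n x, OF K1(2)] norm2_CN_gauss_bound[of N "g x" K2 n x, OF K2(2)] by linarith+
  qed
  have fP1: "norm2_CN M (f x) \<le> P * gauss n x" "norm2_CN M (f x) \<le> P" and gP1: "norm2_CN N (g x) \<le> P * gauss n x" "norm2_CN N (g x) \<le> P" for x
    using fP[of x] gP[of x] mult_left_mono[OF g1(1)[of x] P] mult_left_mono[OF g1(2)[of x] P] by linarith+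
  obtain Ki where Ki: "Ki \<ge> 0" "\<And>e A B. 0 < e \<Longrightarrow> e \<le> 1 \<Longrightarrow> 0 \<le> A \<Longrightarrow> A \<le> P \<Longrightarrow> 0 \<le> B \<Longrightarrow> B \<le> P \<Longrightarrow>
    bell (A + e) (B + e) - bell e e \<le> Ki * (A + B + B powr (1 - sg))"
    using bell_increment[OF P] by blast
  define mm where "mm x = Ki * (norm2_CN M (f x) + norm2_CN N (g x) + norm2_CN N (g x) powr (1 - sg))" for x
  define H where "H e x = 2 * ((norm2_CN M (f x) + e) powr ((m + 1) / 2) + (norm2_CN N (g x) + e) powr (1 - sg))" for e x
  define S where "S e x = min (mm x) (H e x)" for e x
  have [measurable]: "mm \<in> borel_measurable (lebesgue_Rn n)" "H e \<in> borel_measurable (lebesgue_Rn n)" for e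
    unfolding mm_def H_def by measurable
  have [measurable]: "S e \<in> borel_measurable (lebesgue_Rn n)" for e unfolding S_def by measurable
  have mm0: "mm x \<ge> 0" for x unfolding mm_def using Ki(1) norm2_CN_nonneg by (intro mult_nonneg_nonneg add_nonneg_nonneg) auto
  have H0: "H e x \<ge> 0" for e x unfolding H_def by simp
  have sg1: "1 - sg \<ge> 1 / 2" using sg by simp
  have pg: "norm2_CN N (g x) powr (1 - sg) \<le> P powr (1 - sg) * gauss n x" for x
    by (rule powr_le_gauss[OF norm2_CN_nonneg gP P sg1])
  have pf: "norm2_CN M (f x) powr ((m + 1) / 2) \<le> P powr ((m + 1) / 2) * gauss n x" for x
    using m by (intro powr_le_gauss[OF norm2_CN_nonneg fP P]) auto
  have mmb: "mm x \<le> (Ki * (P + P + P powr (1 - sg))) * gauss n x" for x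
    unfolding mm_def using fP1(1)[of x] gP1(1)[of x] pg[of x] Ki(1)
      mult_left_mono[of "norm2_CN M (f x) + norm2_CN N (g x) + norm2_CN N (g x) powr (1 - sg)" "P * gauss n x + P * gauss n x + P powr (1 - sg) * gauss n x" Ki]
    by (simp add: algebra_simps)
  have imm: "integrable (lebesgue_Rn n) mm"
    by (rule integrable_gauss_bound[where K = "Ki * (P + P + P powr (1 - sg))"]) (use mmb mm0 in auto)
  have Smm: "\<bar>S e x\<bar> \<le> mm x" for e x
    unfolding S_def using mm0[of x] H0[of e x] by (auto simp: min_def)
  have iS: "integrable (lebesgue_Rn n) (S e)" for e
    by (rule Bochner_Integration.integrable_bound[OF imm]) (use Smm mm0 in auto)
  have if': "integrable (lebesgue_Rn n) (\<lambda>x. norm2_CN M (f x) powr ((m + 1) / 2))"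
    by (rule integrable_gauss_bound[where K = "P powr ((m + 1) / 2)"]) (use pf in auto)
  have ig: "integrable (lebesgue_Rn n) (\<lambda>x. norm2_CN N (g x) powr (1 - sg))"
    by (rule integrable_gauss_bound[where K = "P powr (1 - sg)"]) (use pg in auto)
  have iH: "integrable (lebesgue_Rn n) (H 0)"
    unfolding H_def using if' ig by simp
  have bS: "beta0 M N e (f x) (g x) \<le> S e x" if e: "0 < e" "e \<le> 1" for e x
  proof -
    have "bell e e \<ge> 0" unfolding bell_def using e del_pos by simp
    then have "beta0 M N e (f x) (g x) \<le> bell (norm2_CN M (f x) + e) (norm2_CN N (g x) + e)" unfolding beta0_def by simp
    also have "\<dots> \<le> H e x" unfolding H_def by (intro bell_upper norm2_CN_plus_pos e)
    finally show ?thesis unfolding S_def mm_def beta0_def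
      using Ki(2)[OF e norm2_CN_nonneg fP1(2) norm2_CN_nonneg gP1(2)] by simp
  qed
  have le: "?I \<le> ennreal (3 * m * (\<integral>x. S e x \<partial>lebesgue_Rn n))" if e: "0 < e" "e \<le> 1" for e
  proof -
    have "(\<integral>x. beta0 M N e (f x) (g x) \<partial>lebesgue_Rn n) \<le> (\<integral>x. S e x \<partial>lebesgue_Rn n)"
    proof (intro integral_mono iS bS e)
      show "integrable (lebesgue_Rn n) (\<lambda>x. beta0 M N e (f x) (g x))"
      proof (rule Bochner_Integration.integrable_bound[OF iS[of e]])
        show "(\<lambda>x. beta0 M N e (f x) (g x)) \<in> borel_measurable (lebesgue_Rn n)"
          unfolding beta0_def by measurable
        show "AE x in lebesgue_Rn n. norm (beta0 M N e (f x) (g x)) \<le> norm (S e x)"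
          using order_trans[OF bS[OF e] abs_ge_self] by (intro AE_I2) (simp add: beta0_nonneg[OF e(1)])
      qed
    qed
    then have "3 * m * (\<integral>x. beta0 M N e (f x) (g x) \<partial>lebesgue_Rn n) \<le> 3 * m * (\<integral>x. S e x \<partial>lebesgue_Rn n)"
      using m by (intro mult_left_mono) auto
    then show ?thesis using finite_estimate_eps[OF n A A' e, of M c N d]
      unfolding f_def[abs_def] g_def[abs_def] by (meson ennreal_leI order_trans)
  qed
  define \<epsilon> where "\<epsilon> k = 1 / (real k + 1)" for k :: nat
  have \<epsilon>: "0 < \<epsilon> k" "\<epsilon> k \<le> 1" for k by (auto simp: \<epsilon>_def)
  have \<epsilon>0: "\<epsilon> \<longlonglongrightarrow> 0" unfolding \<epsilon>_def by real_asymp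
  have "(\<lambda>k. \<integral>x. S (\<epsilon> k) x \<partial>lebesgue_Rn n) \<longlonglongrightarrow> (\<integral>x. S 0 x \<partial>lebesgue_Rn n)"
  proof (rule integral_dominated_convergence[OF _ _ imm])
    show "AE x in lebesgue_Rn n. (\<lambda>k. S (\<epsilon> k) x) \<longlonglongrightarrow> S 0 x"
    proof (intro AE_I2)
      fix x
      have p: "(\<lambda>k. (y + \<epsilon> k) powr r) \<longlonglongrightarrow> (y + 0) powr r" if "y \<ge> 0" "r > 0" for y r :: real
        using that \<epsilon>(1) by (intro tendsto_powr' tendsto_add tendsto_const \<epsilon>0) (auto intro!: always_eventually add_nonneg_nonneg less_imp_le)
      show "(\<lambda>k. S (\<epsilon> k) x) \<longlonglongrightarrow> S 0 x"
        unfolding S_def H_def using sg m by (intro tendsto_intros p norm2_CN_nonneg) auto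
    qed
    show "AE x in lebesgue_Rn n. norm (S (\<epsilon> k) x) \<le> mm x" for k
      using Smm by simp
  qed measurable
  then have "(\<lambda>k. ennreal (3 * m * (\<integral>x. S (\<epsilon> k) x \<partial>lebesgue_Rn n))) \<longlonglongrightarrow> ennreal (3 * m * (\<integral>x. S 0 x \<partial>lebesgue_Rn n))"
    by (intro tendsto_ennrealI tendsto_mult tendsto_const)
  then have "?I \<le> ennreal (3 * m * (\<integral>x. S 0 x \<partial>lebesgue_Rn n))"
    by (rule LIMSEQ_le_const) (use le \<epsilon> in blast)
  also have "(\<integral>x. S 0 x \<partial>lebesgue_Rn n) \<le> (\<integral>x. H 0 x \<partial>lebesgue_Rn n)"
    by (intro integral_mono iS iH) (simp add: S_def)
  then have "ennreal (3 * m * (\<integral>x. S 0 x \<partial>lebesgue_Rn n)) \<le> ennreal (3 * m * (\<integral>x. H 0 x \<partial>lebesgue_Rn n))"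
    using m by (intro ennreal_leI mult_left_mono) auto
  also have "(\<integral>x. H 0 x \<partial>lebesgue_Rn n) = 2 * (?a + ?b)"
  proof -
    have 1: "2 * ((m + 1) / 2) = m + 1" and 2: "2 * (1 - sg) = 1 + 1 / m" using sg(3) by (auto simp: field_simps)
    have "(\<integral>x. H 0 x \<partial>lebesgue_Rn n) = 2 * ((\<integral>x. norm2_CN M (f x) powr ((m + 1) / 2) \<partial>lebesgue_Rn n) + (\<integral>x. norm2_CN N (g x) powr (1 - sg) \<partial>lebesgue_Rn n))"
      unfolding H_def using if' ig by simp
    then show ?thesis unfolding norm2_CN_powr 1 2 f_def[abs_def] g_def[abs_def] .
  qed
  also have "3 * m * (2 * (?a + ?b)) = 6 * m * (?a + ?b)" by simp
  finally show ?thesis .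
qed

end

section \<open>From sums of integrals to products of norms\<close>

lemma star_series_scale:
  assumes "finite A" "l \<ge> 0"
  shows "star_series n N A (\<lambda>i \<alpha>. of_real l * c i \<alpha>) x t = l * star_series n N A c x t"
proof -
  have s: "norm2_CN N (\<lambda>i. mode_sum A (\<lambda>\<alpha>. of_real l * c i \<alpha>) \<phi>) = l\<^sup>2 * norm2_CN N (\<lambda>i. mode_sum A (c i) \<phi>)" for \<phi>
  proof -
    have "mode_sum A (\<lambda>\<alpha>. of_real l * c i \<alpha>) \<phi> = l *\<^sub>R mode_sum A (c i) \<phi>" for i
      unfolding mode_sum_def by (simp add: sum_distrib_left scaleR_conv_of_real mult.assoc)
    then show ?thesis unfolding norm2_CN_def by (simp add: sum_distrib_left power2_eq_square mult.assoc)
  qed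
  have "star_series n N A (\<lambda>i \<alpha>. of_real l * c i \<alpha>) x t
    = sqrt (l\<^sup>2 * ((\<Sum>j\<le>n. norm2_CN N (\<lambda>i. mode_sum A (c i) (\<lambda>\<alpha>. mode1 n j t \<alpha> x))) + (norm_Rn n x)\<^sup>2 * norm2_CN N (\<lambda>i. mode_sum A (c i) (\<lambda>\<alpha>. mode n t \<alpha> x))))"
    unfolding star_series_finite[OF assms(1)] s by (simp add: sum_distrib_left algebra_simps)
  then show ?thesis
    unfolding star_series_finite[OF assms(1)] using assms(2) by (simp add: real_sqrt_mult)
qed

lemma norm_CN_hermite_sum_scale:
  assumes "l \<ge> 0"
  shows "norm_CN N (\<lambda>i. hermite_sum n A (\<lambda>\<alpha>. of_real l * c i \<alpha>) x) = l * norm_CN N (\<lambda>i. hermite_sum n A (c i) x)"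
proof -
  have "hermite_sum n A (\<lambda>\<alpha>. of_real l * c i \<alpha>) x = of_real l * hermite_sum n A (c i) x" for i
    unfolding hermite_sum_def by (simp add: sum_distrib_left mult.assoc)
  then show ?thesis
    using assms unfolding norm_CN_def by (simp add: norm_mult L2_set_right_distrib)
qed

lemma measurable_star_ser_finite:
  assumes "finite A"
  shows "(\<lambda>z. star_series n N A c (snd z) (fst z)) \<in> borel_measurable (borel \<Otimes>\<^sub>M lebesgue_Rn n)"
proof -
  have [measurable]: "norm_Rn n \<in> borel_measurable (lebesgue_Rn n)"
    unfolding norm_Rn_def L2_set_def lebesgue_Rn_def by measurable
  have [measurable]: "(\<lambda>z. norm2_CN N (\<lambda>i. mode_sum A (c i) (\<lambda>\<alpha>. mode1 n j (fst z) \<alpha> (snd z)))) \<in> borel_measurable (borel \<Otimes>\<^sub>M lebesgue_Rn n)" if "j \<le> n" for j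
    unfolding norm2_CN_eq_ip by (intro measurable_ip mode_sum_measurable measurable_mode that)
  have [measurable]: "(\<lambda>z. norm2_CN N (\<lambda>i. mode_sum A (c i) (\<lambda>\<alpha>. mode n (fst z) \<alpha> (snd z)))) \<in> borel_measurable (borel \<Otimes>\<^sub>M lebesgue_Rn n)"
    unfolding norm2_CN_eq_ip by (intro measurable_ip mode_sum_measurable measurable_mode(1)[OF order_refl])
  show ?thesis unfolding star_series_finite[OF assms] by measurable
qed

definition half_space_integral :: "nat \<Rightarrow> ((nat \<Rightarrow> real) \<Rightarrow> real \<Rightarrow> real) \<Rightarrow> ennreal" where
  "half_space_integral n h = (\<integral>\<^sup>+t\<in>{0<..}. ((\<integral>\<^sup>+x. ennreal (h x t) \<partial>lebesgue_Rn n) * ennreal t) \<partial>lborel)"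

lemma half_space_integral_cmult:
  assumes [measurable]: "(\<lambda>z. h (snd z) (fst z)) \<in> borel_measurable (borel \<Otimes>\<^sub>M lebesgue_Rn n)" and "l \<ge> 0"
  shows "half_space_integral n (\<lambda>x t. l * h x t) = ennreal l * half_space_integral n h"
proof -
  interpret L: sigma_finite_measure "lebesgue_Rn n" by (rule sigma_finite_lebesgue_Rn)
  have [measurable]: "(\<lambda>x. h x t) \<in> borel_measurable (lebesgue_Rn n)" for t
    using measurable_compose[OF measurable_Pair1' assms(1), of t] by simp
  have "(\<lambda>z. h (snd z) (fst z)) \<in> borel_measurable (lborel \<Otimes>\<^sub>M lebesgue_Rn n)"
    using assms(1) by (simp cong: measurable_cong_sets)
  then have [measurable]: "(\<lambda>t. \<integral>\<^sup>+x. ennreal (h x t) \<partial>lebesgue_Rn n) \<in> borel_measurable lborel"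
    by (intro L.borel_measurable_nn_integral) (simp add: case_prod_beta)
  have "half_space_integral n (\<lambda>x t. l * h x t) = (\<integral>\<^sup>+t\<in>{0<..}. (ennreal l * (\<integral>\<^sup>+x. ennreal (h x t) \<partial>lebesgue_Rn n) * ennreal t) \<partial>lborel)"
    unfolding half_space_integral_def
    by (intro nn_integral_cong arg_cong2[where f = "(*)"] refl) (simp add: ennreal_mult' assms(2) nn_integral_cmult)
  also have "\<dots> = ennreal l * half_space_integral n h"
    unfolding half_space_integral_def by (subst nn_integral_cmult[symmetric]) (auto simp: mult_ac)
  finally show ?thesis .
qed

text \<open>Replacing \<open>f, g\<close> by \<open>\<lambda>f, \<mu>g\<close> and optimizing turns the sum of integrals into a product of norms.\<close>

lemma finite_estimate:
  assumes n: "n \<ge> 1" and A: "finite A" and A': "finite A'" and p: "p \<ge> 2" "q = p / (p - 1)"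
  shows "half_space_integral n (\<lambda>x t. star_series n M A c x t * star_series n N A' d x t)
    \<le> ennreal (12 * (p - 1) * Lp_norm n M p (\<lambda>x i. hermite_sum n A (c i) x) * Lp_norm n N q (\<lambda>x i. hermite_sum n A' (d i) x))"
proof -
  interpret bellman "p - 1" by unfold_locales (use p in simp)
  define a where "a = (\<integral>x. norm_CN M (\<lambda>i. hermite_sum n A (c i) x) powr p \<partial>lebesgue_Rn n)"
  define b where "b = (\<integral>x. norm_CN N (\<lambda>i. hermite_sum n A' (d i) x) powr q \<partial>lebesgue_Rn n)"
  have q: "1 + 1 / (p - 1) = q" "q > 1" using p by (simp_all add: add_divide_eq_iff less_divide_eq)
  have ab: "a \<ge> 0" "b \<ge> 0" unfolding a_def b_def by (intro integral_nonneg_AE AE_I2; simp)+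
  define I where "I = half_space_integral n (\<lambda>x t. star_series n M A c x t * star_series n N A' d x t)"
  have [measurable]: "(\<lambda>z. star_series n M A c (snd z) (fst z)) \<in> borel_measurable (borel \<Otimes>\<^sub>M lebesgue_Rn n)"
    "(\<lambda>z. star_series n N A' d (snd z) (fst z)) \<in> borel_measurable (borel \<Otimes>\<^sub>M lebesgue_Rn n)"
    by (intro measurable_star_ser_finite A A')+
  have scaled: "ennreal (l * k) * I \<le> ennreal (6 * (p - 1) * (l powr p * a + k powr q * b))" if lk: "l > 0" "k > 0" for l k
  proof -
    have "ennreal (l * k) * I = half_space_integral n (\<lambda>x t. star_series n M A (\<lambda>i \<alpha>. of_real l * c i \<alpha>) x t * star_series n N A' (\<lambda>i \<alpha>. of_real k * d i \<alpha>) x t)"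
      unfolding I_def using lk A A'
      by (subst half_space_integral_cmult[symmetric]) (auto simp: star_series_scale mult_ac)
    also have "\<dots> \<le> ennreal (6 * (p - 1) * ((\<integral>x. (l * norm_CN M (\<lambda>i. hermite_sum n A (c i) x)) powr p \<partial>lebesgue_Rn n)
       + (\<integral>x. (k * norm_CN N (\<lambda>i. hermite_sum n A' (d i) x)) powr q \<partial>lebesgue_Rn n)))"
      using finite_estimate_sum[OF n A A', of M "\<lambda>i \<alpha>. of_real l * c i \<alpha>" N "\<lambda>i \<alpha>. of_real k * d i \<alpha>"] lk q(1)
      unfolding half_space_integral_def by (simp add: norm_CN_hermite_sum_scale)
    also have "\<dots> = ennreal (6 * (p - 1) * (l powr p * a + k powr q * b))"
      using lk unfolding a_def b_def by (simp add: powr_mult norm_CN_nonneg)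
    finally show ?thesis .
  qed
  have eta: "I \<le> ennreal (12 * (p - 1) * ((a powr (1 / p) + \<eta>) * (b powr (1 / q) + \<eta>)))" if "\<eta> > 0" for \<eta>
  proof -
    \<comment> \<open>The optimal scalings are the inverses of the norms. Adding \<eta> keeps them
      finite when a norm is 0; afterwards \<eta> tends to 0.\<close>
    define x where "x = a powr (1 / p) + \<eta>"
    define y where "y = b powr (1 / q) + \<eta>"
    have xy: "x > 0" "y > 0" using that by (auto simp: x_def y_def add_nonneg_pos)
    have "a = (a powr (1 / p)) powr p" "b = (b powr (1 / q)) powr q" using ab p q by (auto simp: powr_powr)
    moreover have "(a powr (1 / p)) powr p \<le> x powr p" "(b powr (1 / q)) powr q \<le> y powr q"
      unfolding x_def y_def using that p q by (intro powr_mono2; simp)+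
    ultimately have "a \<le> x powr p" "b \<le> y powr q" by simp_all
    then have 1: "inverse x powr p * a \<le> 1" "inverse y powr q * b \<le> 1"
      using xy by (auto simp: inverse_powr divide_le_eq simp flip: divide_inverse_commute)
    have "ennreal (inverse x * inverse y) * I \<le> ennreal (6 * (p - 1) * (inverse x powr p * a + inverse y powr q * b))"
      using xy by (intro scaled) auto
    also have "\<dots> \<le> ennreal (6 * (p - 1) * (1 + 1))"
      using 1 p by (intro ennreal_leI mult_left_mono add_mono) auto
    finally have "ennreal (x * y) * (ennreal (inverse x * inverse y) * I) \<le> ennreal (x * y) * ennreal (6 * (p - 1) * (1 + 1))"
      by (intro mult_left_mono) auto
    moreover have "ennreal (x * y) * (ennreal (inverse x * inverse y) * I) = I"
    proof -
      have "ennreal (x * y) * (ennreal (inverse x * inverse y) * I) = ennreal ((x * y) * (inverse x * inverse y)) * I"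
        using xy by (subst ennreal_mult) (auto simp: mult.assoc)
      also have "(x * y) * (inverse x * inverse y) = 1" using xy by (simp add: field_simps)
      finally show ?thesis by simp
    qed
    moreover have "ennreal (x * y) * ennreal (6 * (p - 1) * (1 + 1)) = ennreal (12 * (p - 1) * (x * y))"
      using xy p by (subst ennreal_mult[symmetric]) (auto simp: algebra_simps)
    ultimately show ?thesis unfolding x_def y_def by simp
  qed
  define \<epsilon> where "\<epsilon> k = 1 / (real k + 1)" for k :: nat
  have \<epsilon>0: "\<epsilon> \<longlonglongrightarrow> 0" unfolding \<epsilon>_def by real_asymp
  have "(\<lambda>k. ennreal (12 * (p - 1) * ((a powr (1 / p) + \<epsilon> k) * (b powr (1 / q) + \<epsilon> k)))) \<longlonglongrightarrow>
     ennreal (12 * (p - 1) * ((a powr (1 / p) + 0) * (b powr (1 / q) + 0)))"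
    by (intro tendsto_ennrealI tendsto_intros \<epsilon>0)
  then have "I \<le> ennreal (12 * (p - 1) * ((a powr (1 / p) + 0) * (b powr (1 / q) + 0)))"
    by (rule LIMSEQ_le_const) (intro exI[of _ 0] allI impI eta, simp add: \<epsilon>_def)
  then show ?thesis unfolding I_def a_def b_def Lp_norm_def by (simp add: mult.assoc)
qed

section \<open>Passage to test functions\<close>

lemma gauss_approx_family:
  fixes M :: nat
  assumes "\<And>i. i < M \<Longrightarrow> gauss_approx n (f i)" "e > 0"
  shows "\<exists>A c. finite A \<and> A \<subseteq> multi_indices n \<and> (\<forall>i<M. \<forall>x\<in>Rn n. cmod (hermite_sum n A (c i) x - f i x) \<le> e * gauss n x)"
proof -
  have "\<forall>i. \<exists>A c. i < M \<longrightarrow> finite A \<and> A \<subseteq> multi_indices n \<and> (\<forall>x\<in>Rn n. cmod (hermite_sum n A c x - f i x) \<le> e * gauss n x)"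
    using assms unfolding weighted_closure_def hermite_span_def by metis
  then obtain A c where Ac: "\<And>i. i < M \<Longrightarrow> finite (A i)" "\<And>i. i < M \<Longrightarrow> A i \<subseteq> multi_indices n"
    "\<And>i x. i < M \<Longrightarrow> x \<in> Rn n \<Longrightarrow> cmod (hermite_sum n (A i) (c i) x - f i x) \<le> e * gauss n x"
    by metis
  define B where "B = (\<Union>i<M. A i)"
  have B: "finite B" "B \<subseteq> multi_indices n" unfolding B_def using Ac(1,2) by auto
  have "hermite_sum n (A i) (c i) x = hermite_sum n B (\<lambda>\<alpha>. if \<alpha> \<in> A i then c i \<alpha> else 0) x" if "i < M" for i x
    using that Ac(1) B by (intro hermite_sum_extend) (auto simp: B_def)
  then show ?thesis
    using Ac(3) B by (intro exI[of _ B] exI[of _ "\<lambda>i \<alpha>. if \<alpha> \<in> A i then c i \<alpha> else 0"]) auto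
qed

text \<open>One sequence of Hermite sums handles both sides of the estimate: an error relative to
  \<open>gauss\<close> gives convergence of the coefficients at a uniform rate, hence of the star
  norms at every point, and by domination convergence of the L^p norms for every
  \<open>p \<ge> 1\<close>.\<close>

lemma test_function_approximation:
  assumes "test_function n M f"
  obtains A c B where "\<And>k. finite (A k)" "\<And>k. A k \<subseteq> multi_indices n"
    "B \<ge> 0" "\<And>i \<alpha>. i < M \<Longrightarrow> cmod (hermite_coeff n \<alpha> (\<lambda>y. f y i)) \<le> B * hermite_weight n \<alpha>"
    "\<And>x t. n \<ge> 1 \<Longrightarrow> t > 0 \<Longrightarrow> (\<lambda>k. star_series n M (A k) (c k) x t) \<longlonglongrightarrow>
       star_series n M (multi_indices n) (\<lambda>i \<alpha>. hermite_coeff n \<alpha> (\<lambda>y. f y i)) x t"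
    "\<And>p. p \<ge> 1 \<Longrightarrow> (\<lambda>k. Lp_norm n M p (\<lambda>x i. hermite_sum n (A k) (c k i) x)) \<longlonglongrightarrow> Lp_norm n M p f"
proof -
  define e where "e k = 1 / (real k + 1)" for k :: nat
  have e: "0 < e k" "e k \<le> 1" for k by (auto simp: e_def)
  have e0: "e \<longlonglongrightarrow> 0" unfolding e_def by real_asymp
  have ap: "gauss_approx n (\<lambda>x. f x i)" if "i < M" for i
  proof (rule gauss_approx_compact_support)
    have "\<forall>js. set js \<subseteq> {..<n} \<longrightarrow> continuous_on (Rn n) (foldr partial js (\<lambda>x. f x i))"
      using assms that unfolding test_function_def smooth_Rn_def by blast
    from this[rule_format, of "[]"] show "continuous_on (Rn n) (\<lambda>x. f x i)" by simp
    show "compact (closure {x \<in> Rn n. f x i \<noteq> 0})"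
      using assms that unfolding test_function_def by blast
  qed
  have "\<forall>k. \<exists>A c. finite A \<and> A \<subseteq> multi_indices n \<and> (\<forall>i<M. \<forall>x\<in>Rn n. cmod (hermite_sum n A (c i) x - f x i) \<le> e k * gauss n x)"
    using gauss_approx_family[of M n "\<lambda>i x. f x i", OF ap e(1)] by blast
  then obtain A c where A: "\<And>k. finite (A k)" "\<And>k. A k \<subseteq> multi_indices n"
    and c: "\<And>k i x. i < M \<Longrightarrow> x \<in> Rn n \<Longrightarrow> cmod (hermite_sum n (A k) (c k i) x - f x i) \<le> e k * gauss n x"
    by metis
  have g: "gauss n x > 0" for x by (rule gauss_pos)
  \<comment> \<open>A Gaussian bound for \<open>f\<close> itself is read off from the approximation
    with index 0, whose error is at most \<open>gauss n x\<close>; one more \<open>gauss n x\<close>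
    then covers all the other approximations.\<close>
  obtain K0 where K0: "K0 \<ge> 0" "\<And>i x. i < M \<Longrightarrow> cmod (hermite_sum n (A 0) (c 0 i) x) \<le> K0 * gauss n x"
    using hermite_sums_gauss_bound[of M n "A 0" "c 0"] by blast
  define K where "K = K0 + 2"
  have K: "K \<ge> 0" using K0(1) by (simp add: K_def)
  have ek: "e k * gauss n x \<le> gauss n x" for k x using e(2)[of k] g[of x] by (simp add: mult_left_le_one_le e(1) less_imp_le)
  have fb': "cmod (f x i) \<le> (K0 + 1) * gauss n x" if "i < M" "x \<in> Rn n" for i x
    using norm_triangle_ineq3[of "hermite_sum n (A 0) (c 0 i) x" "f x i"] c[OF that, of 0] K0(2)[OF that(1), of x] ek[of 0 x]
    by (simp add: algebra_simps abs_le_iff)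
  have fb: "cmod (f x i) \<le> K * gauss n x" if "i < M" "x \<in> Rn n" for i x
    using fb'[OF that] g[of x] by (simp add: K_def algebra_simps)
  have hb: "cmod (hermite_sum n (A k) (c k i) x) \<le> K * gauss n x" if "i < M" "x \<in> Rn n" for k i x
    using norm_triangle_ineq2[of "hermite_sum n (A k) (c k i) x" "f x i"] c[OF that, of k] fb'[OF that] ek[of k x]
    by (simp add: K_def algebra_simps)
  have lim: "(\<lambda>k. hermite_sum n (A k) (c k i) x) \<longlonglongrightarrow> f x i" if "i < M" "x \<in> Rn n" for i x
  proof (rule LIM_zero_cancel, rule Lim_null_comparison[OF always_eventually[OF allI]])
    show "cmod (hermite_sum n (A k) (c k i) x - f x i) \<le> e k * gauss n x" for k by (rule c[OF that])
    show "(\<lambda>k. e k * gauss n x) \<longlonglongrightarrow> 0" by (rule tendsto_mult_left_zero[OF e0])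
  qed
  \<comment> \<open>Measurability for the product sigma-algebra is obtained from the pointwise limit
    of Hermite sums, not from continuity.\<close>
  have fm [measurable]: "(\<lambda>x. f x i) \<in> borel_measurable (lebesgue_Rn n)" if "i < M" for i
    by (rule borel_measurable_LIMSEQ_metric[of "\<lambda>k. hermite_sum n (A k) (c k i)"])
       (use lim[OF that] in \<open>auto simp: space_lebesgue_Rn\<close>)
  define G where "G = (\<integral>x. gauss n x \<partial>lebesgue_Rn n)"
  have G: "G \<ge> 0" unfolding G_def using g by (intro integral_nonneg_AE AE_I2) (simp add: less_imp_le)
  have cb: "cmod (hermite_coeff n \<alpha> (\<lambda>y. f y i)) \<le> (K * G) * hermite_weight n \<alpha>" if "i < M" for i \<alpha>
    using hermite_coeff_bound[OF fm[OF that] fb[OF that] K] unfolding G_def .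
  have cd: "cmod ((if \<alpha> \<in> A k then c k i \<alpha> else 0) - hermite_coeff n \<alpha> (\<lambda>y. f y i)) \<le> (e k * G) * hermite_weight n \<alpha>"
    if "i < M" "\<alpha> \<in> multi_indices n" for k i \<alpha>
  proof -
    have "(if \<alpha> \<in> A k then c k i \<alpha> else 0) - hermite_coeff n \<alpha> (\<lambda>y. f y i) = hermite_coeff n \<alpha> (\<lambda>x. hermite_sum n (A k) (c k i) x - f x i)"
      using hermite_coeff_diff[OF measurable_hermite_sum fm[OF that(1)] hb[OF that(1)] fb[OF that(1)] K K, where \<alpha> = \<alpha>]
      unfolding hermite_coeff_hermite_sum[OF A that(2)] by simp
    also have "cmod \<dots> \<le> e k * G * hermite_weight n \<alpha>"
      unfolding G_def using fm[OF that(1)] c[OF that(1)] e(1)[of k] by (intro hermite_coeff_bound) auto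
    finally show ?thesis .
  qed
  have eG: "e k * G \<ge> 0" for k using e(1)[of k] G by simp
  have ek0: "(\<lambda>k. e k * G) \<longlonglongrightarrow> 0" by (rule tendsto_mult_left_zero[OF e0])
  have S: "(\<lambda>k. star_series n M (A k) (c k) x t) \<longlonglongrightarrow> star_series n M (multi_indices n) (\<lambda>i \<alpha>. hermite_coeff n \<alpha> (\<lambda>y. f y i)) x t"
    if "n \<ge> 1" "t > 0" for x t
  proof -
    have "(\<lambda>k. star_series n M (multi_indices n) (\<lambda>i \<alpha>. if \<alpha> \<in> A k then c k i \<alpha> else 0) x t)
      \<longlonglongrightarrow> star_series n M (multi_indices n) (\<lambda>i \<alpha>. hermite_coeff n \<alpha> (\<lambda>y. f y i)) x t"
      using K G by (intro star_series_tendsto[OF that(2,1) _ cb cd eG ek0]) auto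
    then show ?thesis unfolding star_series_restrict[OF A(2)] .
  qed
  have L: "(\<lambda>k. Lp_norm n M p (\<lambda>x i. hermite_sum n (A k) (c k i) x)) \<longlonglongrightarrow> Lp_norm n M p f" if p: "p \<ge> 1" for p
  proof -
    have "(\<lambda>k. \<integral>x. norm_CN M (\<lambda>i. hermite_sum n (A k) (c k i) x) powr p \<partial>lebesgue_Rn n) \<longlonglongrightarrow> (\<integral>x. norm_CN M (f x) powr p \<partial>lebesgue_Rn n)"
    proof (rule integral_dominated_convergence[where w = "\<lambda>x. (real M * K\<^sup>2) powr (p / 2) * gauss n x"])
      show "integrable (lebesgue_Rn n) (\<lambda>x. (real M * K\<^sup>2) powr (p / 2) * gauss n x)"
        by (intro integrable_mult_right integrable_gauss)
      show "(\<lambda>x. norm_CN M (f x) powr p) \<in> borel_measurable (lebesgue_Rn n)"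
        by (intro powr_real_measurable measurable_norm_CN fm borel_measurable_const)
      show "(\<lambda>x. norm_CN M (\<lambda>i. hermite_sum n (A k) (c k i) x) powr p) \<in> borel_measurable (lebesgue_Rn n)" for k
        by (intro powr_real_measurable measurable_norm_CN measurable_hermite_sum borel_measurable_const)
      show "AE x in lebesgue_Rn n. (\<lambda>k. norm_CN M (\<lambda>i. hermite_sum n (A k) (c k i) x) powr p) \<longlonglongrightarrow> norm_CN M (f x) powr p"
      proof (intro AE_I2)
        fix x assume "x \<in> space (lebesgue_Rn n)"
        then have "(\<lambda>k. norm_CN M (\<lambda>i. hermite_sum n (A k) (c k i) x)) \<longlonglongrightarrow> norm_CN M (f x)"
          unfolding norm_CN_def L2_set_def by (intro tendsto_intros lim) (auto simp: space_lebesgue_Rn)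
        then show "(\<lambda>k. norm_CN M (\<lambda>i. hermite_sum n (A k) (c k i) x) powr p) \<longlonglongrightarrow> norm_CN M (f x) powr p"
          using p by (intro tendsto_powr' tendsto_const) (auto simp: norm_CN_nonneg)
      qed
      show "AE x in lebesgue_Rn n. norm (norm_CN M (\<lambda>i. hermite_sum n (A k) (c k i) x) powr p) \<le> (real M * K\<^sup>2) powr (p / 2) * gauss n x" for k
      proof (intro AE_I2)
        fix x assume "x \<in> space (lebesgue_Rn n)"
        then have "norm_CN M (\<lambda>i. hermite_sum n (A k) (c k i) x) powr p \<le> (real M * K\<^sup>2) powr (p / 2) * gauss n x"
          using hb p by (intro norm_CN_powr_gauss_bound) (auto simp: space_lebesgue_Rn)
        then show "norm (norm_CN M (\<lambda>i. hermite_sum n (A k) (c k i) x) powr p) \<le> (real M * K\<^sup>2) powr (p / 2) * gauss n x"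
          by simp
      qed
    qed
    then show ?thesis
      unfolding Lp_norm_def using p by (intro tendsto_powr' tendsto_const) (auto intro!: always_eventually integral_nonneg_AE)
  qed
  show ?thesis
    by (rule that[OF A _ cb S L]) (use K G in auto)
qed

text \<open>Fatou's lemma is used in \<open>x\<close> at fixed time and then in \<open>t\<close>; in
  between, the factor \<open>t\<close> passes through the lower limit by continuity and
  monotonicity.\<close>

lemma half_space_integral_liminf:
  assumes meas: "\<And>k. (\<lambda>z. h k (snd z) (fst z)) \<in> borel_measurable (borel \<Otimes>\<^sub>M lebesgue_Rn n)"
    and lim: "\<And>x t. x \<in> Rn n \<Longrightarrow> t > 0 \<Longrightarrow> (\<lambda>k. h k x t) \<longlonglongrightarrow> h' x t"
  shows "half_space_integral n h' \<le> liminf (\<lambda>k. half_space_integral n (h k))"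
proof -
  interpret L: sigma_finite_measure "lebesgue_Rn n" by (rule sigma_finite_lebesgue_Rn)
  have mx [measurable]: "(\<lambda>x. h k x t) \<in> borel_measurable (lebesgue_Rn n)" for k t
    using measurable_compose[OF measurable_Pair1' meas, of t] by simp
  have mt [measurable]: "(\<lambda>t. \<integral>\<^sup>+x. ennreal (h k x t) \<partial>lebesgue_Rn n) \<in> borel_measurable lborel" for k
  proof -
    have "(\<lambda>z. h k (snd z) (fst z)) \<in> borel_measurable (lborel \<Otimes>\<^sub>M lebesgue_Rn n)"
      using meas[of k] by (simp cong: measurable_cong_sets)
    then show ?thesis by (intro L.borel_measurable_nn_integral) (simp add: case_prod_beta)
  qed
  have "half_space_integral n h' \<le> (\<integral>\<^sup>+t. liminf (\<lambda>k. (\<integral>\<^sup>+x. ennreal (h k x t) \<partial>lebesgue_Rn n) * ennreal t * indicator {0<..} t) \<partial>lborel)"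
    unfolding half_space_integral_def
  proof (rule nn_integral_mono)
    fix t :: real
    show "(\<integral>\<^sup>+x. ennreal (h' x t) \<partial>lebesgue_Rn n) * ennreal t * indicator {0<..} t
      \<le> liminf (\<lambda>k. (\<integral>\<^sup>+x. ennreal (h k x t) \<partial>lebesgue_Rn n) * ennreal t * indicator {0<..} t)"
    proof (cases "t > 0")
      case True
      have "(\<integral>\<^sup>+x. ennreal (h' x t) \<partial>lebesgue_Rn n) = (\<integral>\<^sup>+x. liminf (\<lambda>k. ennreal (h k x t)) \<partial>lebesgue_Rn n)"
      proof (rule nn_integral_cong)
        fix x assume "x \<in> space (lebesgue_Rn n)"
        then have "(\<lambda>k. ennreal (h k x t)) \<longlonglongrightarrow> ennreal (h' x t)"
          using lim True by (intro tendsto_ennrealI) (auto simp: space_lebesgue_Rn)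
        then show "ennreal (h' x t) = liminf (\<lambda>k. ennreal (h k x t))" by (simp add: lim_imp_Liminf)
      qed
      also have "\<dots> \<le> liminf (\<lambda>k. \<integral>\<^sup>+x. ennreal (h k x t) \<partial>lebesgue_Rn n)"
        by (rule nn_integral_liminf) measurable
      finally have "ennreal t * (\<integral>\<^sup>+x. ennreal (h' x t) \<partial>lebesgue_Rn n) \<le> ennreal t * liminf (\<lambda>k. \<integral>\<^sup>+x. ennreal (h k x t) \<partial>lebesgue_Rn n)"
        by (rule mult_left_mono) simp
      also have "\<dots> = liminf (\<lambda>k. ennreal t * (\<integral>\<^sup>+x. ennreal (h k x t) \<partial>lebesgue_Rn n))"
        by (rule Liminf_compose_continuous_mono[symmetric])
           (auto intro!: ennreal_continuous_on_cmult continuous_on_id monoI mult_left_mono)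
      finally show ?thesis using True by (simp add: mult.commute)
    qed simp
  qed
  also have "\<dots> \<le> liminf (\<lambda>k. half_space_integral n (h k))"
    unfolding half_space_integral_def by (rule nn_integral_liminf) measurable
  finally show ?thesis .
qed

lemma embedding_ge_2:
  assumes n: "n \<ge> 1" and f: "test_function n M f" and g: "test_function n N g" and p: "p \<ge> 2" "q = p / (p - 1)"
  shows "half_space_integral n (\<lambda>x t. star_norm n M (\<lambda>y s. poisson n s f y) x t * star_norm n N (\<lambda>y s. poisson n s g y) x t)
    \<le> ennreal (12 * (p - 1) * Lp_norm n M p f * Lp_norm n N q g)"
proof -
  have q: "q > 1" using p by (simp add: less_divide_eq)
  obtain A c B where A: "\<And>k. finite (A k)" "\<And>k. A k \<subseteq> multi_indices n"
    and "B \<ge> 0" and B: "\<And>i \<alpha>. i < M \<Longrightarrow> cmod (hermite_coeff n \<alpha> (\<lambda>y. f y i)) \<le> B * hermite_weight n \<alpha>"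
    and S: "\<And>x t. n \<ge> 1 \<Longrightarrow> t > 0 \<Longrightarrow> (\<lambda>k. star_series n M (A k) (c k) x t) \<longlonglongrightarrow>
       star_series n M (multi_indices n) (\<lambda>i \<alpha>. hermite_coeff n \<alpha> (\<lambda>y. f y i)) x t"
    and L: "\<And>p. p \<ge> 1 \<Longrightarrow> (\<lambda>k. Lp_norm n M p (\<lambda>x i. hermite_sum n (A k) (c k i) x)) \<longlonglongrightarrow> Lp_norm n M p f"
    by (rule test_function_approximation[OF f]) (rule that)
  obtain A' d B' where A': "\<And>k. finite (A' k)" "\<And>k. A' k \<subseteq> multi_indices n"
    and "B' \<ge> 0" and B': "\<And>i \<alpha>. i < N \<Longrightarrow> cmod (hermite_coeff n \<alpha> (\<lambda>y. g y i)) \<le> B' * hermite_weight n \<alpha>"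
    and S': "\<And>x t. n \<ge> 1 \<Longrightarrow> t > 0 \<Longrightarrow> (\<lambda>k. star_series n N (A' k) (d k) x t) \<longlonglongrightarrow>
       star_series n N (multi_indices n) (\<lambda>i \<alpha>. hermite_coeff n \<alpha> (\<lambda>y. g y i)) x t"
    and L': "\<And>p. p \<ge> 1 \<Longrightarrow> (\<lambda>k. Lp_norm n N p (\<lambda>x i. hermite_sum n (A' k) (d k i) x)) \<longlonglongrightarrow> Lp_norm n N p g"
    by (rule test_function_approximation[OF g]) (rule that)
  have "half_space_integral n (\<lambda>x t. star_norm n M (\<lambda>y s. poisson n s f y) x t * star_norm n N (\<lambda>y s. poisson n s g y) x t)
     \<le> liminf (\<lambda>k. half_space_integral n (\<lambda>x t. star_series n M (A k) (c k) x t * star_series n N (A' k) (d k) x t))"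
  proof (rule half_space_integral_liminf)
    show "(\<lambda>z. star_series n M (A k) (c k) (snd z) (fst z) * star_series n N (A' k) (d k) (snd z) (fst z)) \<in> borel_measurable (borel \<Otimes>\<^sub>M lebesgue_Rn n)" for k
      by (intro borel_measurable_times measurable_star_ser_finite A A')
    show "(\<lambda>k. star_series n M (A k) (c k) x t * star_series n N (A' k) (d k) x t) \<longlonglongrightarrow>
      star_norm n M (\<lambda>y s. poisson n s f y) x t * star_norm n N (\<lambda>y s. poisson n s g y) x t" if t: "t > 0" for x t
    proof -
      have 1: "star_norm n M (\<lambda>y s. poisson n s f y) x t = star_series n M (multi_indices n) (\<lambda>i \<alpha>. hermite_coeff n \<alpha> (\<lambda>y. f y i)) x t"
        by (rule star_norm_poisson[OF t n B])
      have 2: "star_norm n N (\<lambda>y s. poisson n s g y) x t = star_series n N (multi_indices n) (\<lambda>i \<alpha>. hermite_coeff n \<alpha> (\<lambda>y. g y i)) x t"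
        by (rule star_norm_poisson[OF t n B'])
      show ?thesis unfolding 1 2 by (intro tendsto_mult S S' n t)
    qed
  qed
  also have "\<dots> \<le> liminf (\<lambda>k. ennreal (12 * (p - 1) * Lp_norm n M p (\<lambda>x i. hermite_sum n (A k) (c k i) x)
       * Lp_norm n N q (\<lambda>x i. hermite_sum n (A' k) (d k i) x)))"
    by (intro Liminf_mono always_eventually allI finite_estimate n A A' p)
  also have "\<dots> = ennreal (12 * (p - 1) * Lp_norm n M p f * Lp_norm n N q g)"
    using p q by (intro lim_imp_Liminf tendsto_ennrealI tendsto_mult tendsto_const L L') auto
  finally show ?thesis .
qed

text \<open>Here the only eigenvalue is 0 and there is no decay in time, but the extension is
  constant in time and there are no spatial terms.\<close>

lemma star_norm_dim_0: "star_norm 0 N (\<lambda>y s. poisson 0 s f y) x t = 0"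
proof -
  have "poisson 0 s f x i = poisson 0 0 f x i" for s i
    by (simp add: poisson_def hermite_calculus_def hermite_eigenvalue_def)
  then have "vector_derivative (\<lambda>s. poisson 0 s f x i) (at t) = 0" for i
    by (metis (no_types, lifting) vector_derivative_const_at ext)
  then show ?thesis by (simp add: star_norm_def norm_CN_def norm_Rn_def L2_set_def)
qed

theorem theorem1:
  "\<exists>C::real. C > 0 \<and>
     (\<forall>(M::nat) (N::nat) (n::nat)
        (f :: (nat \<Rightarrow> real) \<Rightarrow> nat \<Rightarrow> complex) (g :: (nat \<Rightarrow> real) \<Rightarrow> nat \<Rightarrow> complex)
        (p::real) (q::real) (pstar::real).
        test_function n M f \<longrightarrow> test_function n N g \<longrightarrow>
        p > 1 \<longrightarrow> q = p / (p - 1) \<longrightarrow> pstar = max p q \<longrightarrow>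
        (\<integral>\<^sup>+t\<in>{0<..}.
           ((\<integral>\<^sup>+x. ennreal (star_norm n M (\<lambda>y s. poisson n s f y) x t *
                          star_norm n N (\<lambda>y s. poisson n s g y) x t) \<partial>lebesgue_Rn n) * ennreal t) \<partial>lborel)
        \<le> ennreal (C * (pstar - 1) * Lp_norm n M p f * Lp_norm n N q g))"
proof (intro exI[of _ 12] conjI allI impI)
  fix M N n f g and p q pstar :: real
  assume f: "test_function n M f" and g: "test_function n N g" and p: "p > 1" and q: "q = p / (p - 1)"
    and ps: "pstar = max p q"
  have "half_space_integral n (\<lambda>x t. star_norm n M (\<lambda>y s. poisson n s f y) x t * star_norm n N (\<lambda>y s. poisson n s g y) x t)
    \<le> ennreal (12 * (pstar - 1) * Lp_norm n M p f * Lp_norm n N q g)"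
  proof (cases "n = 0")
    case True
    then show ?thesis by (simp add: star_norm_dim_0 half_space_integral_def)
  next
    case False
    then have n: "n \<ge> 1" by simp
    show ?thesis
    proof (cases "p \<ge> 2")
      case True
      then have "q \<le> p" using q by (simp add: divide_le_eq)
      then show ?thesis using embedding_ge_2[OF n f g True q] ps by (simp add: max_absorb1)
    next
      \<comment> \<open>The left-hand side is symmetric in \<open>f\<close> and \<open>g\<close>, so
        for \<open>p < 2\<close> they exchange roles: \<open>q \<ge> 2\<close>, and \<open>p\<close>
        is the exponent conjugate to \<open>q\<close>.\<close>
      case False
      have q2: "q \<ge> 2" unfolding q using p False by (simp add: le_divide_eq)
      moreover have "q \<ge> p" using q2 False by simp
      moreover have p': "p = q / (q - 1)"
      proof -
        have "q - 1 = 1 / (p - 1)" unfolding q using p by (simp add: field_simps)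
        then show ?thesis using p by (simp add: q)
      qed
      ultimately have q2: "q \<ge> 2" "q \<ge> p" and p': "p = q / (q - 1)" by blast+
      show ?thesis
        using embedding_ge_2[OF n g f q2(1) p'] ps q2(2) by (simp add: max_absorb2 mult_ac)
    qed
  qed
  then show "(\<integral>\<^sup>+t\<in>{0<..}.
           ((\<integral>\<^sup>+x. ennreal (star_norm n M (\<lambda>y s. poisson n s f y) x t *
                          star_norm n N (\<lambda>y s. poisson n s g y) x t) \<partial>lebesgue_Rn n) * ennreal t) \<partial>lborel)
        \<le> ennreal (12 * (pstar - 1) * Lp_norm n M p f * Lp_norm n N q g)"
    unfolding half_space_integral_def .
qed simp

end
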